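(* Let $h_0\in L^\infty(\mathbb{R})$ be nonnegative and such that the function $$m_0(\theta):=\sum_{k\in\mathbb{Z}}e^{\alpha(k+\theta)}h_0(k+\theta),\qquad\theta\in[0,1),$$ belongs to $L^1(0,1)$. Let $h$ be the solution of $$\partial_t h(t,x)=\partial_x h(t,x)+\alpha h(t,x)+e^{-\alpha}h^2(t,x-1)-h^2(t,x),\qquad t>0,\ x\in\mathbb{R},$$ with initial condition $h(0,\cdot)=h_0$. Then $h$ converges to a stationary solution as $t\to\infty$, i.e. there exists a stationary solution $h_\infty$ with $$\lim_{t\to\infty}\int_{\mathbb{R}}e^{\alpha x}|h(t,x)-h_\infty(x)|\,dx=0,$$ if and only if $m_0$ is constant almost everywhere in $[0,1)$.
   Context: Let $\gamma<1$ and $\alpha:=(1-\gamma)\ln 2>0$. Solution of the evolution equation: fixing a nonnegative bounded representative of $h_0$, the solution $h$ is the nonnegative function on $[0,\infty)\times\mathbb{R}$, bounded on $[0,T]\times\mathbb{R}$ for every $T>0$, with $h(0,\cdot)=h_0$, that satisfies the equation along characteristics: for every $y\in\mathbb{R}$ the function $t\mapsto h(t,y-t)$ is $C^1$ on $[0,\infty)$ and $$\frac{d}{dt}\big[h(t,y-t)\big]=\alpha h(t,y-t)+e^{-\alpha}h^2(t,y-t-1)-h^2(t,y-t).$$ A stationary solution is a nonnegative function $h_\infty\in C^1(\mathbb{R})\cap L^1(\mathbb{R};e^{\alpha x}dx)$ (the zero function is allowed) satisfying $$0=\partial_x h_\infty(x)+\alpha h_\infty(x)+e^{-\alpha}h_\infty^2(x-1)-h_\infty^2(x),\qquad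 x\in\mathbb{R}.$$ *)

theory Defs
  imports "HOL-Analysis.Analysis"
begin

definition alpha :: "real \<Rightarrow> real" where
  "alpha \<gamma> = (1 - \<gamma>) * ln 2"

(* A (classical, along characteristics) solution on [0,oo) x R; values h t x with t < 0 are
   irrelevant.  The derivative at t = 0 is one-sided, and the continuity clause for the derivative
   is the C^1 requirement. The right-hand side is the equation evaluated at x = y - t. *)
definition is_solution :: "real \<Rightarrow> (real \<Rightarrow> real) \<Rightarrow> (real \<Rightarrow> real \<Rightarrow> real) \<Rightarrow> bool" where
  "is_solution a h0 h \<longleftrightarrow>
     (\<forall>t\<ge>0. \<forall>x. h t x \<ge> 0) \<and>
     (\<forall>T>0. bounded ((\<lambda>(t, x). h t x) ` ({0..T} \<times> UNIV))) \<and>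
     (\<forall>x. h 0 x = h0 x) \<and>
     (\<forall>y. let F = (\<lambda>t. a * h t (y - t) + exp (- a) * (h t (y - t - 1))\<^sup>2 - (h t (y - t))\<^sup>2) in
        continuous_on {0..} F \<and>
        (\<forall>t\<ge>0. ((\<lambda>s. h s (y - s)) has_real_derivative F t) (at t within {0..})))"

definition is_stationary :: "real \<Rightarrow> (real \<Rightarrow> real) \<Rightarrow> bool" where
  "is_stationary a h \<longleftrightarrow>
     (\<forall>x. h x \<ge> 0) \<and>
     h C1_differentiable_on UNIV \<and>
     integrable lebesgue (\<lambda>x. exp (a * x) * h x) \<and>
     (\<forall>x. 0 = deriv h x + a * h x + exp (- a) * (h (x - 1))\<^sup>2 - (h x)\<^sup>2)"

(* Taken in [0,oo], so that a divergent series has value oo rather than a default value. *)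
definition m0 :: "real \<Rightarrow> (real \<Rightarrow> real) \<Rightarrow> real \<Rightarrow> ennreal" where
  "m0 a h0 \<theta> =
     (\<Sum>\<^sub>\<infinity>k\<in>(UNIV :: int set). ennreal (exp (a * (of_int k + \<theta>)) * h0 (of_int k + \<theta>)))"

end

theory Submission
  imports Defs
begin

text \<open>
Write \<open>x = y + k - t\<close> with \<open>k\<close> an integer. Along a characteristic the point \<open>y + k\<close> is fixed, and the
equation at \<open>x\<close> only involves the values at \<open>x\<close> and \<open>x - 1\<close>. The problem therefore splits into
independent problems on the fibres \<open>y + \<int>\<close>. On one fibre let \<open>V k t\<close> be the sum of
\<open>exp (a x) h(t, x)\<close> over all points \<open>y + j - t\<close> with \<open>j \<le> k\<close>. The linear term cancels against the weight,
the quadratic terms telescope, and what remains is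
\<open>V k' = - exp (- a x) (V k - V (k - 1))\<^sup>2\<close>.
Two consequences carry the proof.

The total mass of a fibre, the limit of \<open>V k t\<close> as \<open>k \<rightarrow> \<infinity>\<close>, does not depend on \<open>t\<close>: no mass
escapes at either end, because barriers of the form \<open>C exp (a x)\<close> on the left (\<open>flow_left_tail\<close>) and
\<open>e + M exp (x0 - x)\<close> on the right (\<open>flow_right_tail\<close>) confine it uniformly in time.

The difference \<open>D\<close> of two such flows satisfies an upwind transport equation
\<open>D k' = - w (D k - D (k - 1))\<close> with \<open>w \<ge> 0\<close>, so \<open>D\<close> obeys a maximum principle that is proved by induction
on \<open>k\<close> from the left (\<open>lattice_barrier\<close>). If both flows have the same mass, \<open>D\<close> is small outside a window
\<open>[- R, R]\<close> in the variable \<open>x\<close>, at all times. A characteristic crosses this window from the right in time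
\<open>2 R\<close>, and \<open>w\<close> is bounded there, so a fixed fraction of the difference between the supremum of
\<open>D\<close> and the small value with which it entered survives. Hence the supremum of \<open>D\<close> contracts towards that value in
each time step \<open>2 R\<close> (\<open>flow_gap_contracts\<close>) and the two flows
merge, first uniformly and then, thanks to the tails, in the sum norm (\<open>flows_merge_l1\<close>).

A nonnegative stationary solution of fibre mass \<open>M\<close> amounts to a bounded monotone solution of
\<open>\<Phi>'(x) = exp (- a x) (\<Phi> x - \<Phi> (x - 1))\<^sup>2\<close> that runs from \<open>0\<close> to \<open>M\<close>; it gives a flow on every fibre. It is obtained
by monotone iteration between explicit lower and upper bounds, the stationary versions of the barriers above
(\<open>exists_stationary_cumulative\<close>).

If the initial fibre mass is almost everywhere equal to \<open>M\<close>, the solution and the stationary solution of mass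
\<open>M\<close> merge on almost every fibre, and dominated convergence with the bound \<open>2 M\<close> gives convergence in the
weighted norm. Conversely, the fibre masses of a stationary solution are constant, because
\<open>exp (a x) hinf x\<close> is an integral over \<open>[x - 1, x]\<close> of one nonnegative function on the line
(\<open>stationary_fibre_sum_constant\<close>); since the fibre masses of the solution are conserved, convergence forces the
initial ones to agree with this constant.
\<close>


section \<open>Integrals over the line as integrals of sums over fibres\<close>

lemma sum_le_nn_integral_count_space:
  fixes f :: "'a \<Rightarrow> ennreal"
  assumes "finite F"
  shows "sum f F \<le> (\<integral>\<^sup>+k. f k \<partial>count_space UNIV)"
proof -
  have "sum f F = (\<integral>\<^sup>+k. f k \<partial>count_space F)"
    using assms by (simp add: nn_integral_count_space_finite)
  also have "\<dots> = (\<integral>\<^sup>+k. f k * indicator F k \<partial>count_space UNIV)"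
    by (rule nn_integral_count_space_indicator) simp
  also have "\<dots> \<le> (\<integral>\<^sup>+k. f k \<partial>count_space UNIV)"
    by (rule nn_integral_mono) (auto simp: indicator_def)
  finally show ?thesis .
qed

text \<open>
A sum over the integers is bounded as soon as its finite partial sums are; an enumeration of the
integers turns it into a series.
\<close>
lemma nn_integral_count_space_le:
  fixes f :: "int \<Rightarrow> ennreal"
  assumes "\<And>F. finite F \<Longrightarrow> sum f F \<le> B"
  shows "(\<integral>\<^sup>+k. f k \<partial>count_space UNIV) \<le> B"
proof -
  have "(\<integral>\<^sup>+k. f k \<partial>count_space UNIV) = (\<integral>\<^sup>+n. f (int_decode n) \<partial>count_space UNIV)"
    by (rule nn_integral_bij_count_space[symmetric]) (rule bij_int_decode)
  also have "\<dots> = (\<Sum>n. f (int_decode n))"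
    by (rule nn_integral_count_space_nat)
  also have "\<dots> \<le> B"
  proof (rule suminf_le_const)
    fix n
    have "(\<Sum>i<n. f (int_decode i)) = sum f (int_decode ` {..<n})"
      using bij_int_decode by (subst sum.reindex) (auto simp: bij_def inj_on_def)
    also have "\<dots> \<le> B" by (rule assms) simp
    finally show "(\<Sum>i<n. f (int_decode i)) \<le> B" .
  qed simp
  finally show ?thesis .
qed

lemma infsum_eq_nn_integral_count_space:
  fixes f :: "int \<Rightarrow> ennreal"
  shows "infsum f UNIV = (\<integral>\<^sup>+k. f k \<partial>count_space UNIV)"
proof -
  have eq: "infsum f UNIV = (SUP F\<in>{F. finite F \<and> F \<subseteq> UNIV}. sum f F)"
    by (rule nonneg_infsum_complete) simp
  show ?thesis
  proof (rule antisym)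
    show "infsum f UNIV \<le> (\<integral>\<^sup>+k. f k \<partial>count_space UNIV)"
      unfolding eq by (auto intro!: SUP_least sum_le_nn_integral_count_space)
    show "(\<integral>\<^sup>+k. f k \<partial>count_space UNIV) \<le> infsum f UNIV"
      unfolding eq by (auto intro!: nn_integral_count_space_le SUP_upper2)
  qed
qed

lemma measurable_translate_lebesgue:
  fixes f :: "real \<Rightarrow> 'b::topological_space"
  assumes "f \<in> borel_measurable lebesgue"
  shows "(\<lambda>x. f (c + x)) \<in> borel_measurable lebesgue"
proof -
  have "(\<lambda>x::real. c + x) \<in> lebesgue \<rightarrow>\<^sub>M lebesgue"
    using lebesgue_affine_measurable[where c="\<lambda>_. 1" and t=c] by simp
  from measurable_compose[OF this assms] show ?thesis .
qed

lemma nn_integral_translate_lebesgue: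
  fixes f :: "real \<Rightarrow> ennreal"
  assumes "f \<in> borel_measurable lebesgue"
  shows "(\<integral>\<^sup>+x. f (c + x) \<partial>lebesgue) = (\<integral>\<^sup>+x. f x \<partial>lebesgue)"
  using nn_integral_real_affine_lebesgue[OF assms, of 1 c] by simp

text \<open>
Written as an integral for counting measure, so that sums over a fibre \<open>y + \<int>\<close> and Lebesgue integrals may be
exchanged.
\<close>
definition fibre_sum :: "(real \<Rightarrow> ennreal) \<Rightarrow> real \<Rightarrow> ennreal" where
  "fibre_sum f y = (\<integral>\<^sup>+k. f (of_int k + y) \<partial>count_space UNIV)"

lemma m0_eq_fibre_sum: "m0 a h0 = fibre_sum (\<lambda>x. ennreal (exp (a * x) * h0 x))"
  by (simp add: m0_def fibre_sum_def infsum_eq_nn_integral_count_space fun_eq_iff)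

lemma fibre_sum_add: "fibre_sum (\<lambda>x. f x + g x) y = fibre_sum f y + fibre_sum g y"
  unfolding fibre_sum_def by (rule nn_integral_add) auto

lemma fibre_sum_mono: "(\<And>x. f x \<le> g x) \<Longrightarrow> fibre_sum f y \<le> fibre_sum g y"
  unfolding fibre_sum_def by (rule nn_integral_mono) auto

lemma measurable_fibre_sum:
  assumes "f \<in> borel_measurable lebesgue"
  shows "fibre_sum f \<in> borel_measurable lebesgue"
proof -
  have "fibre_sum f = (\<lambda>y. \<Sum>n. f (of_int (int_decode n) + y))"
    unfolding fibre_sum_def
    by (intro ext trans[OF nn_integral_bij_count_space[OF bij_int_decode, symmetric]
          nn_integral_count_space_nat])
  also have "\<dots> \<in> borel_measurable lebesgue"
    by (intro borel_measurable_suminf_order measurable_translate_lebesgue[OF assms])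
  finally show ?thesis .
qed

text \<open>
The unit interval is a fundamental domain for the integer translations: the translates of its indicator
add up to \<open>1\<close> at every point. Inserting this sum under the integral and translating each term back
to the unit interval gives the identity.
\<close>
lemma nn_integral_eq_fibre_sum:
  fixes f :: "real \<Rightarrow> ennreal"
  assumes f[measurable]: "f \<in> borel_measurable lebesgue"
  shows "(\<integral>\<^sup>+x. f x \<partial>lebesgue) = (\<integral>\<^sup>+y\<in>{0..<1}. fibre_sum f y \<partial>lebesgue)"
proof -
  have ind: "(\<integral>\<^sup>+k. indicator {0..<1} (x + of_int k) \<partial>count_space (UNIV::int set)) = (1::ennreal)" for x :: real
  proof -
    have "indicator {0..<1} (x + of_int k) = (indicator {- \<lfloor>x\<rfloor>} k :: ennreal)" for k
    proof -
      have "x + of_int k \<in> {0..<1} \<longleftrightarrow> k = - \<lfloor>x\<rfloor>"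
        by (simp, linarith)
      then show ?thesis by (auto simp: indicator_def)
    qed
    then show ?thesis by simp
  qed
  have shift: "indicator {0..<1} (x + c) = (indicator {- c..<1 - c} x :: ennreal)" for x c :: real
    by (auto simp: indicator_def)
  have meas: "(\<lambda>x. f (of_int k + x)) \<in> borel_measurable lebesgue" for k :: int
    by (rule measurable_translate_lebesgue[OF f])
  have "(\<integral>\<^sup>+y\<in>{0..<1}. fibre_sum f y \<partial>lebesgue)
      = (\<integral>\<^sup>+y. (\<integral>\<^sup>+k. f (of_int k + y) * indicator {0..<1} y \<partial>count_space (UNIV::int set)) \<partial>lebesgue)"
    unfolding fibre_sum_def by (simp add: nn_integral_multc)
  also have "\<dots> = (\<integral>\<^sup>+k. (\<integral>\<^sup>+y. f (of_int k + y) * indicator {0..<1} y \<partial>lebesgue) \<partial>count_space (UNIV::int set))"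
    by (rule nn_integral_count_space_nn_integral) (auto intro!: borel_measurable_times_ennreal meas borel_measurable_indicator)
  also have "\<dots> = (\<integral>\<^sup>+k. (\<integral>\<^sup>+x. f x * indicator {0..<1} (x + of_int k) \<partial>lebesgue) \<partial>count_space (UNIV::int set))"
  proof -
    have s: "(\<integral>\<^sup>+y. f (of_int k + y) * indicator {0..<1} y \<partial>lebesgue)
        = (\<integral>\<^sup>+x. f x * indicator {0..<1} (x + of_int (- k)) \<partial>lebesgue)" for k :: int
    proof -
      have "(\<lambda>x::real. indicator {0..<1} (x + of_int (- k)) :: ennreal) \<in> borel_measurable lebesgue"
        by (simp only: shift) (intro borel_measurable_indicator, simp)
      then have "(\<lambda>x. f x * indicator {0..<1} (x + of_int (- k))) \<in> borel_measurable lebesgue"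
        by (intro borel_measurable_times_ennreal f)
      from nn_integral_translate_lebesgue[OF this, of "of_int k"] show ?thesis
        by simp
    qed
    have "bij (uminus :: int \<Rightarrow> int)" by (rule bij_uminus)
    from nn_integral_bij_count_space[OF this, of "\<lambda>k. (\<integral>\<^sup>+x. f x * indicator {0..<1} (x + of_int k) \<partial>lebesgue)"]
    show ?thesis by (simp only: s)
  qed
  also have "\<dots> = (\<integral>\<^sup>+x. (\<integral>\<^sup>+k. f x * indicator {0..<1} (x + of_int k) \<partial>count_space (UNIV::int set)) \<partial>lebesgue)"
  proof (rule nn_integral_count_space_nn_integral[symmetric])
    show "countable (UNIV :: int set)" by simp
    fix k :: int
    have "(\<lambda>x::real. indicator {0..<1} (x + of_int k) :: ennreal) \<in> borel_measurable lebesgue"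
      by (simp only: shift) (intro borel_measurable_indicator, simp)
    then show "(\<lambda>x. f x * indicator {0..<1} (x + of_int k)) \<in> borel_measurable lebesgue"
      by (intro borel_measurable_times_ennreal f)
  qed
  also have "\<dots> = (\<integral>\<^sup>+x. f x \<partial>lebesgue)"
    by (simp add: nn_integral_cmult ind)
  finally show ?thesis ..
qed

section \<open>Cumulative masses on a fibre and their comparison principle\<close>

text \<open>
After the last time at which \<open>Z \<le> c\<close> the function would be nonincreasing while it lies above \<open>c\<close>. The
derivative is only controlled where \<open>Z > c\<close>, which is what a comparison with a strict excess provides.
\<close>
lemma barrier:
  fixes Z :: "real \<Rightarrow> real"
  assumes "s \<le> t"
    and der: "\<And>r. s \<le> r \<Longrightarrow> r \<le> t \<Longrightarrow> (Z has_real_derivative Z' r) (at r within {s..t})"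
    and neg: "\<And>r. s \<le> r \<Longrightarrow> r \<le> t \<Longrightarrow> Z r > c \<Longrightarrow> Z' r \<le> 0"
    and init: "Z s \<le> c"
  shows "Z t \<le> c"
proof (rule ccontr)
  assume "\<not> Z t \<le> c"
  then have gt: "Z t > c" by simp
  have cont: "continuous_on {s..t} Z"
    using der by (auto simp: continuous_on_eq_continuous_within intro!: DERIV_continuous)
  define S where "S = {r \<in> {s..t}. Z r \<le> c}"
  have "compact S"
  proof -
    have "closed S"
      unfolding S_def using cont by (intro continuous_closed_preimage_constant continuous_on_closed_Collect_le
          closed_Collect_le continuous_on_const) auto
    moreover have "bounded S"
      by (rule bounded_subset[of "{s..t}"]) (auto simp: S_def)
    ultimately show ?thesis by (simp add: compact_eq_bounded_closed)
  qed
  moreover have "s \<in> S" using init \<open>s \<le> t\<close> by (simp add: S_def)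
  ultimately obtain r where r: "r \<in> S" "\<And>q. q \<in> S \<Longrightarrow> q \<le> r"
    using compact_attains_sup[of S] by auto
  have "r < t" using r(1) gt by (cases "r = t") (auto simp: S_def)
  have above: "Z q > c" if "r < q" "q \<le> t" for q
  proof -
    have "s \<le> q" using r(1) that by (auto simp: S_def)
    moreover have "q \<notin> S" using r(2)[of q] that by auto
    ultimately show ?thesis using that by (auto simp: S_def)
  qed
  have "s \<le> r" using r(1) by (simp add: S_def)
  have "\<exists>q\<in>{r<..<t}. Z t - Z r = Z' q * (t - r)"
  proof (rule mvt_simple[OF \<open>r < t\<close>])
    fix q assume q: "r \<le> q" "q \<le> t"
    have "(Z has_real_derivative Z' q) (at q within {r..t})"
      by (rule has_field_derivative_subset[OF der]) (use q \<open>s \<le> r\<close> in auto)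
    then show "(Z has_derivative (*) (Z' q)) (at q within {r..t})"
      by (simp add: has_field_derivative_def)
  qed
  then obtain q where q: "r < q" "q < t" "Z t - Z r = Z' q * (t - r)" by auto
  have "Z' q \<le> 0" using neg[of q] above[of q] q \<open>s \<le> r\<close> by auto
  then have "Z t - Z r \<le> 0" using q by (simp add: mult_nonpos_nonneg)
  then show False using gt r(1) by (simp add: S_def)
qed

text \<open>
In an upwind equation \<open>Z k\<close> is driven by its left neighbour only. Once \<open>Z (k - 1) \<le> c\<close> is known on the whole time
interval, the scalar barrier applies to \<open>Z k\<close>; the induction starts far on the left, where \<open>Z \<le> c\<close> by
assumption.
\<close>
lemma lattice_barrier:
  fixes Z :: "int \<Rightarrow> real \<Rightarrow> real"
  assumes der: "\<And>k t. s \<le> t \<Longrightarrow> t \<le> T \<Longrightarrow> (Z k has_real_derivative Z' k t) (at t within {s..T})"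
    and neg: "\<And>k t. s \<le> t \<Longrightarrow> t \<le> T \<Longrightarrow> Z k t > c \<Longrightarrow> Z (k - 1) t \<le> c \<Longrightarrow> Z' k t \<le> 0"
    and init: "\<And>k. Z k s \<le> c"
    and left: "\<And>k t. k \<le> K \<Longrightarrow> s \<le> t \<Longrightarrow> t \<le> T \<Longrightarrow> Z k t \<le> c"
    and t: "s \<le> t" "t \<le> T"
  shows "Z k t \<le> c"
proof (cases "k \<le> K")
  case True
  then show ?thesis using left t by blast
next
  case False
  then have "K \<le> k" by simp
  then show ?thesis using t
  proof (induction k arbitrary: t rule: int_ge_induct)
    case base
    then show ?case using left by blast
  next
    case (step i)
    show ?case
    proof (rule barrier[of s t "Z (i + 1)" "Z' (i + 1)"])
      fix r assume r: "s \<le> r" "r \<le> t"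
      show "(Z (i + 1) has_real_derivative Z' (i + 1) r) (at r within {s..t})"
        by (rule has_field_derivative_subset[OF der]) (use r step.prems in auto)
      show "Z' (i + 1) r \<le> 0" if "c < Z (i + 1) r"
        using that step.IH[of r] r step.prems by (intro neg) auto
    qed (use step.prems init in auto)
  qed
qed

text \<open>
The evolution of the cumulative masses on the fibre through \<open>y\<close>; \<open>y + k - t\<close> is the position at time \<open>t\<close> of the
point with index \<open>k\<close>. The last clause says that no mass enters from \<open>- \<infinity>\<close> in finite time; it provides
the start of the induction in \<open>lattice_barrier\<close>.
\<close>
definition cumulative_flow :: "real \<Rightarrow> real \<Rightarrow> (int \<Rightarrow> real \<Rightarrow> real) \<Rightarrow> bool" where
  "cumulative_flow a y V \<longleftrightarrow>
     (\<forall>k. \<forall>t\<ge>0. V (k - 1) t \<le> V k t) \<and>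
     (\<forall>k. \<forall>t\<ge>0. (V k has_real_derivative
        - exp (- a * (y + of_int k - t)) * (V k t - V (k - 1) t)\<^sup>2) (at t within {0..})) \<and>
     (\<forall>T. \<forall>e>0. \<exists>K. \<forall>k\<le>K. \<forall>t\<in>{0..T}. \<bar>V k t\<bar> \<le> e)"

lemma flow_step: "cumulative_flow a y V \<Longrightarrow> 0 \<le> t \<Longrightarrow> V (k - 1) t \<le> V k t"
  by (simp add: cumulative_flow_def)

lemma flow_deriv:
  assumes "cumulative_flow a y V" "0 \<le> s" "s \<le> t" "t \<le> T"
  shows "(V k has_real_derivative
        - exp (- a * (y + of_int k - t)) * (V k t - V (k - 1) t)\<^sup>2) (at t within {s..T})"
  by (rule has_field_derivative_subset[of _ _ _ "{0..}"])
     (use assms in \<open>auto simp: cumulative_flow_def\<close>)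

lemma flow_left:
  assumes "cumulative_flow a y V" "e > 0"
  shows "\<exists>K. \<forall>k\<le>K. \<forall>t\<in>{0..T}. \<bar>V k t\<bar> \<le> e"
  using assms by (simp add: cumulative_flow_def)

lemma flow_mono:
  assumes "cumulative_flow a y V" "0 \<le> t" "j \<le> k"
  shows "V j t \<le> V k t"
  using \<open>j \<le> k\<close>
proof (induction k rule: int_ge_induct)
  case (step i)
  then show ?case using flow_step[OF assms(1,2), of "i + 1"] by simp
qed simp

lemma flow_nonneg:
  assumes "cumulative_flow a y V" "0 \<le> t"
  shows "0 \<le> V k t"
proof (rule field_le_epsilon)
  fix e :: real assume "e > 0"
  then obtain K where K: "\<forall>k\<le>K. \<forall>r\<in>{0..t}. \<bar>V k r\<bar> \<le> e"
    using flow_left[OF assms(1)] by blast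
  have "\<bar>V (min k K) t\<bar> \<le> e" using K assms(2) by auto
  moreover have "V (min k K) t \<le> V k t" by (rule flow_mono[OF assms]) simp
  ultimately show "0 \<le> V k t + e" by linarith
qed

lemma flow_le_initial:
  assumes "cumulative_flow a y V" "0 \<le> t"
  shows "V k t \<le> V k 0"
proof (rule barrier[of 0 t "V k" "\<lambda>t. - exp (- a * (y + of_int k - t)) * (V k t - V (k - 1) t)\<^sup>2"])
  fix r assume r: "0 \<le> r" "r \<le> t"
  show "(V k has_real_derivative - exp (- a * (y + of_int k - r)) * (V k r - V (k - 1) r)\<^sup>2) (at r within {0..t})"
    by (rule flow_deriv[OF assms(1)]) (use r in auto)
qed (use assms in auto)

text \<open>
With \<open>x = y + k - t\<close>, the function \<open>C exp (a x)\<close> decays in time along the fibre at relative rate \<open>a\<close>, whereas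
the flow started from it would decay at the relative rate \<open>C (1 - exp (- a))\<^sup>2\<close>. For \<open>C\<close> as assumed the barrier
decays more slowly than the flow, so that it stays above.
\<close>
lemma flow_left_tail:
  assumes V: "cumulative_flow a y V" and "a > 0"
    and C: "C \<ge> a / (1 - exp (- a))\<^sup>2"
    and init: "\<And>k. V k 0 \<le> C * exp (a * (y + of_int k))"
    and "t \<ge> 0"
  shows "V k t \<le> C * exp (a * (y + of_int k - t))"
proof (rule field_le_epsilon)
  fix e :: real assume "e > 0"
  have "exp (- a) < 1" using \<open>a > 0\<close> by simp
  then have q: "1 - exp (- a) > 0" by simp
  then have Cq: "C * (1 - exp (- a))\<^sup>2 \<ge> a" using C by (simp add: pos_divide_le_eq)
  have "C > 0"
    using less_le_trans[OF _ C] \<open>a > 0\<close> q by simp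
  define W where "W k r = C * exp (a * (y + of_int k - r))" for k :: int and r
  have Wstep: "W (k - 1) r = W k r * exp (- a)" for k r
    by (simp add: W_def exp_add[symmetric] algebra_simps)
  have Wpos: "W k r > 0" for k r using \<open>C > 0\<close> by (simp add: W_def)
  obtain K where K: "\<forall>k\<le>K. \<forall>r\<in>{0..t}. \<bar>V k r\<bar> \<le> e"
    using flow_left[OF V \<open>e > 0\<close>] by blast
  \<comment> \<open>The slack \<open>e\<close> absorbs the part of the flow far on the left, where the barrier itself tends to \<open>0\<close>.\<close>
  have "V k t - W k t \<le> e"
  proof (rule lattice_barrier[of 0 t "\<lambda>k r. V k r - W k r" _ e K t k])
    fix k r assume r: "0 \<le> r" "r \<le> t"
    show "((\<lambda>r. V k r - W k r) has_real_derivative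
       (- exp (- a * (y + of_int k - r)) * (V k r - V (k - 1) r)\<^sup>2) - (- a * W k r)) (at r within {0..t})"
      by (intro DERIV_diff flow_deriv[OF V])
         (use r in \<open>auto simp: W_def intro!: derivative_eq_intros\<close>)
    assume h: "e < V k r - W k r" "V (k - 1) r - W (k - 1) r \<le> e"
    have d: "W k r * (1 - exp (- a)) \<le> V k r - V (k - 1) r"
      using h Wstep[of k r] by (simp add: algebra_simps)
    have "a * W k r \<le> C * (1 - exp (- a))\<^sup>2 * W k r"
      using Cq Wpos[of k r] by (intro mult_right_mono) auto
    also have "\<dots> = exp (- a * (y + of_int k - r)) * (W k r * (1 - exp (- a)))\<^sup>2"
    proof -
      have "exp (- a * (y + of_int k - r)) * W k r = C"
        by (simp add: W_def exp_add[symmetric] algebra_simps)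
      then show ?thesis by (simp add: power2_eq_square algebra_simps)
    qed
    also have "\<dots> \<le> exp (- a * (y + of_int k - r)) * (V k r - V (k - 1) r)\<^sup>2"
      using d Wpos[of k r] q by (intro mult_left_mono power_mono) auto
    finally show "(- exp (- a * (y + of_int k - r)) * (V k r - V (k - 1) r)\<^sup>2) - (- a * W k r) \<le> 0"
      by simp
  next
    fix k show "V k 0 - W k 0 \<le> e" using init[of k] \<open>e > 0\<close> by (simp add: W_def)
  next
    fix k r assume "k \<le> K" "0 \<le> r" "r \<le> t"
    then have "\<bar>V k r\<bar> \<le> e" using K by auto
    then show "V k r - W k r \<le> e" using Wpos[of k r] by linarith
  qed (use \<open>t \<ge> 0\<close> in auto)
  then show "V k t \<le> C * exp (a * (y + of_int k - t)) + e" by (simp add: W_def)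
qed

text \<open>
The tail \<open>M - V k t\<close> grows at the rate \<open>exp (- a x) (V k - V (k - 1))\<^sup>2\<close>, which is tiny for large \<open>x\<close>, while
\<open>M exp (x0 - x)\<close> grows along the fibre like its own value, since \<open>x\<close> decreases with unit speed.
To the left of \<open>x0\<close> this barrier exceeds the total mass and there is nothing to prove; to the right of \<open>x0\<close> it
wins if \<open>x0\<close> is large. The initial tail only tends to \<open>0\<close>, without a rate: adding the constant \<open>e / 2\<close>
to the barrier does not change its increments, and \<open>x0\<close> is taken so large that the initial tail is below
\<open>e / 2\<close> beyond \<open>x0\<close>.
\<close>
lemma flow_right_tail:
  assumes V: "cumulative_flow a y V" and "a > 0" and "M \<ge> 0"
    and lim: "\<And>e. e > 0 \<Longrightarrow> \<exists>K. \<forall>k\<ge>K. V k 0 \<ge> M - e"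
    and "e > 0"
  shows "\<exists>R. \<forall>k. \<forall>t\<ge>0. y + of_int k - t \<ge> R \<longrightarrow> V k t \<ge> M - e"
proof -
  obtain K where K: "\<And>k. k \<ge> K \<Longrightarrow> V k 0 \<ge> M - e / 2"
    using lim[of "e / 2"] \<open>e > 0\<close> by auto
  define B where "B = (exp 1 - 1 :: real)"
  have "B > 0" by (simp add: B_def)
  obtain x0 where x0: "x0 \<ge> y + of_int K" "exp (- a * x0) * M * B\<^sup>2 \<le> 1"
  proof -
    define x1 where "x1 = max (y + of_int K) (M * B\<^sup>2 / a)"
    have "M * B\<^sup>2 / a \<le> x1" by (simp add: x1_def)
    then have "M * B\<^sup>2 \<le> a * x1" using \<open>a > 0\<close> by (simp add: pos_divide_le_eq mult.commute)
    also have "\<dots> \<le> exp (a * x1)" using exp_ge_add_one_self[of "a * x1"] by linarith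
    finally have "exp (- a * x1) * M * B\<^sup>2 \<le> 1" by (simp add: exp_minus field_simps)
    with that[of x1] show ?thesis by (simp add: x1_def)
  qed
  define W where "W k r = M * exp (x0 - (y + of_int k - r))" for k :: int and r
  have Wnn: "W k r \<ge> 0" for k r using \<open>M \<ge> 0\<close> by (simp add: W_def)
  have Wstep: "W (k - 1) r = W k r * exp 1" for k r
    by (simp add: W_def exp_add[symmetric] algebra_simps)
  have Wbig: "M \<le> W k r" if "y + of_int k - r \<le> x0" for k r
  proof -
    have "M * 1 \<le> M * exp (x0 - (y + of_int k - r))"
      using that \<open>M \<ge> 0\<close> by (intro mult_left_mono) auto
    then show ?thesis by (simp add: W_def)
  qed
  have main: "(M - V k t) - W k t \<le> e / 2" if "t \<ge> 0" for k t
  proof (rule lattice_barrier[of 0 t "\<lambda>k r. (M - V k r) - W k r" _ "e / 2" "\<lfloor>x0 - y\<rfloor>" t k])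
    fix k r assume r: "0 \<le> r" "r \<le> t"
    show "((\<lambda>r. (M - V k r) - W k r) has_real_derivative
       (0 - (- exp (- a * (y + of_int k - r)) * (V k r - V (k - 1) r)\<^sup>2)) - W k r) (at r within {0..t})"
      by (intro DERIV_diff flow_deriv[OF V] DERIV_const)
         (use r in \<open>auto simp: W_def intro!: derivative_eq_intros\<close>)
    assume h: "e / 2 < (M - V k r) - W k r" "(M - V (k - 1) r) - W (k - 1) r \<le> e / 2"
    have "x0 \<le> y + of_int k - r"
    proof (rule ccontr)
      assume "\<not> ?thesis"
      then have "M \<le> W k r" by (intro Wbig) simp
      then show False using h(1) flow_nonneg[OF V r(1), of k] \<open>e > 0\<close> by simp
    qed
    note x = this
    have d: "V k r - V (k - 1) r \<le> W k r * B"
      using h Wstep[of k r] by (simp add: algebra_simps B_def)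
    have "exp (- a * (y + of_int k - r)) * (V k r - V (k - 1) r)\<^sup>2 \<le> exp (- a * x0) * (W k r * B)\<^sup>2"
      using x \<open>a > 0\<close> d flow_step[OF V r(1), of k]
      by (intro mult_mono power_mono) auto
    also have "\<dots> = (exp (- a * x0) * B\<^sup>2 * W k r) * W k r"
      by (simp add: power2_eq_square)
    also have "\<dots> \<le> 1 * W k r"
    proof (rule mult_right_mono[OF _ Wnn])
      have "W k r \<le> M * exp 0" unfolding W_def using x \<open>M \<ge> 0\<close> by (intro mult_left_mono) auto
      then have "exp (- a * x0) * B\<^sup>2 * W k r \<le> exp (- a * x0) * B\<^sup>2 * M"
        by (intro mult_left_mono) auto
      with x0(2) show "exp (- a * x0) * B\<^sup>2 * W k r \<le> 1" by (simp add: mult_ac)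
    qed
    finally show "(0 - (- exp (- a * (y + of_int k - r)) * (V k r - V (k - 1) r)\<^sup>2)) - W k r \<le> 0"
      by simp
  next
    fix k
    show "(M - V k 0) - W k 0 \<le> e / 2"
    proof (cases "k \<ge> K")
      case True
      then show ?thesis using K[of k] Wnn[of k 0] by linarith
    next
      case False
      then have "y + of_int k - 0 \<le> x0" using x0(1) by linarith
      then show ?thesis using Wbig[of k 0] flow_nonneg[OF V order_refl, of k] \<open>e > 0\<close> by linarith
    qed
  next
    fix k r assume k: "k \<le> \<lfloor>x0 - y\<rfloor>" "0 \<le> r" "r \<le> t"
    then have "y + of_int k - r \<le> x0" by linarith
    then show "(M - V k r) - W k r \<le> e / 2"
      using Wbig[of k r] flow_nonneg[OF V k(2), of k] \<open>e > 0\<close> by linarith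
  qed (use that in auto)
  obtain R where R: "M * exp (x0 - R) \<le> e / 2"
  proof -
    define R where "R = x0 + 2 * M / e"
    have "2 * M / e \<le> exp (2 * M / e)" using exp_ge_add_one_self[of "2 * M / e"] by linarith
    then have "M * exp (x0 - R) \<le> e / 2"
      using \<open>e > 0\<close> by (simp add: R_def exp_minus field_simps)
    then show ?thesis by (rule that)
  qed
  show ?thesis
  proof (intro exI allI impI)
    fix k :: int and t :: real assume "t \<ge> 0" "R \<le> y + of_int k - t"
    then have "W k t \<le> M * exp (x0 - R)"
      unfolding W_def using \<open>M \<ge> 0\<close> by (intro mult_left_mono) auto
    with main[OF \<open>t \<ge> 0\<close>, of k] R show "M - e \<le> V k t" by linarith
  qed
qed

section \<open>Flows with the same mass merge\<close>

text \<open>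
Tightness in the moving variable \<open>x = y + k - t\<close>, uniformly in time: at either end, at most \<open>e\<close> of the
mass \<open>M\<close> lies outside \<open>[- R, R]\<close>.
\<close>
definition uniform_tails :: "real \<Rightarrow> real \<Rightarrow> (int \<Rightarrow> real \<Rightarrow> real) \<Rightarrow> bool" where
  "uniform_tails y M V \<longleftrightarrow> (\<forall>e>0. \<exists>R. \<forall>k. \<forall>t\<ge>0.
     (y + of_int k - t \<le> - R \<longrightarrow> V k t \<le> e) \<and> (y + of_int k - t \<ge> R \<longrightarrow> V k t \<ge> M - e))"

lemma uniform_tailsI:
  assumes "\<And>e. e > 0 \<Longrightarrow> \<exists>L. \<forall>k. \<forall>t\<ge>0. y + of_int k - t \<le> L \<longrightarrow> V k t \<le> e"
    and "\<And>e. e > 0 \<Longrightarrow> \<exists>R. \<forall>k. \<forall>t\<ge>0. y + of_int k - t \<ge> R \<longrightarrow> V k t \<ge> M - e"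
  shows "uniform_tails y M V"
  unfolding uniform_tails_def
proof (intro allI impI)
  fix e :: real assume e: "e > 0"
  obtain L where L: "\<forall>k. \<forall>t\<ge>0. y + of_int k - t \<le> L \<longrightarrow> V k t \<le> e"
    using assms(1)[OF e] by blast
  obtain R where R: "\<forall>k. \<forall>t\<ge>0. y + of_int k - t \<ge> R \<longrightarrow> V k t \<ge> M - e"
    using assms(2)[OF e] by blast
  show "\<exists>R. \<forall>k. \<forall>t\<ge>0. (y + of_int k - t \<le> - R \<longrightarrow> V k t \<le> e) \<and> (y + of_int k - t \<ge> R \<longrightarrow> V k t \<ge> M - e)"
    using L R by (intro exI[of _ "max R (- L)"]) auto
qed

lemma uniform_tailsD:
  assumes "uniform_tails y M V" "e > 0"
  shows "\<exists>R>0. (\<forall>k. \<forall>t\<ge>0. y + of_int k - t \<le> - R \<longrightarrow> V k t \<le> e) \<and>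
    (\<forall>k. \<forall>t\<ge>0. y + of_int k - t \<ge> R \<longrightarrow> V k t \<ge> M - e)"
proof -
  obtain R where R: "\<forall>k. \<forall>t\<ge>0.
     (y + of_int k - t \<le> - R \<longrightarrow> V k t \<le> e) \<and> (y + of_int k - t \<ge> R \<longrightarrow> V k t \<ge> M - e)"
    using assms unfolding uniform_tails_def by blast
  show ?thesis
    by (rule exI[of _ "max R 1"]) (use R in auto)
qed

text \<open>
If \<open>V - W\<close> is larger at \<open>k\<close> than at \<open>k - 1\<close>, then \<open>V\<close> has the larger increment at \<open>k\<close>, hence the larger
outflow, and the difference decreases.
\<close>
lemma flow_diff_mono_rate:
  fixes p q p' q' :: real
  assumes "q \<le> p" "q' \<le> p'" "p - q \<ge> p' - q'" "w \<ge> 0"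
  shows "- w * (p - q)\<^sup>2 - (- w * (p' - q')\<^sup>2) \<le> 0"
proof -
  have "(p' - q')\<^sup>2 \<le> (p - q)\<^sup>2" using assms by (intro power_mono) auto
  then have "w * (p' - q')\<^sup>2 \<le> w * (p - q)\<^sup>2" using assms(4) by (rule mult_left_mono)
  then show ?thesis by simp
qed

lemma flow_gap_sup_nonincreasing:
  assumes V: "cumulative_flow a y V" and W: "cumulative_flow a y W"
    and left: "\<And>k t. t \<ge> 0 \<Longrightarrow> y + of_int k - t \<le> - R \<Longrightarrow> V k t - W k t \<le> S"
    and s: "0 \<le> s" "s \<le> t"
    and init: "\<And>k. V k s - W k s \<le> S"
  shows "V k t - W k t \<le> S"
proof (rule lattice_barrier[of s t "\<lambda>k r. V k r - W k r" _ S "\<lfloor>s - y - R\<rfloor>" t k])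
  fix k r assume r: "s \<le> r" "r \<le> t"
  then have "r \<ge> 0" using s by simp
  show "((\<lambda>r. V k r - W k r) has_real_derivative
     - exp (- a * (y + of_int k - r)) * (V k r - V (k - 1) r)\<^sup>2
      - (- exp (- a * (y + of_int k - r)) * (W k r - W (k - 1) r)\<^sup>2)) (at r within {s..t})"
    by (intro DERIV_diff flow_deriv[OF V] flow_deriv[OF W]) (use r s in auto)
  assume "S < V k r - W k r" "V (k - 1) r - W (k - 1) r \<le> S"
  then show "- exp (- a * (y + of_int k - r)) * (V k r - V (k - 1) r)\<^sup>2
      - (- exp (- a * (y + of_int k - r)) * (W k r - W (k - 1) r)\<^sup>2) \<le> 0"
    by (intro flow_diff_mono_rate flow_step[OF V \<open>r \<ge> 0\<close>] flow_step[OF W \<open>r \<ge> 0\<close>]) auto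
next
  fix k r assume k: "k \<le> \<lfloor>s - y - R\<rfloor>" "s \<le> r" "r \<le> t"
  then have "y + of_int k - r \<le> - R" by linarith
  then show "V k r - W k r \<le> S" using k s by (intro left) auto
qed (use s init in auto)

text \<open>
The difference \<open>D k = V k - W k\<close> satisfies \<open>D k' = - w (D k - D (k - 1))\<close>, where \<open>w \<le> 2 M exp (a R)\<close> as long
as \<open>x \<ge> - R\<close>. A point that lies in the window \<open>\<bar>x\<bar> < R\<close> at time \<open>t\<close> was to the right of the window at time \<open>t - 2 R\<close>, where
\<open>D k \<le> e\<close>. Since then it can have been pulled towards the upper bound \<open>S\<close> at rate at most
\<open>2 M exp (a R)\<close>, so a fraction \<open>exp (- 4 R M exp (a R))\<close> of the initial deficit \<open>S - e\<close> survives.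
\<close>
lemma flow_gap_contracts:
  assumes V: "cumulative_flow a y V" and W: "cumulative_flow a y W" and "a > 0"
    and VM: "\<And>k t. t \<ge> 0 \<Longrightarrow> V k t \<le> M" and WM: "\<And>k t. t \<ge> 0 \<Longrightarrow> W k t \<le> M"
    and "R > 0"
    and tail: "\<And>k t. t \<ge> 0 \<Longrightarrow> \<bar>y + of_int k - t\<bar> \<ge> R \<Longrightarrow> V k t - W k t \<le> e"
    and "e \<le> S" "0 \<le> s"
    and S: "\<And>k t. t \<ge> s \<Longrightarrow> V k t - W k t \<le> S"
    and t: "t \<ge> s + 2 * R"
  shows "V k t - W k t - e \<le> (1 - exp (- 4 * R * M * exp (a * R))) * (S - e)"
proof -
  define A where "A = 2 * M * exp (a * R)"
  define p where "p = exp (- 2 * R * A)"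
  have "M \<ge> 0" using VM[of 0 k] flow_nonneg[OF V order_refl, of k] by simp
  then have "A \<ge> 0" by (simp add: A_def)
  have p: "p = exp (- 4 * R * M * exp (a * R))" by (simp add: p_def A_def)
  have "p \<le> 1" using \<open>A \<ge> 0\<close> \<open>R > 0\<close> by (simp add: p_def)
  have "V k t - W k t \<le> S - p * (S - e)"
  proof (cases "\<bar>y + of_int k - t\<bar> \<ge> R")
    case True
    then have "V k t - W k t \<le> e" using tail t \<open>0 \<le> s\<close> \<open>R > 0\<close> by simp
    also have "p * (S - e) \<le> 1 * (S - e)" using \<open>p \<le> 1\<close> \<open>e \<le> S\<close> by (intro mult_right_mono) auto
    then have "e \<le> S - p * (S - e)" by simp
    finally show ?thesis .
  next
    case False
    define t0 where "t0 = t - 2 * R"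
    have t0: "s \<le> t0" "0 \<le> t0" "t0 \<le> t" using t \<open>0 \<le> s\<close> \<open>R > 0\<close> by (auto simp: t0_def)
    \<comment> \<open>The deficit \<open>Y \<le> 0\<close> satisfies \<open>Y' \<le> - w Y \<le> - A Y\<close>, hence \<open>exp (A r) Y r\<close> does not increase.\<close>
    define Y where "Y r = V k r - W k r - S" for r
    define Y' where "Y' r = - exp (- a * (y + of_int k - r)) * (V k r - V (k - 1) r)\<^sup>2
      - (- exp (- a * (y + of_int k - r)) * (W k r - W (k - 1) r)\<^sup>2)" for r
    have "exp (A * t) * Y t \<le> exp (A * t0) * Y t0"
    proof (rule barrier[OF t0(3), of "\<lambda>r. exp (A * r) * Y r" "\<lambda>r. exp (A * r) * (A * Y r + Y' r)"])
      fix r assume r: "t0 \<le> r" "r \<le> t"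
      have "(Y has_real_derivative Y' r - 0) (at r within {t0..t})"
        unfolding Y_def Y'_def
        by (intro DERIV_diff flow_deriv[OF V] flow_deriv[OF W] DERIV_const) (use r t0 in auto)
      then show "((\<lambda>r. exp (A * r) * Y r) has_real_derivative exp (A * r) * (A * Y r + Y' r))
          (at r within {t0..t})"
        by (auto intro!: derivative_eq_intros simp: algebra_simps)
      have "r \<ge> 0" using r t0 by simp
      define w where "w = exp (- a * (y + of_int k - r)) * ((V k r - V (k - 1) r) + (W k r - W (k - 1) r))"
      have Y'w: "Y' r = - w * ((V k r - W k r) - (V (k - 1) r - W (k - 1) r))"
        by (simp add: Y'_def w_def power2_eq_square algebra_simps)
      have "w \<ge> 0" unfolding w_def using flow_step[OF V \<open>r \<ge> 0\<close>, of k] flow_step[OF W \<open>r \<ge> 0\<close>, of k] by simp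
      have "w \<le> exp (a * R) * (M + M)"
        unfolding w_def
      proof (intro mult_mono add_mono)
        have "a * - (y + of_int k - r) \<le> a * R"
          using False r \<open>a > 0\<close> by (intro mult_left_mono) auto
        then show "exp (- a * (y + of_int k - r)) \<le> exp (a * R)"
          by (simp only: exp_le_cancel_iff mult_minus_left mult_minus_right)
        show "V k r - V (k - 1) r \<le> M" using VM[OF \<open>r \<ge> 0\<close>, of k] flow_nonneg[OF V \<open>r \<ge> 0\<close>, of "k - 1"] by simp
        show "W k r - W (k - 1) r \<le> M" using WM[OF \<open>r \<ge> 0\<close>, of k] flow_nonneg[OF W \<open>r \<ge> 0\<close>, of "k - 1"] by simp
        show "0 \<le> V k r - V (k - 1) r + (W k r - W (k - 1) r)"
          using flow_step[OF V \<open>r \<ge> 0\<close>, of k] flow_step[OF W \<open>r \<ge> 0\<close>, of k] by simp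
      qed simp
      then have "w \<le> A" by (simp add: A_def mult_ac)
      have "Y r \<le> 0" using S[of r k] r t0 by (simp add: Y_def)
      have "V (k - 1) r - W (k - 1) r \<le> S" using S[of r "k - 1"] r t0 by simp
      then have "w * Y r \<le> w * ((V k r - W k r) - (V (k - 1) r - W (k - 1) r))"
        using \<open>w \<ge> 0\<close> by (intro mult_left_mono) (simp_all add: Y_def)
      then have "Y' r \<le> - w * Y r" by (simp add: Y'w)
      moreover have "A * Y r \<le> w * Y r" using \<open>w \<le> A\<close> \<open>Y r \<le> 0\<close> by (rule mult_right_mono_neg)
      ultimately have "A * Y r + Y' r \<le> 0" by simp
      then show "exp (A * r) * (A * Y r + Y' r) \<le> 0" by (simp add: mult_nonneg_nonpos)
    qed simp
    moreover have "Y t0 \<le> e - S"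
    proof -
      have "\<bar>y + of_int k - t0\<bar> \<ge> R" using False by (simp add: t0_def)
      from tail[OF t0(2) this] show ?thesis by (simp add: Y_def)
    qed
    then have "exp (A * t0) * Y t0 \<le> exp (A * t0) * (e - S)" by simp
    ultimately have "exp (A * t) * Y t \<le> exp (A * t0) * (e - S)" by linarith
    then have "exp (- A * t) * (exp (A * t) * Y t) \<le> exp (- A * t) * (exp (A * t0) * (e - S))"
      by (rule mult_left_mono) simp
    moreover have "exp (- A * t) * (exp (A * t) * Y t) = Y t"
      by (simp add: mult.assoc[symmetric] exp_add[symmetric])
    moreover have "exp (- A * t) * exp (A * t0) = p"
      unfolding p_def t0_def exp_add[symmetric] by (rule arg_cong[of _ _ exp]) (simp add: algebra_simps)
    then have "exp (- A * t) * (exp (A * t0) * (e - S)) = p * (e - S)"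
      by (simp only: mult.assoc[symmetric])
    ultimately have "Y t \<le> p * (e - S)" by (simp only:)
    then show ?thesis by (simp add: Y_def algebra_simps)
  qed
  then show ?thesis unfolding p[symmetric] by (simp add: algebra_simps)
qed

text \<open>
Iterating the contraction with \<open>d = e / 2\<close> as size of the tails leaves the excess \<open>(1 - p)\<^sup>n M\<close> over
\<open>d\<close> after \<open>n\<close> steps of length \<open>2 R\<close>; the tails, and hence \<open>R\<close> and \<open>p\<close>, are uniform in time.
\<close>
lemma flows_merge_upper:
  assumes V: "cumulative_flow a y V" and W: "cumulative_flow a y W" and "a > 0"
    and VM: "\<And>k t. t \<ge> 0 \<Longrightarrow> V k t \<le> M" and WM: "\<And>k t. t \<ge> 0 \<Longrightarrow> W k t \<le> M"
    and VT: "uniform_tails y M V" and WT: "uniform_tails y M W"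
    and "e > 0"
  shows "\<exists>t0\<ge>0. \<forall>t\<ge>t0. \<forall>k. V k t - W k t \<le> e"
proof -
  define d where "d = e / 2"
  have "d > 0" using \<open>e > 0\<close> by (simp add: d_def)
  from uniform_tailsD[OF VT \<open>d > 0\<close>] obtain R1 where "R1 > 0"
    and "\<forall>k. \<forall>t\<ge>0. y + of_int k - t \<le> - R1 \<longrightarrow> V k t \<le> d"
    and "\<forall>k. \<forall>t\<ge>0. y + of_int k - t \<ge> R1 \<longrightarrow> V k t \<ge> M - d"
    by (elim exE conjE) (rule that)
  note R1 = this(1) this(2,3)[rule_format]
  from uniform_tailsD[OF WT \<open>d > 0\<close>] obtain R2 where "R2 > 0"
    and "\<forall>k. \<forall>t\<ge>0. y + of_int k - t \<le> - R2 \<longrightarrow> W k t \<le> d"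
    and "\<forall>k. \<forall>t\<ge>0. y + of_int k - t \<ge> R2 \<longrightarrow> W k t \<ge> M - d"
    by (elim exE conjE) (rule that)
  note R2 = this(1) this(2,3)[rule_format]
  define R where "R = max R1 R2"
  have "R > 0" using R1 by (simp add: R_def)
  have tail: "V k t - W k t \<le> d" if "t \<ge> 0" "\<bar>y + of_int k - t\<bar> \<ge> R" for k t
  proof (cases "y + of_int k - t \<ge> 0")
    case True
    then have "y + of_int k - t \<ge> R2" using that by (simp add: R_def)
    with R2(3)[of t k] VM[of t k] that show ?thesis by linarith
  next
    case False
    then have "y + of_int k - t \<le> - R1" using that by (simp add: R_def)
    with R1(2)[of t k] flow_nonneg[OF W that(1), of k] that show ?thesis by linarith
  qed
  have "M \<ge> 0" using VM[of 0 0] flow_nonneg[OF V order_refl, of 0] by simp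
  define p where "p = exp (- 4 * R * M * exp (a * R))"
  have p: "0 < p" "p \<le> 1" using \<open>M \<ge> 0\<close> \<open>R > 0\<close> by (auto simp: p_def)
  define S where "S n = d + (1 - p) ^ n * M" for n :: nat
  have Sd: "d \<le> S n" for n using p \<open>M \<ge> 0\<close> by (simp add: S_def)
  have main: "\<exists>t0\<ge>0. \<forall>t\<ge>t0. \<forall>k. V k t - W k t \<le> S n" for n
  proof (induction n)
    case 0
    have "V k t - W k t \<le> S 0" if "t \<ge> 0" for k t
      using VM[OF that, of k] flow_nonneg[OF W that, of k] \<open>d > 0\<close> by (simp add: S_def)
    then show ?case by blast
  next
    case (Suc n)
    then obtain s where s: "s \<ge> 0" "\<And>t k. t \<ge> s \<Longrightarrow> V k t - W k t \<le> S n" by blast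
    have "V k t - W k t \<le> S (Suc n)" if "t \<ge> s + 2 * R" for k t
    proof -
      have "V k t - W k t - d \<le> (1 - p) * (S n - d)"
        unfolding p_def
        by (rule flow_gap_contracts[OF V W \<open>a > 0\<close> VM WM \<open>R > 0\<close> tail Sd s(1) s(2) that]) auto
      then show ?thesis by (simp add: S_def)
    qed
    then show ?case using s(1) \<open>R > 0\<close> by (intro exI[of _ "s + 2 * R"]) auto
  qed
  have "(\<lambda>n. (1 - p) ^ n * M) \<longlonglongrightarrow> 0 * M"
    using p by (intro tendsto_mult LIMSEQ_realpow_zero tendsto_const) auto
  then have "eventually (\<lambda>n. (1 - p) ^ n * M < d) sequentially"
    using \<open>d > 0\<close> by (intro order_tendstoD) auto
  then obtain n where n: "(1 - p) ^ n * M < d"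
    by (auto simp: eventually_sequentially)
  then have "S n \<le> e" by (simp add: S_def d_def)
  moreover obtain t0 where "t0 \<ge> 0" "\<forall>t\<ge>t0. \<forall>k. V k t - W k t \<le> S n" using main by blast
  ultimately show ?thesis by (intro exI[of _ t0]) (auto intro: order_trans)
qed

lemma flows_merge:
  assumes V: "cumulative_flow a y V" and W: "cumulative_flow a y W" and "a > 0"
    and VM: "\<And>k t. t \<ge> 0 \<Longrightarrow> V k t \<le> M" and WM: "\<And>k t. t \<ge> 0 \<Longrightarrow> W k t \<le> M"
    and VT: "uniform_tails y M V" and WT: "uniform_tails y M W"
    and "e > 0"
  obtains t0 where "t0 \<ge> 0" "\<And>t k. t \<ge> t0 \<Longrightarrow> \<bar>V k t - W k t\<bar> \<le> e"
proof -
  obtain t1 where t1: "t1 \<ge> 0" "\<And>t k. t \<ge> t1 \<Longrightarrow> V k t - W k t \<le> e"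
    using flows_merge_upper[OF V W \<open>a > 0\<close> VM WM VT WT \<open>e > 0\<close>] by blast
  obtain t2 where t2: "t2 \<ge> 0" "\<And>t k. t \<ge> t2 \<Longrightarrow> W k t - V k t \<le> e"
    using flows_merge_upper[OF W V \<open>a > 0\<close> WM VM WT VT \<open>e > 0\<close>] by blast
  show ?thesis
  proof (rule that[of "max t1 t2"])
    show "\<bar>V k t - W k t\<bar> \<le> e" if "max t1 t2 \<le> t" for t k
      using t1(2)[of t k] t2(2)[of t k] that by (simp add: abs_le_iff)
  qed (use t1 in auto)
qed

lemma sum_telescope_int:
  fixes f :: "int \<Rightarrow> real"
  assumes "m \<le> n"
  shows "(\<Sum>k\<in>{m<..n}. f k - f (k - 1)) = f n - f m"
  using assms
proof (induction n rule: int_ge_induct)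
  case (step i)
  have "{m<..i + 1} = insert (i + 1) {m<..i}" using step by auto
  then show ?case using step by simp
qed simp

text \<open>
The window \<open>[- R, R]\<close> contains boundedly many points of a fibre, and on it the increments are close because the
cumulative masses are. Outside the window both flows carry little mass.
\<close>
lemma flows_merge_l1:
  assumes V: "cumulative_flow a y V" and W: "cumulative_flow a y W" and "a > 0"
    and VM: "\<And>k t. t \<ge> 0 \<Longrightarrow> V k t \<le> M" and WM: "\<And>k t. t \<ge> 0 \<Longrightarrow> W k t \<le> M"
    and VT: "uniform_tails y M V" and WT: "uniform_tails y M W"
  shows "((\<lambda>t. \<integral>\<^sup>+k. ennreal \<bar>(V k t - V (k - 1) t) - (W k t - W (k - 1) t)\<bar> \<partial>count_space UNIV)
           \<longlongrightarrow> 0) at_top"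
proof (rule tendsto_zero_ennreal)
  fix r :: real assume "r > 0"
  define d where "d = r / 9"
  have "d > 0" using \<open>r > 0\<close> by (simp add: d_def)
  from uniform_tailsD[OF VT \<open>d > 0\<close>] obtain R1 where "R1 > 0"
    and "\<forall>k. \<forall>t\<ge>0. y + of_int k - t \<le> - R1 \<longrightarrow> V k t \<le> d"
    and "\<forall>k. \<forall>t\<ge>0. y + of_int k - t \<ge> R1 \<longrightarrow> V k t \<ge> M - d"
    by (elim exE conjE) (rule that)
  note R1 = this(1) this(2,3)[rule_format]
  from uniform_tailsD[OF WT \<open>d > 0\<close>] obtain R2 where "R2 > 0"
    and "\<forall>k. \<forall>t\<ge>0. y + of_int k - t \<le> - R2 \<longrightarrow> W k t \<le> d"
    and "\<forall>k. \<forall>t\<ge>0. y + of_int k - t \<ge> R2 \<longrightarrow> W k t \<ge> M - d"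
    by (elim exE conjE) (rule that)
  note R2 = this(1) this(2,3)[rule_format]
  define R where "R = max R1 R2"
  have "R > 0" using R1 by (simp add: R_def)
  \<comment> \<open>The window meets at most \<open>2 R + 2\<close> indices, each contributing at most \<open>2 e\<close>; the tails contribute \<open>2 d\<close> each.\<close>
  define e where "e = d / (2 * R + 2)"
  have "e > 0" using \<open>d > 0\<close> \<open>R > 0\<close> by (simp add: e_def)
  obtain t0 where t0: "t0 \<ge> 0" "\<And>t k. t \<ge> t0 \<Longrightarrow> \<bar>V k t - W k t\<bar> \<le> e"
    by (rule flows_merge[OF V W \<open>a > 0\<close> VM WM VT WT \<open>e > 0\<close>]) auto
  have "(\<integral>\<^sup>+k. ennreal \<bar>(V k t - V (k - 1) t) - (W k t - W (k - 1) t)\<bar> \<partial>count_space UNIV) < ennreal r"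
    if "t \<ge> t0" for t
  proof -
    have "t \<ge> 0" using that t0 by simp
    define k1 where "k1 = \<lfloor>t - y - R\<rfloor>"
    define k2 where "k2 = \<lceil>t - y + R\<rceil>"
    have k12: "k1 \<le> k2" unfolding k1_def k2_def using \<open>R > 0\<close> by linarith
    have gap: "of_int (k2 - k1) \<le> 2 * R + 2" unfolding k1_def k2_def by simp linarith
    have x1: "y + of_int k1 - t \<le> - R1" "y + of_int k1 - t \<le> - R2"
      unfolding k1_def R_def by linarith+
    have x2: "y + of_int k2 - t \<ge> R1" "y + of_int k2 - t \<ge> R2"
      unfolding k2_def R_def by linarith+
    define g where "g k = \<bar>(V k t - V (k - 1) t) - (W k t - W (k - 1) t)\<bar>" for k
    define m where "m k = (V k t - V (k - 1) t) + (W k t - W (k - 1) t)" for k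
    have gm: "g k \<le> m k" for k
      using flow_step[OF V \<open>t \<ge> 0\<close>, of k] flow_step[OF W \<open>t \<ge> 0\<close>, of k]
      unfolding g_def m_def by linarith
    have summ: "sum m {i<..j} = (V j t - V i t) + (W j t - W i t)" if "i \<le> j" for i j
      unfolding m_def sum.distrib
      using sum_telescope_int[OF that, of "\<lambda>k. V k t"] sum_telescope_int[OF that, of "\<lambda>k. W k t"]
      by simp
    have "(\<integral>\<^sup>+k. ennreal (g k) \<partial>count_space UNIV) \<le> ennreal (6 * d)"
    proof (rule nn_integral_count_space_le)
      fix F :: "int set" assume "finite F"
      define i where "i = min k1 (Min (insert 0 F) - 1)"
      define j where "j = max k2 (Max (insert 0 F))"
      have ij: "i \<le> k1" "k2 \<le> j" by (auto simp: i_def j_def)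
      have "F \<subseteq> {i<..j}"
      proof
        fix k assume "k \<in> F"
        then have "Min (insert 0 F) \<le> k" "k \<le> Max (insert 0 F)"
          using \<open>finite F\<close> by (auto intro!: Min_le Max_ge)
        then show "k \<in> {i<..j}" by (auto simp: i_def j_def)
      qed
      then have "sum g F \<le> sum g {i<..j}" by (intro sum_mono2) (auto simp: g_def)
      also have "{i<..j} = {i<..k1} \<union> {k1<..k2} \<union> {k2<..j}" using ij k12 by auto
      also have "sum g \<dots> = sum g {i<..k1} + sum g {k1<..k2} + sum g {k2<..j}"
        using ij k12 by (subst sum.union_disjoint, auto)+
      also have "sum g {i<..k1} \<le> sum m {i<..k1}" by (intro sum_mono gm)
      also have "sum m {i<..k1} \<le> 2 * d"
        using R1(2)[OF \<open>t \<ge> 0\<close> x1(1)] R2(2)[OF \<open>t \<ge> 0\<close> x1(2)]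
          flow_nonneg[OF V \<open>t \<ge> 0\<close>, of i] flow_nonneg[OF W \<open>t \<ge> 0\<close>, of i]
        by (simp add: summ[OF ij(1)])
      also have "sum g {k2<..j} \<le> sum m {k2<..j}" by (intro sum_mono gm)
      also have "sum m {k2<..j} \<le> 2 * d"
        using R1(3)[OF \<open>t \<ge> 0\<close> x2(1)] R2(3)[OF \<open>t \<ge> 0\<close> x2(2)]
          VM[OF \<open>t \<ge> 0\<close>, of j] WM[OF \<open>t \<ge> 0\<close>, of j]
        by (simp add: summ[OF ij(2)])
      also have "sum g {k1<..k2} \<le> (\<Sum>k\<in>{k1<..k2}. 2 * e)"
      proof (rule sum_mono)
        fix k show "g k \<le> 2 * e"
          using t0(2)[OF that, of k] t0(2)[OF that, of "k - 1"] unfolding g_def by linarith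
      qed
      also have "\<dots> = of_int (k2 - k1) * (2 * e)" using k12 by simp
      also have "\<dots> \<le> (2 * R + 2) * (2 * e)" using gap \<open>e > 0\<close> by (intro mult_right_mono) auto
      also have "\<dots> = 2 * d" using \<open>R > 0\<close> by (simp add: e_def field_simps)
      finally have "sum g F \<le> 6 * d" by simp
      moreover have "(\<Sum>k\<in>F. ennreal (g k)) = ennreal (sum g F)"
        by (rule sum_ennreal) (simp add: g_def)
      ultimately show "(\<Sum>k\<in>F. ennreal (g k)) \<le> ennreal (6 * d)"
        by (simp add: ennreal_leI)
    qed
    also have "\<dots> < ennreal r" using \<open>r > 0\<close> by (intro ennreal_lessI) (auto simp: d_def)
    finally show ?thesis by (simp add: g_def)
  qed
  then show "\<forall>\<^sub>F t in at_top. (\<integral>\<^sup>+k. ennreal \<bar>(V k t - V (k - 1) t) - (W k t - W (k - 1) t)\<bar> \<partial>count_space UNIV) < ennreal r"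
    using eventually_ge_at_top[of t0] by (rule eventually_mono[rotated]) auto
qed

lemma mass_of_cumulative:
  fixes f :: "int \<Rightarrow> real"
  assumes mono: "\<And>k. f (k - 1) \<le> f k" and le: "\<And>k. f k \<le> M" and nn: "\<And>k. 0 \<le> f k"
    and left: "\<And>e. e > 0 \<Longrightarrow> \<exists>k. f k \<le> e"
    and right: "\<And>e. e > 0 \<Longrightarrow> \<exists>k. f k \<ge> M - e"
  shows "(\<integral>\<^sup>+k. ennreal (f k - f (k - 1)) \<partial>count_space UNIV) = ennreal M"
proof (rule antisym)
  define g where "g k = f k - f (k - 1)" for k
  have g0: "g k \<ge> 0" for k using mono by (simp add: g_def)
  have M0: "M \<ge> 0" using le[of 0] nn[of 0] by simp
  have m: "f i \<le> f j" if "i \<le> j" for i j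
    using that
  proof (induction j rule: int_ge_induct)
    case (step j)
    then show ?case using mono[of "j + 1"] by simp
  qed simp
  have tel: "(\<Sum>k\<in>{i<..j}. ennreal (g k)) = ennreal (f j - f i)" if "i \<le> j" for i j
    using sum_ennreal[of "{i<..j}" g] sum_telescope_int[OF that, of f] g0 by (simp add: g_def)
  show "(\<integral>\<^sup>+k. ennreal (f k - f (k - 1)) \<partial>count_space UNIV) \<le> ennreal M"
    unfolding g_def[symmetric]
  proof (rule nn_integral_count_space_le)
    fix F :: "int set" assume "finite F"
    define i where "i = Min (insert 0 F) - 1"
    define j where "j = Max (insert 0 F)"
    have "F \<subseteq> {i<..j}"
    proof
      fix k assume "k \<in> F"
      then have "Min (insert 0 F) \<le> k" "k \<le> Max (insert 0 F)"
        using \<open>finite F\<close> by (auto intro!: Min_le Max_ge)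
      then show "k \<in> {i<..j}" by (auto simp: i_def j_def)
    qed
    then have "(\<Sum>k\<in>F. ennreal (g k)) \<le> (\<Sum>k\<in>{i<..j}. ennreal (g k))"
      by (intro sum_mono2) auto
    also have "\<dots> = ennreal (f j - f i)"
    proof (rule tel)
      have "Min (insert 0 F) \<le> Max (insert 0 F)"
        using \<open>finite F\<close> by (intro Min_le_iff[THEN iffD2] bexI[of _ "Max (insert 0 F)"] Max_in) auto
      then show "i \<le> j" by (simp add: i_def j_def)
    qed
    also have "\<dots> \<le> ennreal M" using le[of j] nn[of i] by (intro ennreal_leI) simp
    finally show "(\<Sum>k\<in>F. ennreal (g k)) \<le> ennreal M" .
  qed
  show "ennreal M \<le> (\<integral>\<^sup>+k. ennreal (f k - f (k - 1)) \<partial>count_space UNIV)"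
    unfolding g_def[symmetric]
  proof (rule ennreal_le_epsilon)
    fix e :: real assume "e > 0"
    obtain i where i: "f i \<le> e / 2" using left[of "e / 2"] \<open>e > 0\<close> by auto
    obtain j where j: "f j \<ge> M - e / 2" using right[of "e / 2"] \<open>e > 0\<close> by auto
    have "f (max i j) \<ge> M - e / 2" using j m[of j "max i j"] by simp
    then have "M \<le> (f (max i j) - f i) + e" using i by simp
    then have "ennreal M \<le> ennreal ((f (max i j) - f i) + e)" by (rule ennreal_leI)
    also have "\<dots> = ennreal (f (max i j) - f i) + ennreal e"
      using m[of i "max i j"] \<open>e > 0\<close> by (intro ennreal_plus) auto
    also have "ennreal (f (max i j) - f i) = (\<Sum>k\<in>{i<..max i j}. ennreal (g k))"
      by (rule tel[symmetric]) simp
    also have "\<dots> \<le> (\<integral>\<^sup>+k. ennreal (g k) \<partial>count_space UNIV)"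
      by (rule sum_le_nn_integral_count_space) simp
    finally show "ennreal M \<le> (\<integral>\<^sup>+k. ennreal (g k) \<partial>count_space UNIV) + ennreal e"
      by (simp add: add_right_mono)
  qed
qed

text \<open>
Converse of \<open>mass_of_cumulative\<close>: a nonnegative family of total mass \<open>M\<close> is the family of increments of its
partial sums from \<open>- \<infinity>\<close>. Both limits, \<open>0\<close> on the left and \<open>M\<close> on the right, are read off from one finite set that carries
all but \<open>e\<close> of the mass.
\<close>
lemma cumulative_of_mass:
  fixes v :: "int \<Rightarrow> real"
  assumes v: "\<And>k. 0 \<le> v k" and M: "(\<integral>\<^sup>+k. ennreal (v k) \<partial>count_space UNIV) = ennreal M" "0 \<le> M"
  obtains f where "\<And>k. f k - f (k - 1) = v k" "\<And>k. 0 \<le> f k" "\<And>k. f k \<le> M"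
    "\<And>k. f k = infsum v {..k}" "\<And>k. v summable_on {..k}"
    "\<And>e. e > 0 \<Longrightarrow> \<exists>K. \<forall>k\<le>K. f k \<le> e" "\<And>e. e > 0 \<Longrightarrow> \<exists>K. \<forall>k\<ge>K. f k \<ge> M - e"
proof -
  have bound: "sum v F \<le> M" if "finite F" for F
  proof -
    have "ennreal (sum v F) = (\<Sum>k\<in>F. ennreal (v k))" by (simp add: sum_ennreal v)
    also have "\<dots> \<le> ennreal M" unfolding M(1)[symmetric] by (rule sum_le_nn_integral_count_space[OF that])
    finally show ?thesis using \<open>0 \<le> M\<close> by simp
  qed
  have summ: "v summable_on A" for A
    by (rule nonneg_bounded_partial_sums_imp_summable_on[of _ _ M])
       (auto simp: v bound intro!: eventually_finite_subsets_at_top_weakI)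
  define f where "f k = infsum v {..k}" for k
  have attained: "\<exists>F. finite F \<and> sum v F \<ge> M - e" if "e > 0" for e
  proof (rule ccontr)
    assume *: "\<not> ?thesis"
    then have lt: "sum v F < M - e" if "finite F" for F using * that by (auto simp: not_le)
    have "M - e > 0" using lt[of "{}"] by simp
    have "ennreal M \<le> ennreal (M - e)"
      unfolding M(1)[symmetric]
    proof (rule nn_integral_count_space_le)
      fix F :: "int set" assume "finite F"
      then show "(\<Sum>k\<in>F. ennreal (v k)) \<le> ennreal (M - e)"
        using lt[of F] by (simp add: sum_ennreal v ennreal_leI)
    qed
    then show False using \<open>M - e > 0\<close> \<open>e > 0\<close> by simp
  qed
  show ?thesis
  proof (rule that[of f])
    fix k :: int
    have "{..k} = {..k - 1} \<union> {k}" by auto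
    then have "f k = infsum v ({..k - 1} \<union> {k})" by (simp add: f_def)
    also have "\<dots> = f (k - 1) + infsum v {k}"
      unfolding f_def by (rule infsum_Un_disjoint) (auto intro: summ)
    finally show "f k - f (k - 1) = v k" by simp
    show "0 \<le> f k" by (simp add: f_def infsum_nonneg v)
    show "f k \<le> M" unfolding f_def by (rule infsum_le_finite_sums[OF summ bound])
    show "f k = infsum v {..k}" by (rule f_def)
    show "v summable_on {..k}" by (rule summ)
  next
    fix e :: real assume "e > 0"
    then obtain F where F: "finite F" "sum v F \<ge> M - e" using attained by blast
    show "\<exists>K. \<forall>k\<le>K. f k \<le> e"
    proof (intro exI allI impI)
      fix k assume k: "k \<le> Min (insert 0 F) - 1"
      show "f k \<le> e" unfolding f_def
      proof (rule infsum_le_finite_sums[OF summ])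
        fix G assume G: "finite G" "G \<subseteq> {..k}"
        have "G \<inter> F = {}"
        proof -
          have "Min (insert 0 F) \<le> x" if "x \<in> F" for x using that F(1) by (intro Min_le) auto
          then show ?thesis using G k by fastforce
        qed
        then have "sum v G + sum v F = sum v (G \<union> F)" using G F by (simp add: sum.union_disjoint)
        also have "\<dots> \<le> M" by (rule bound) (use G F in auto)
        finally show "sum v G \<le> e" using F(2) by simp
      qed
    qed
    show "\<exists>K. \<forall>k\<ge>K. f k \<ge> M - e"
    proof (intro exI allI impI)
      fix k assume k: "Max (insert 0 F) \<le> k"
      have "F \<subseteq> {..k}" using F(1) k by auto
      then have "sum v F \<le> f k" unfolding f_def
        by (intro finite_sum_le_infsum[OF summ F(1)]) (auto simp: v)
      then show "M - e \<le> f k" using F(2) by simp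
    qed
  qed
qed

section \<open>Existence of stationary profiles\<close>

text \<open>
The bounded solution \<open>u\<close> of \<open>u' = l u - g\<close>, in the form that integrates along the characteristics, which come
from the right.
\<close>
definition relax :: "real \<Rightarrow> (real \<Rightarrow> real) \<Rightarrow> real \<Rightarrow> real" where
  "relax l g x = exp (l * x) * integral {x..} (\<lambda>z. exp (- l * z) * g z)"

lemma relax_integrable:
  fixes g :: "real \<Rightarrow> real"
  assumes "l > 0" "continuous_on UNIV g" "\<And>z. \<bar>g z\<bar> \<le> K"
  shows "(\<lambda>z. exp (- l * z) * g z) integrable_on {x..}"
proof (rule measurable_bounded_by_integrable_imp_integrable_real)
  have "continuous_on {x..} (\<lambda>z. exp (- l * z) * g z)"
    by (intro continuous_intros continuous_on_subset[OF assms(2)]) auto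
  then show "(\<lambda>z. exp (- l * z) * g z) \<in> borel_measurable (lebesgue_on {x..})"
    by (rule continuous_imp_measurable_on_sets_lebesgue) auto
  show "(\<lambda>z. K * exp (- l * z)) integrable_on {x..}"
    using has_integral_exp_minus_to_infinity[OF \<open>l > 0\<close>, of x]
    by (intro integrable_on_mult_right) blast
  show "\<bar>exp (- l * z) * g z\<bar> \<le> K * exp (- l * z)" if "z \<in> {x..}" for z
    using assms(3)[of z] by (simp add: abs_mult mult.commute)
qed auto

lemma relax_le:
  assumes "(\<lambda>z. exp (- l * z) * g z) integrable_on {x..}" "(f has_integral I) {x..}"
    and "\<And>z. z \<ge> x \<Longrightarrow> exp (- l * z) * g z \<le> f z"
  shows "relax l g x \<le> exp (l * x) * I"
  unfolding relax_def
  by (intro mult_left_mono has_integral_le[OF integrable_integral[OF assms(1)] assms(2)]) (use assms(3) in auto)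

lemma relax_ge:
  assumes "(\<lambda>z. exp (- l * z) * g z) integrable_on {x..}" "(f has_integral I) {x..}"
    and "\<And>z. z \<ge> x \<Longrightarrow> f z \<le> exp (- l * z) * g z"
  shows "exp (l * x) * I \<le> relax l g x"
  unfolding relax_def
  by (intro mult_left_mono has_integral_le[OF assms(2) integrable_integral[OF assms(1)]]) (use assms(3) in auto)

lemma relax_mono:
  assumes "(\<lambda>z. exp (- l * z) * g z) integrable_on {x..}"
    and "(\<lambda>z. exp (- l * z) * f z) integrable_on {x..}"
    and "\<And>z. z \<ge> x \<Longrightarrow> g z \<le> f z"
  shows "relax l g x \<le> relax l f x"
  unfolding relax_def
  by (intro mult_left_mono integral_le assms(1,2)) (use assms(3) in auto)

lemma has_integral_exp_tail:
  fixes l c x :: real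
  assumes "l > 0"
  shows "((\<lambda>z. c * exp (- l * z)) has_integral c * (exp (- l * x) / l)) {x..}"
  by (intro has_integral_mult_right has_integral_exp_minus_to_infinity assms)

lemma relax_const_le:
  assumes "l > 0" "(\<lambda>z. exp (- l * z) * g z) integrable_on {x..}" "\<And>z. z \<ge> x \<Longrightarrow> g z \<le> c"
  shows "relax l g x \<le> c / l"
proof -
  have "relax l g x \<le> exp (l * x) * (c * (exp (- l * x) / l))"
    by (rule relax_le[OF assms(2) has_integral_exp_tail[OF assms(1)]])
       (simp add: mult.commute[of c] assms(3))
  also have "\<dots> = c / l" by (simp add: exp_minus)
  finally show ?thesis .
qed

lemma relax_const_ge:
  assumes "l > 0" "(\<lambda>z. exp (- l * z) * g z) integrable_on {x..}" "\<And>z. z \<ge> x \<Longrightarrow> c \<le> g z"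
  shows "c / l \<le> relax l g x"
proof -
  have "c / l = exp (l * x) * (c * (exp (- l * x) / l))" by (simp add: exp_minus)
  also have "\<dots> \<le> relax l g x"
    by (rule relax_ge[OF assms(2) has_integral_exp_tail[OF assms(1)]])
       (simp add: mult.commute[of c] assms(3))
  finally show ?thesis .
qed

lemma relax_deriv:
  fixes g :: "real \<Rightarrow> real"
  assumes "continuous_on UNIV g" "\<And>x. (\<lambda>z. exp (- l * z) * g z) integrable_on {x..}"
  shows "(relax l g has_real_derivative l * relax l g x - g x) (at x)"
proof -
  define f where "f z = exp (- l * z) * g z" for z
  have int: "f integrable_on {x..}" for x using assms(2) by (simp add: f_def[abs_def])
  have cf: "continuous_on S f" for S
    unfolding f_def by (intro continuous_intros continuous_on_subset[OF assms(1)]) auto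
  have relax_f: "relax l g w = exp (l * w) * integral {w..} f" for w
    by (simp add: relax_def f_def[abs_def])
  define b where "b = x - 1"
  have eq: "integral {w..} f = integral {b..} f - integral {b..w} f" if "b \<le> w" for w
  proof -
    have "{b..} = {b..w} \<union> {w..}" using that by auto
    moreover have "(f has_integral integral {b..w} f + integral {w..} f) ({b..w} \<union> {w..})"
    proof (rule has_integral_Un)
      show "(f has_integral integral {b..w} f) {b..w}"
        by (intro integrable_integral integrable_continuous_interval cf)
      show "(f has_integral integral {w..} f) {w..}" by (rule integrable_integral[OF int])
      have "{b..w} \<inter> {w..} \<subseteq> {w}" by auto
      then show "negligible ({b..w} \<inter> {w..})" by (rule negligible_subset[rotated]) simp
    qed
    ultimately show ?thesis by (simp add: integral_unique)
  qed
  have "((\<lambda>w. integral {b..w} f) has_real_derivative f x) (at x within {b..x + 1})"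
    by (rule integral_has_real_derivative[OF cf]) (simp add: b_def)
  moreover have "at x within {b..x + 1} = at x"
    by (rule at_within_interior) (simp add: b_def)
  ultimately have d: "((\<lambda>w. integral {b..w} f) has_real_derivative f x) (at x)" by simp
  have "((\<lambda>w. exp (l * w) * (integral {b..} f - integral {b..w} f)) has_real_derivative
      l * (exp (l * x) * (integral {b..} f - integral {b..x} f)) - exp (l * x) * f x) (at x)"
    by (rule derivative_eq_intros d refl | simp)+
  also have "exp (l * x) * f x = g x"
    unfolding f_def mult.assoc[symmetric] exp_add[symmetric] by simp
  also have "exp (l * x) * (integral {b..} f - integral {b..x} f) = relax l g x"
    using eq[of x] by (simp add: relax_f b_def)
  finally show ?thesis
  proof (rule DERIV_cong_ev[THEN iffD1, rotated -1])
    have "eventually (\<lambda>w. w > b) (nhds x)"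
      by (rule eventually_nhds_in_open[of "{b<..}" x, simplified]) (simp add: b_def)
    then show "eventually (\<lambda>w. exp (l * w) * (integral {b..} f - integral {b..w} f) = relax l g w) (nhds x)"
    proof eventually_elim
      case (elim w)
      then show ?case using eq[of w] by (simp only: relax_f less_imp_le)
    qed
  qed simp_all
qed

text \<open>
The flux \<open>w (p - q)\<^sup>2\<close> increases with \<open>p\<close>. Adding the linear term \<open>2 c p\<close> compensates for this as long as
the derivative \<open>2 w (p - q)\<close> stays below \<open>2 c\<close>. In \<open>q\<close> the flux decreases, because \<open>p - q\<close> is nonnegative.
\<close>
lemma relaxed_rate_mono:
  fixes p q p' q' w c :: real
  assumes "q \<le> p" "q' \<le> p'" "p \<le> p'" "q \<le> q'" "w \<ge> 0" "w * (p - q) \<le> c" "w * (p' - q') \<le> c"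
  shows "2 * c * p - w * (p - q)\<^sup>2 \<le> 2 * c * p' - w * (p' - q')\<^sup>2"
proof (cases "p' - q' \<le> p - q")
  case True
  have "c \<ge> 0" using mult_nonneg_nonneg[OF \<open>w \<ge> 0\<close>, of "p - q"] assms(1,6) by linarith
  then have "2 * c * p \<le> 2 * c * p'" using assms(3) by (intro mult_left_mono) auto
  moreover have "w * (p' - q')\<^sup>2 \<le> w * (p - q)\<^sup>2"
    using True assms by (intro mult_left_mono power_mono) auto
  ultimately show ?thesis by simp
next
  case False
  have "w * (p' - q')\<^sup>2 - w * (p - q)\<^sup>2 = ((p' - q') - (p - q)) * (w * (p' - q') + w * (p - q))"
    by (simp add: power2_eq_square algebra_simps)
  also have "\<dots> \<le> ((p' - q') - (p - q)) * (2 * c)"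
    using False assms by (intro mult_left_mono) auto
  also have "\<dots> \<le> (p' - p) * (2 * c)"
  proof (intro mult_right_mono)
    show "0 \<le> 2 * c" using mult_nonneg_nonneg[OF \<open>w \<ge> 0\<close>, of "p - q"] assms(1,6) by linarith
  qed (use assms in auto)
  finally show ?thesis by (simp add: algebra_simps)
qed

text \<open>
The constants of the barriers for the profile equation: \<open>C exp (a x)\<close> solves it exactly, \<open>x0\<close> lies so
far to the right that \<open>M - M exp (x0 - x)\<close> is a lower solution beyond it, and the last condition places the
lower bound below the upper one.
\<close>
locale profile_bounds =
  fixes a M C x0 :: real
  assumes a: "0 < a" and M: "0 < M" and C: "C * (1 - exp (- a))\<^sup>2 = a"
    and x0: "exp (- a * x0) * M * (exp 1 - 1)\<^sup>2 \<le> 1" and Mx0: "M \<le> C * exp (a * x0)"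
begin

lemma C_pos: "C > 0"
proof -
  have "1 - exp (- a) > 0" using a by simp
  then have "(1 - exp (- a))\<^sup>2 > 0" by simp
  then show ?thesis using a C by (metis zero_less_mult_pos2)
qed

lemma a_le_C: "a \<le> C"
proof -
  have "(1 - exp (- a))\<^sup>2 \<le> 1" using a by (intro power_le_one) auto
  then have "C * (1 - exp (- a))\<^sup>2 \<le> C * 1" using C_pos by (intro mult_left_mono) auto
  then show ?thesis using C by simp
qed

definition lower :: "real \<Rightarrow> real" where
  "lower x = max 0 (M - M * exp (x0 - x))"

text \<open>
The bound \<open>C exp (a x)\<close> also yields \<open>exp (- a x) (\<Phi> x - \<Phi> (x - 1)) \<le> C\<close>, the condition under which
\<open>relaxed_rate_mono\<close> applies with relaxation constant \<open>2 C\<close>.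
\<close>
definition between :: "(real \<Rightarrow> real) \<Rightarrow> bool" where
  "between \<Phi> \<longleftrightarrow> mono \<Phi> \<and> (\<forall>x. lower x \<le> \<Phi> x \<and> \<Phi> x \<le> M \<and> \<Phi> x \<le> C * exp (a * x))"

definition source :: "(real \<Rightarrow> real) \<Rightarrow> real \<Rightarrow> real" where
  "source \<Phi> z = 2 * C * \<Phi> z - exp (- a * z) * (\<Phi> z - \<Phi> (z - 1))\<^sup>2"

lemma betweenD:
  assumes "between \<Phi>"
  shows "x \<le> y \<Longrightarrow> \<Phi> x \<le> \<Phi> y" "lower x \<le> \<Phi> x" "0 \<le> \<Phi> x" "\<Phi> x \<le> M" "\<Phi> x \<le> C * exp (a * x)"
    "exp (- a * x) * (\<Phi> x - \<Phi> (x - 1)) \<le> C"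
proof -
  show "x \<le> y \<Longrightarrow> \<Phi> x \<le> \<Phi> y" "lower x \<le> \<Phi> x" "\<Phi> x \<le> M" "\<Phi> x \<le> C * exp (a * x)"
    using assms by (auto simp: between_def mono_def)
  have nn: "0 \<le> \<Phi> x" for x
    using assms by (auto simp: between_def lower_def intro: order_trans[rotated])
  then show "0 \<le> \<Phi> x" .
  have "exp (- a * x) * (\<Phi> x - \<Phi> (x - 1)) \<le> exp (- a * x) * (C * exp (a * x))"
  proof (rule mult_left_mono)
    show "\<Phi> x - \<Phi> (x - 1) \<le> C * exp (a * x)"
      using \<open>\<Phi> x \<le> C * exp (a * x)\<close> nn[of "x - 1"] by linarith
  qed simp
  also have "\<dots> = C" by (simp add: exp_minus)
  finally show "exp (- a * x) * (\<Phi> x - \<Phi> (x - 1)) \<le> C" .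
qed

lemma source_mono:
  assumes "between \<Phi>" "between \<Psi>" "\<And>x. \<Phi> x \<le> \<Psi> x"
  shows "source \<Phi> z \<le> source \<Psi> z"
  unfolding source_def
  by (rule relaxed_rate_mono) (use assms betweenD(1,6) in auto)

text \<open>
The weight \<open>exp (- a x)\<close> decreases in \<open>x\<close>, so shifting to the right only helps; the rest is the monotonicity
of the relaxed rate, applied to the values of \<open>\<Phi>\<close> at the two places.
\<close>
lemma source_increasing:
  assumes "between \<Phi>" "x \<le> z"
  shows "source \<Phi> x \<le> source \<Phi> z"
proof -
  have w: "exp (- a * z) \<le> exp (- a * x)" using a assms(2) by simp
  have d: "0 \<le> \<Phi> x - \<Phi> (x - 1)" using betweenD(1)[OF assms(1), of "x - 1" x] by simp
  have "2 * C * \<Phi> x - exp (- a * z) * (\<Phi> x - \<Phi> (x - 1))\<^sup>2 \<le> source \<Phi> z"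
    unfolding source_def
  proof (rule relaxed_rate_mono)
    have "exp (- a * z) * (\<Phi> x - \<Phi> (x - 1)) \<le> exp (- a * x) * (\<Phi> x - \<Phi> (x - 1))"
      by (rule mult_right_mono[OF w d])
    then show "exp (- a * z) * (\<Phi> x - \<Phi> (x - 1)) \<le> C"
      using betweenD(6)[OF assms(1), of x] by simp
    show "exp (- a * z) * (\<Phi> z - \<Phi> (z - 1)) \<le> C" by (rule betweenD(6)[OF assms(1)])
  qed (use betweenD(1)[OF assms(1)] assms(2) in auto)
  moreover have "exp (- a * z) * (\<Phi> x - \<Phi> (x - 1))\<^sup>2 \<le> exp (- a * x) * (\<Phi> x - \<Phi> (x - 1))\<^sup>2"
    by (rule mult_right_mono[OF w]) simp
  ultimately show ?thesis unfolding source_def by linarith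
qed

lemma source_bounds:
  assumes "between \<Phi>"
  shows "0 \<le> source \<Phi> z" "source \<Phi> z \<le> 2 * C * M" "source \<Phi> z \<le> (2 * C - a) * C * exp (a * z)"
proof -
  have "2 * C * 0 - exp (- a * z) * (0 - 0)\<^sup>2 \<le> source \<Phi> z"
    unfolding source_def
    by (rule relaxed_rate_mono) (use betweenD[OF assms] C_pos in auto)
  then show "0 \<le> source \<Phi> z" by simp
  have "source \<Phi> z \<le> 2 * C * \<Phi> z" by (simp add: source_def)
  also have "\<dots> \<le> 2 * C * M" using betweenD(4)[OF assms] C_pos by (intro mult_left_mono) auto
  finally show "source \<Phi> z \<le> 2 * C * M" .
  define p where "p = C * exp (a * z)"
  define q where "q = C * exp (a * (z - 1))"
  have q: "q = p * exp (- a)" by (simp add: p_def q_def exp_add[symmetric] algebra_simps)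
  have wp: "exp (- a * z) * p = C" by (simp add: p_def exp_minus)
  have p0: "p > 0" using C_pos by (simp add: p_def)
  have qp: "q \<le> p" "0 \<le> q" using p0 a by (auto simp: q)
  have "source \<Phi> z \<le> 2 * C * p - exp (- a * z) * (p - q)\<^sup>2"
    unfolding source_def
  proof (rule relaxed_rate_mono)
    have "exp (- a * z) * (p - q) \<le> exp (- a * z) * p" using qp by (intro mult_left_mono) auto
    then show "exp (- a * z) * (p - q) \<le> C" unfolding wp .
    show "exp (- a * z) * (\<Phi> z - \<Phi> (z - 1)) \<le> C" by (rule betweenD(6)[OF assms])
  qed (use betweenD[OF assms] qp in \<open>auto simp: p_def q_def\<close>)
  also have "exp (- a * z) * (p - q)\<^sup>2 = (exp (- a * z) * p) * (1 - exp (- a))\<^sup>2 * p"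
    by (simp add: q power2_eq_square algebra_simps)
  also have "\<dots> = a * p" by (simp only: wp C)
  also have "2 * C * p - a * p = (2 * C - a) * C * exp (a * z)" by (simp add: p_def algebra_simps)
  finally show "source \<Phi> z \<le> (2 * C - a) * C * exp (a * z)" .
qed

lemma source_lower:
  assumes "between \<Phi>" "x0 \<le> z"
  shows "2 * C * M - (2 * C + 1) * (M * exp (x0 - z)) \<le> source \<Phi> z"
proof -
  define e where "e = M * exp (x0 - z)"
  have e: "0 < e" "e \<le> M" using M assms(2) by (auto simp: e_def)
  have lz: "lower z = M - e" using e by (simp add: lower_def e_def)
  have lz1: "lower (z - 1) \<ge> M - e * exp 1"
    by (simp add: lower_def e_def exp_add[symmetric] exp_diff mult_ac)
  have "M * exp (x0 - z) \<le> M * exp (x0 - (z - 1))" using M by (intro mult_left_mono) auto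
  then have lmono: "lower (z - 1) \<le> lower z" unfolding lower_def by linarith
  have l0: "lower x \<ge> 0" for x by (simp add: lower_def)
  have "2 * C * lower z - exp (- a * z) * (lower z - lower (z - 1))\<^sup>2 \<le> source \<Phi> z"
    unfolding source_def
  proof (rule relaxed_rate_mono)
    have "lower z \<le> C * exp (a * z)" using betweenD(2,5)[OF assms(1), of z] by simp
    then have "exp (- a * z) * (lower z - lower (z - 1)) \<le> exp (- a * z) * (C * exp (a * z))"
      using l0[of "z - 1"] by (intro mult_left_mono) auto
    also have "\<dots> = C" by (simp add: exp_minus)
    finally show "exp (- a * z) * (lower z - lower (z - 1)) \<le> C" .
    show "exp (- a * z) * (\<Phi> z - \<Phi> (z - 1)) \<le> C" by (rule betweenD(6)[OF assms(1)])
  qed (use lmono betweenD(1,2)[OF assms(1)] in auto)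
  moreover have "exp (- a * z) * (lower z - lower (z - 1))\<^sup>2 \<le> e"
  proof -
    have "exp (- a * z) * (lower z - lower (z - 1))\<^sup>2 \<le> exp (- a * x0) * (e * (exp 1 - 1))\<^sup>2"
      using lz lz1 lmono a assms(2) by (intro mult_mono power_mono) (auto simp: algebra_simps)
    also have "\<dots> = (exp (- a * x0) * e * (exp 1 - 1)\<^sup>2) * e"
      by (simp add: power2_eq_square)
    also have "\<dots> \<le> 1 * e"
    proof (rule mult_right_mono)
      have "exp (- a * x0) * e * (exp 1 - 1)\<^sup>2 \<le> exp (- a * x0) * M * (exp 1 - 1)\<^sup>2"
        using e by (intro mult_right_mono mult_left_mono) auto
      then show "exp (- a * x0) * e * (exp 1 - 1)\<^sup>2 \<le> 1" using x0 by (rule order_trans)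
    qed (use e in simp)
    finally show ?thesis by simp
  qed
  ultimately show ?thesis unfolding lz e_def[symmetric] by (simp add: algebra_simps)
qed

lemma source_integrable:
  assumes "between \<Phi>" "continuous_on UNIV \<Phi>"
  shows "(\<lambda>z. exp (- (2 * C) * z) * source \<Phi> z) integrable_on {x..}"
proof (rule relax_integrable)
  show "continuous_on UNIV (source \<Phi>)"
    unfolding source_def[abs_def]
    by (intro continuous_intros assms(2) continuous_on_compose2[OF assms(2)]) auto
  show "\<bar>source \<Phi> z\<bar> \<le> 2 * C * M" for z
    using source_bounds(1,2)[OF assms(1), of z] by simp
qed (use C_pos in simp)

text \<open>
The profile equation \<open>\<Phi>' = exp (- a x) (\<Phi> x - \<Phi> (x - 1))\<^sup>2\<close> reads \<open>\<Phi>' = 2 C \<Phi> - source \<Phi>\<close>, so that its bounded solutions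
are the fixed points of this map, which is monotone by \<open>source_mono\<close>.
\<close>
definition iterate :: "(real \<Rightarrow> real) \<Rightarrow> real \<Rightarrow> real" where
  "iterate \<Phi> = relax (2 * C) (source \<Phi>)"

lemma iterate_deriv:
  assumes "between \<Phi>" "continuous_on UNIV \<Phi>"
  shows "(iterate \<Phi> has_real_derivative 2 * C * iterate \<Phi> x - source \<Phi> x) (at x)"
  unfolding iterate_def
proof (rule relax_deriv)
  show "continuous_on UNIV (source \<Phi>)"
    unfolding source_def[abs_def]
    by (intro continuous_intros assms(2) continuous_on_compose2[OF assms(2)]) auto
qed (rule source_integrable[OF assms])

lemma iterate_continuous:
  assumes "between \<Phi>" "continuous_on UNIV \<Phi>"
  shows "continuous_on UNIV (iterate \<Phi>)"
  by (intro continuous_at_imp_continuous_on ballI DERIV_isCont[OF iterate_deriv[OF assms]])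

text \<open>
This says that the derivative of the iterate is nonnegative: the source increases, so its exponential
average over \<open>[x, \<infinity>)\<close> is at least its value at \<open>x\<close>.
\<close>
lemma iterate_ge_source:
  assumes "between \<Phi>" "continuous_on UNIV \<Phi>"
  shows "source \<Phi> x \<le> 2 * C * iterate \<Phi> x"
proof -
  have "source \<Phi> x / (2 * C) \<le> iterate \<Phi> x"
    unfolding iterate_def
    by (rule relax_const_ge[OF _ source_integrable[OF assms]])
       (use C_pos source_increasing[OF assms(1)] in auto)
  then show ?thesis using C_pos by (simp add: field_simps)
qed

text \<open>
Each bound is preserved because it is, or lies below, its own image: \<open>C exp (a x)\<close> and the constants \<open>0\<close>
and \<open>M\<close> are fixed points, and \<open>M - M exp (x0 - x)\<close> is a lower solution to the right of \<open>x0\<close>.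
\<close>
lemma iterate_between:
  assumes "between \<Phi>" "continuous_on UNIV \<Phi>"
  shows "between (iterate \<Phi>)"
  unfolding between_def
proof (intro conjI allI)
  note int = source_integrable[OF assms]
  show "mono (iterate \<Phi>)"
  proof (rule monoI)
    fix x y :: real assume "x \<le> y"
    then show "iterate \<Phi> x \<le> iterate \<Phi> y"
      by (rule DERIV_nonneg_imp_nondecreasing)
         (use iterate_deriv[OF assms] iterate_ge_source[OF assms] in force)
  qed
  fix x
  show upM: "iterate \<Phi> x \<le> M"
  proof -
    have "iterate \<Phi> x \<le> (2 * C * M) / (2 * C)"
      unfolding iterate_def
      by (rule relax_const_le[OF _ int]) (use C_pos source_bounds[OF assms(1)] in auto)
    then show ?thesis using C_pos by simp
  qed
  show "iterate \<Phi> x \<le> C * exp (a * x)"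
  proof -
    have pos: "2 * C - a > 0" using a_le_C C_pos by simp
    have "iterate \<Phi> x \<le> exp (2 * C * x) * (((2 * C - a) * C) * (exp (- (2 * C - a) * x) / (2 * C - a)))"
      unfolding iterate_def
    proof (rule relax_le[OF int has_integral_exp_tail[OF pos]])
      fix z
      have "exp (- (2 * C) * z) * source \<Phi> z \<le> exp (- (2 * C) * z) * ((2 * C - a) * C * exp (a * z))"
        by (intro mult_left_mono source_bounds(3)[OF assms(1)]) simp
      also have "\<dots> = (2 * C - a) * C * (exp (- (2 * C) * z) * exp (a * z))" by simp
      also have "exp (- (2 * C) * z) * exp (a * z) = exp (- (2 * C - a) * z)"
        unfolding exp_add[symmetric] by (rule arg_cong[of _ _ exp]) (simp add: algebra_simps)
      finally show "exp (- (2 * C) * z) * source \<Phi> z \<le> (2 * C - a) * C * exp (- (2 * C - a) * z)" .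
    qed
    also have "\<dots> = C * (exp (2 * C * x) * exp (- (2 * C - a) * x))" using pos by simp
    also have "exp (2 * C * x) * exp (- (2 * C - a) * x) = exp (a * x)"
      unfolding exp_add[symmetric] by (rule arg_cong[of _ _ exp]) (simp add: algebra_simps)
    finally show ?thesis .
  qed
  show "lower x \<le> iterate \<Phi> x"
  proof -
    have "0 / (2 * C) \<le> iterate \<Phi> x"
      unfolding iterate_def
      by (rule relax_const_ge[OF _ int]) (use C_pos source_bounds[OF assms(1)] in auto)
    then have nn: "0 \<le> iterate \<Phi> x" by simp
    show ?thesis
    proof (cases "x0 \<le> x")
      case False
      then have "M * 1 \<le> M * exp (x0 - x)" using M by (intro mult_left_mono) auto
      then show ?thesis using nn by (simp add: lower_def)
    next
      case True
      have p1: "2 * C > 0" "2 * C + 1 > 0" using C_pos by auto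
      have "exp (2 * C * x) * ((2 * C * M) * (exp (- (2 * C) * x) / (2 * C))
          - ((2 * C + 1) * (M * exp x0)) * (exp (- (2 * C + 1) * x) / (2 * C + 1))) \<le> iterate \<Phi> x"
        unfolding iterate_def
      proof (rule relax_ge[OF int has_integral_diff[OF has_integral_exp_tail[OF p1(1)] has_integral_exp_tail[OF p1(2)]]])
        fix z assume "x \<le> z"
        have "exp (- (2 * C) * z) * exp (x0 - z) = exp x0 * exp (- (2 * C + 1) * z)"
          unfolding exp_add[symmetric] by (rule arg_cong[of _ _ exp]) (simp add: algebra_simps)
        then have "2 * C * M * exp (- (2 * C) * z) - (2 * C + 1) * (M * exp x0) * exp (- (2 * C + 1) * z)
           = exp (- (2 * C) * z) * (2 * C * M - (2 * C + 1) * (M * exp (x0 - z)))"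
          by (simp add: algebra_simps)
        also have "\<dots> \<le> exp (- (2 * C) * z) * source \<Phi> z"
          using True \<open>x \<le> z\<close> by (intro mult_left_mono source_lower assms) auto
        finally show "2 * C * M * exp (- (2 * C) * z) - (2 * C + 1) * (M * exp x0) * exp (- (2 * C + 1) * z)
           \<le> exp (- (2 * C) * z) * source \<Phi> z" .
      qed
      moreover have "exp (2 * C * x) * ((2 * C * M) * (exp (- (2 * C) * x) / (2 * C))
          - ((2 * C + 1) * (M * exp x0)) * (exp (- (2 * C + 1) * x) / (2 * C + 1)))
          = M * (exp (2 * C * x) * exp (- (2 * C) * x)) - M * (exp (2 * C * x) * exp x0 * exp (- (2 * C + 1) * x))"
        using p1 by (simp add: right_diff_distrib)
      moreover have "exp (2 * C * x) * exp (- (2 * C) * x) = 1"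
        unfolding exp_add[symmetric] by simp
      moreover have "exp (2 * C * x) * exp x0 * exp (- (2 * C + 1) * x) = exp (x0 - x)"
        unfolding exp_add[symmetric] by (rule arg_cong[of _ _ exp]) (simp add: algebra_simps)
      ultimately show ?thesis using nn by (simp add: lower_def)
    qed
  qed
qed

lemma iterate_mono:
  assumes "between \<Phi>" "continuous_on UNIV \<Phi>" "between \<Psi>" "continuous_on UNIV \<Psi>" "\<And>x. \<Phi> x \<le> \<Psi> x"
  shows "iterate \<Phi> x \<le> iterate \<Psi> x"
  unfolding iterate_def
  by (intro relax_mono source_integrable source_mono assms)

lemma iterate_lipschitz:
  assumes "between \<Phi>" "continuous_on UNIV \<Phi>" "x \<le> y"
  shows "\<bar>iterate \<Phi> y - iterate \<Phi> x\<bar> \<le> 2 * C * M * (y - x)"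
proof (cases "x = y")
  case False
  then have "x < y" using assms(3) by simp
  then obtain z where z: "iterate \<Phi> y - iterate \<Phi> x = (y - x) * (2 * C * iterate \<Phi> z - source \<Phi> z)"
    using MVT2[of x y "iterate \<Phi>" "\<lambda>z. 2 * C * iterate \<Phi> z - source \<Phi> z"] iterate_deriv[OF assms(1,2)] by blast
  have "2 * C * iterate \<Phi> z \<le> 2 * C * M"
    using betweenD(4)[OF iterate_between[OF assms(1,2)]] C_pos by (intro mult_left_mono) auto
  then have "\<bar>2 * C * iterate \<Phi> z - source \<Phi> z\<bar> \<le> 2 * C * M"
    using source_bounds(1)[OF assms(1), of z] iterate_ge_source[OF assms(1,2), of z] by linarith
  then have "(y - x) * \<bar>2 * C * iterate \<Phi> z - source \<Phi> z\<bar> \<le> (y - x) * (2 * C * M)"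
    using \<open>x < y\<close> by (intro mult_left_mono) auto
  then show ?thesis unfolding z using \<open>x < y\<close> by (simp add: abs_mult mult_ac)
qed simp

definition upper :: "real \<Rightarrow> real" where
  "upper x = min M (C * exp (a * x))"

lemma upper_between: "between upper"
  unfolding between_def
proof (intro conjI allI)
  show "mono upper"
    unfolding mono_def upper_def
    using a C_pos by (intro allI impI min.mono mult_left_mono) auto
  fix x
  show "lower x \<le> upper x"
  proof (cases "x0 \<le> x")
    case True
    have "M \<le> C * exp (a * x0)" by (rule Mx0)
    also have "\<dots> \<le> C * exp (a * x)" using True a C_pos by (intro mult_left_mono) auto
    finally show ?thesis using M by (auto simp: lower_def upper_def)
  next
    case False
    then have "M * 1 \<le> M * exp (x0 - x)" using M by (intro mult_left_mono) auto
    then show ?thesis using M C_pos by (simp add: lower_def upper_def)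
  qed
qed (auto simp: upper_def)

lemma upper_continuous: "continuous_on UNIV upper"
  unfolding upper_def[abs_def] by (intro continuous_intros)

text \<open>
The iterates of the upper bound decrease. Their limit is a fixed point by monotone convergence, and it is
continuous because the iterates are Lipschitz with a common constant; a continuous fixed point is
differentiable and solves the equation.
\<close>
lemma exists_profile:
  "\<exists>\<Phi>. between \<Phi> \<and> (\<forall>x. (\<Phi> has_real_derivative exp (- a * x) * (\<Phi> x - \<Phi> (x - 1))\<^sup>2) (at x))"
proof -
  define f where "f n = (iterate ^^ n) upper" for n
  have f_Suc: "f (Suc n) = iterate (f n)" for n by (simp add: f_def)
  have f: "between (f n) \<and> continuous_on UNIV (f n)" for n
  proof (induction n)
    case 0
    then show ?case using upper_between upper_continuous by (simp add: f_def)
  next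
    case (Suc n)
    then show ?case by (simp add: f_Suc iterate_between iterate_continuous)
  qed
  then have fb: "between (f n)" and fc: "continuous_on UNIV (f n)" for n by auto
  have dec: "f (Suc n) x \<le> f n x" for n x
  proof (induction n arbitrary: x)
    case 0
    show ?case using betweenD(4,5)[OF fb, of "Suc 0" x] by (simp add: f_def upper_def)
  next
    case (Suc n)
    then show ?case unfolding f_Suc[of "Suc n"] f_Suc[of n]
      by (intro iterate_mono) (use fb fc in \<open>auto simp: f_Suc[symmetric]\<close>)
  qed
  have "\<exists>L. (\<lambda>n. f n x) \<longlonglongrightarrow> L" for x
    by (rule decseq_convergent[of "\<lambda>n. f n x" 0])
       (use dec betweenD(3)[OF fb] in \<open>auto simp: decseq_Suc_iff\<close>)
  then obtain \<Phi> where lim: "(\<lambda>n. f n x) \<longlonglongrightarrow> \<Phi> x" for x by metis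
  have \<Phi>: "between \<Phi>"
    unfolding between_def
  proof (intro conjI allI)
    show "mono \<Phi>"
      by (intro monoI LIMSEQ_le[OF lim lim]) (use betweenD(1)[OF fb] in auto)
    show "lower x \<le> \<Phi> x" for x by (rule LIMSEQ_le_const[OF lim]) (use betweenD(2)[OF fb] in auto)
    show "\<Phi> x \<le> M" for x by (rule LIMSEQ_le_const2[OF lim]) (use betweenD(4)[OF fb] in auto)
    show "\<Phi> x \<le> C * exp (a * x)" for x by (rule LIMSEQ_le_const2[OF lim]) (use betweenD(5)[OF fb] in auto)
  qed
  have cont: "continuous_on UNIV \<Phi>"
  proof -
    have lip: "\<bar>\<Phi> y - \<Phi> x\<bar> \<le> 2 * C * M * (y - x)" if "x \<le> y" for x y
    proof (rule LIMSEQ_le_const2)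
      show "(\<lambda>n. \<bar>f (Suc n) y - f (Suc n) x\<bar>) \<longlonglongrightarrow> \<bar>\<Phi> y - \<Phi> x\<bar>"
        by (intro tendsto_intros LIMSEQ_Suc lim)
      show "\<exists>N. \<forall>n\<ge>N. \<bar>f (Suc n) y - f (Suc n) x\<bar> \<le> 2 * C * M * (y - x)"
        unfolding f_Suc using iterate_lipschitz[OF fb fc that] by blast
    qed
    have "lipschitz_on (2 * C * M) UNIV \<Phi>"
    proof (rule lipschitz_onI)
      fix x y :: real
      show "dist (\<Phi> x) (\<Phi> y) \<le> 2 * C * M * dist x y"
        using lip[of x y] lip[of y x] by (cases "x \<le> y") (auto simp: dist_real_def abs_minus_commute)
    qed (use C_pos M in simp)
    then show ?thesis by (rule lipschitz_on_continuous_on)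
  qed
  have fixpoint: "iterate \<Phi> x = \<Phi> x" for x
  proof -
    have int: "(\<lambda>z. exp (- (2 * C) * z) * source (f n) z) integrable_on {x..}" for n
      by (rule source_integrable[OF fb fc])
    have "(\<lambda>n. integral {x..} (\<lambda>z. exp (- (2 * C) * z) * source (f n) z))
        \<longlonglongrightarrow> integral {x..} (\<lambda>z. exp (- (2 * C) * z) * source \<Phi> z)"
    proof (rule monotone_convergence_decreasing[THEN conjunct2])
      show "exp (- (2 * C) * z) * source (f (Suc n)) z \<le> exp (- (2 * C) * z) * source (f n) z" for n z
        by (intro mult_left_mono source_mono fb dec) simp
      show "(\<lambda>n. exp (- (2 * C) * z) * source (f n) z) \<longlonglongrightarrow> exp (- (2 * C) * z) * source \<Phi> z" for z
        unfolding source_def by (intro tendsto_intros lim)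
      show "bounded (range (\<lambda>n. integral {x..} (\<lambda>z. exp (- (2 * C) * z) * source (f n) z)))"
      proof -
        have eq: "integral {x..} (\<lambda>z. exp (- (2 * C) * z) * source (f n) z) = exp (- (2 * C) * x) * f (Suc n) x" for n
          by (simp add: f_Suc iterate_def relax_def exp_minus)
        have "norm (integral {x..} (\<lambda>z. exp (- (2 * C) * z) * source (f n) z)) \<le> exp (- (2 * C) * x) * M" for n
          unfolding eq using betweenD(3,4)[OF fb, of "Suc n" x] by (simp add: abs_mult)
        then show ?thesis by (auto simp: bounded_iff)
      qed
    qed (rule int)
    then have "(\<lambda>n. exp (2 * C * x) * integral {x..} (\<lambda>z. exp (- (2 * C) * z) * source (f n) z))
        \<longlonglongrightarrow> iterate \<Phi> x"
      unfolding iterate_def relax_def by (intro tendsto_mult_left)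
    then have "(\<lambda>n. f (Suc n) x) \<longlonglongrightarrow> iterate \<Phi> x"
      by (simp add: f_Suc iterate_def relax_def)
    moreover have "(\<lambda>n. f (Suc n) x) \<longlonglongrightarrow> \<Phi> x" by (rule LIMSEQ_Suc[OF lim])
    ultimately show ?thesis by (rule LIMSEQ_unique)
  qed
  have "iterate \<Phi> = \<Phi>" using fixpoint by (rule ext)
  then have "(\<Phi> has_real_derivative 2 * C * \<Phi> x - source \<Phi> x) (at x)" for x
    using iterate_deriv[OF \<Phi> cont, of x] by simp
  then have "(\<Phi> has_real_derivative exp (- a * x) * (\<Phi> x - \<Phi> (x - 1))\<^sup>2) (at x)" for x
    by (simp add: source_def)
  with \<Phi> show ?thesis by blast
qed

end

text \<open>
The bounds \<open>M - M exp (x0 - x) \<le> \<Phi> x \<le> C exp (a x)\<close> and \<open>0 \<le> \<Phi> \<le> M\<close> force the limits at both ends; without the lower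
bound the iteration could lose mass, even converge to \<open>0\<close>.
\<close>
lemma exists_stationary_cumulative:
  fixes a M :: real
  assumes "a > 0" "M \<ge> 0"
  obtains \<Phi> where "mono \<Phi>" "\<And>x. 0 \<le> \<Phi> x" "\<And>x. \<Phi> x \<le> M"
    "\<And>x. (\<Phi> has_real_derivative exp (- a * x) * (\<Phi> x - \<Phi> (x - 1))\<^sup>2) (at x)"
    "(\<Phi> \<longlongrightarrow> 0) at_bot" "(\<Phi> \<longlongrightarrow> M) at_top"
proof (cases "M = 0")
  case True
  then show ?thesis by (intro that[of "\<lambda>_. 0"]) (auto simp: mono_def)
next
  case False
  then have "M > 0" using assms by simp
  define C where "C = a / (1 - exp (- a))\<^sup>2"
  have q: "(1 - exp (- a))\<^sup>2 > 0" using \<open>a > 0\<close> by simp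
  have "C > 0" using q \<open>a > 0\<close> by (simp add: C_def)
  define B :: real where "B = (exp 1 - 1)\<^sup>2"
  have "B > 0" by (simp add: B_def)
  define x0 where "x0 = max (M * B) (M / C) / a"
  have ax0: "a * x0 = max (M * B) (M / C)" using \<open>a > 0\<close> by (simp add: x0_def)
  have big: "M * B \<le> exp (a * x0)" "M / C \<le> exp (a * x0)"
    using exp_ge_add_one_self[of "a * x0"] unfolding ax0 by linarith+
  interpret profile_bounds a M C x0
  proof
    show "exp (- a * x0) * M * (exp 1 - 1)\<^sup>2 \<le> 1"
      using big(1) by (simp add: exp_minus B_def field_simps)
    show "M \<le> C * exp (a * x0)" using big(2) \<open>C > 0\<close> by (simp add: field_simps)
  qed (use assms \<open>M > 0\<close> q in \<open>auto simp: C_def\<close>)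
  obtain \<Phi> where \<Phi>: "between \<Phi>"
    "\<And>x. (\<Phi> has_real_derivative exp (- a * x) * (\<Phi> x - \<Phi> (x - 1))\<^sup>2) (at x)"
    using exists_profile by blast
  show ?thesis
  proof (rule that[of \<Phi>])
    show "mono \<Phi>" using \<Phi>(1) by (simp add: between_def)
    show "(\<Phi> \<longlongrightarrow> 0) at_bot"
    proof (rule tendsto_sandwich[of "\<lambda>_. 0" _ _ "\<lambda>x. C * exp (a * x)"])
      have "filterlim (\<lambda>x. a * x) at_bot at_bot"
        using \<open>a > 0\<close> by (intro filterlim_tendsto_pos_mult_at_bot[OF tendsto_const]) (auto simp: filterlim_ident)
      then have "((\<lambda>x. exp (a * x)) \<longlongrightarrow> 0) at_bot"
        by (rule filterlim_compose[OF exp_at_bot])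
      then show "((\<lambda>x. C * exp (a * x)) \<longlongrightarrow> 0) at_bot" by (rule tendsto_mult_right_zero)
    qed (use betweenD[OF \<Phi>(1)] in auto)
    show "(\<Phi> \<longlongrightarrow> M) at_top"
    proof (rule tendsto_sandwich[of "\<lambda>x. M - M * exp (x0 - x)" _ _ "\<lambda>_. M"])
      have "filterlim (\<lambda>x. x0 - x) at_bot at_top"
        unfolding filterlim_at_bot
      proof
        fix Z
        show "\<forall>\<^sub>F x in at_top. x0 - x \<le> Z"
          using eventually_ge_at_top[of "x0 - Z"] by eventually_elim simp
      qed
      then have "((\<lambda>x. M * exp (x0 - x)) \<longlongrightarrow> 0) at_top"
        by (intro tendsto_mult_right_zero filterlim_compose[OF exp_at_bot])
      then show "((\<lambda>x. M - M * exp (x0 - x)) \<longlongrightarrow> M) at_top"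
        using tendsto_diff[OF tendsto_const[of M]] by fastforce
      show "\<forall>\<^sub>F x in at_top. M - M * exp (x0 - x) \<le> \<Phi> x"
        using betweenD(2)[OF \<Phi>(1)] by (simp add: lower_def)
    qed (use betweenD[OF \<Phi>(1)] in auto)
  qed (use \<Phi> betweenD[OF \<Phi>(1)] in auto)
qed

section \<open>Solutions restricted to a fibre are flows\<close>

text \<open>
The geometric series \<open>\<Sum>j\<le>k. exp (a (j + y))\<close> equals \<open>exp (a (k + y)) / (1 - exp (- a))\<close>; it is summed by telescoping.
\<close>
lemma infsum_lower_exp_bound:
  fixes v :: "int \<Rightarrow> real"
  assumes "a > 0" "v summable_on {..k}" "B \<ge> 0"
    and le: "\<And>j. v j \<le> B * exp (a * (of_int j + y))"
  shows "infsum v {..k} \<le> B / (1 - exp (- a)) * exp (a * (of_int k + y))"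
proof (rule infsum_le_finite_sums[OF assms(2)])
  fix F :: "int set" assume F: "finite F" "F \<subseteq> {..k}"
  have q: "1 - exp (- a) > 0" using \<open>a > 0\<close> by simp
  define g where "g j = B / (1 - exp (- a)) * exp (a * (of_int j + y))" for j :: int
  have g: "g j - g (j - 1) = B * exp (a * (of_int j + y))" for j
  proof -
    have "exp (a * (of_int (j - 1) + y)) = exp (- a) * exp (a * (of_int j + y))"
      unfolding exp_add[symmetric] by (rule arg_cong[of _ _ exp]) (simp add: algebra_simps)
    then have "g j - g (j - 1) = B / (1 - exp (- a)) * ((1 - exp (- a)) * exp (a * (of_int j + y)))"
      by (simp add: g_def algebra_simps)
    then show ?thesis using q by simp
  qed
  have g0: "g j \<ge> 0" for j using q \<open>B \<ge> 0\<close> by (simp add: g_def)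
  define m where "m = min k (Min (insert 0 F) - 1)"
  have sub: "F \<subseteq> {m<..k}"
  proof
    fix j assume "j \<in> F"
    then have "Min (insert 0 F) \<le> j" using F(1) by (intro Min_le) auto
    then show "j \<in> {m<..k}" using \<open>j \<in> F\<close> F(2) by (auto simp: m_def)
  qed
  have "sum v F \<le> (\<Sum>j\<in>F. B * exp (a * (of_int j + y)))" by (intro sum_mono le)
  also have "\<dots> \<le> (\<Sum>j\<in>{m<..k}. B * exp (a * (of_int j + y)))"
    using sub \<open>B \<ge> 0\<close> by (intro sum_mono2) auto
  also have "\<dots> = g k - g m"
    unfolding g[symmetric] by (rule sum_telescope_int) (simp add: m_def)
  also have "\<dots> \<le> g k" using g0[of m] by simp
  finally show "sum v F \<le> B / (1 - exp (- a)) * exp (a * (of_int k + y))" by (simp add: g_def)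
qed

lemma exp_small_left:
  fixes a d :: real
  assumes "a > 0" "d > 0" "x \<le> ln d / a"
  shows "exp (a * x) \<le> d"
proof -
  have "a * x \<le> ln d" using assms by (simp add: pos_le_divide_eq mult.commute)
  then have "exp (a * x) \<le> exp (ln d)" by simp
  then show ?thesis using \<open>d > 0\<close> by simp
qed

text \<open>
Instead of differentiating an infinite sum, \<open>V k\<close> is defined as the initial partial sum minus the integral over time
of the flux \<open>J k = exp (a x) h\<^sup>2\<close> out of \<open>k\<close>. Its increments and the weighted values \<open>exp (a x) h\<close> have the same derivative
\<open>J (k - 1) - J k\<close> and the same initial value, hence agree. Boundedness of \<open>h\<close> on finite time intervals
makes the flux vanish as \<open>k \<rightarrow> - \<infinity>\<close>, and boundedness of \<open>h0\<close> gives the initial exponential bound on the left.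
\<close>
lemma solution_cumulative_flow:
  assumes a: "a > 0" and sol: "is_solution a h0 h" and B: "\<And>x. h0 x \<le> B"
    and M: "fibre_sum (\<lambda>x. ennreal (exp (a * x) * h0 x)) y = ennreal M" "0 \<le> M"
  obtains V where "cumulative_flow a y V"
    "\<And>k t. t \<ge> 0 \<Longrightarrow> V k t - V (k - 1) t = exp (a * (y + of_int k - t)) * h t (y + of_int k - t)"
    "\<And>k t. t \<ge> 0 \<Longrightarrow> V k t \<le> M"
    "uniform_tails y M V"
proof -
  have hnn: "h t x \<ge> 0" if "t \<ge> 0" for t x using sol that by (simp add: is_solution_def)
  have h0: "h 0 x = h0 x" for x using sol by (simp add: is_solution_def)
  have h0nn: "h0 x \<ge> 0" for x using hnn[of 0 x] by (simp add: h0)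
  have B0: "B \<ge> 0" using h0nn[of 0] B[of 0] by simp
  define H where "H k t = h t (y + of_int k - t)" for k :: int and t
  define F where "F k t = a * H k t + exp (- a) * (H (k - 1) t)\<^sup>2 - (H k t)\<^sup>2" for k t
  have Hder: "(H k has_real_derivative F k t) (at t within {0..})" if "t \<ge> 0" for k t
  proof -
    have "((\<lambda>s. h s (y + of_int k - s)) has_real_derivative
       (a * h t (y + of_int k - t) + exp (- a) * (h t (y + of_int k - t - 1))\<^sup>2 - (h t (y + of_int k - t))\<^sup>2))
        (at t within {0..})"
      using sol that by (auto simp: is_solution_def Let_def)
    moreover have "y + of_int k - t - 1 = y + of_int (k - 1) - t" by simp
    ultimately show ?thesis by (simp only: H_def[abs_def] F_def)
  qed
  have Hcont: "continuous_on {0..} (H k)" for k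
    using Hder by (auto simp: continuous_on_eq_continuous_within intro!: DERIV_continuous)
  define J where "J k t = exp (a * (y + of_int k - t)) * (H k t)\<^sup>2" for k t
  have Jcont: "continuous_on {0..} (J k)" for k
    unfolding J_def by (intro continuous_intros Hcont)
  have Jint: "J k integrable_on {0..t}" for k t
    by (intro integrable_continuous_interval continuous_on_subset[OF Jcont]) auto
  have J0: "J k t \<ge> 0" for k t by (simp add: J_def)
  define v where "v k = exp (a * (of_int k + y)) * h0 (of_int k + y)" for k :: int
  have v0: "v k \<ge> 0" for k by (simp add: v_def h0nn)
  have vM: "(\<integral>\<^sup>+k. ennreal (v k) \<partial>count_space UNIV) = ennreal M"
    using M(1) by (simp add: fibre_sum_def v_def)
  obtain f where f: "\<And>k. f k - f (k - 1) = v k" "\<And>k. 0 \<le> f k" "\<And>k. f k \<le> M"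
    "\<And>k. f k = infsum v {..k}" "\<And>k. v summable_on {..k}"
    "\<And>e. e > 0 \<Longrightarrow> \<exists>K. \<forall>k\<le>K. f k \<le> e" "\<And>e. e > 0 \<Longrightarrow> \<exists>K. \<forall>k\<ge>K. f k \<ge> M - e"
    using cumulative_of_mass[OF v0 vM M(2)] by metis
  define V where "V k t = f k - integral {0..t} (J k)" for k t
  have V0: "V k 0 = f k" for k by (simp add: V_def)
  have Vder: "(V k has_real_derivative - J k t) (at t within {0..})" if "t \<ge> 0" for k t
  proof -
    have "((\<lambda>x. integral {0..x} (J k)) has_real_derivative J k t) (at t within {0..t + 1})"
      by (rule integral_has_real_derivative) (use that in \<open>auto intro: continuous_on_subset[OF Jcont]\<close>)
    also have "at t within {0..t + 1} = at t within {0..}"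
      by (rule at_within_nhd[of _ "{..<t + 1}"]) auto
    finally have "((\<lambda>x. f k - integral {0..x} (J k)) has_real_derivative 0 - J k t) (at t within {0..})"
      by (intro DERIV_diff DERIV_const)
    then show ?thesis by (simp add: V_def[abs_def])
  qed
  have step: "V k t - V (k - 1) t = exp (a * (y + of_int k - t)) * H k t" if "t \<ge> 0" for k t
  proof -
    define D where "D t = V k t - V (k - 1) t - exp (a * (y + of_int k - t)) * H k t" for t
    have "(D has_real_derivative 0) (at s within {0..})" if "s \<in> {0..}" for s
    proof -
      have s: "s \<ge> 0" using that by simp
      have "(D has_real_derivative - J k s - - J (k - 1) s -
          (- a * exp (a * (y + of_int k - s)) * H k s + exp (a * (y + of_int k - s)) * F k s)) (at s within {0..})"
        unfolding D_def
        by (rule derivative_eq_intros Vder[OF s] Hder[OF s] refl | simp)+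
      moreover define E where "E = exp (a * (y + of_int k - s))"
      have "J (k - 1) s = E * (exp (- a) * (H (k - 1) s)\<^sup>2)"
      proof -
        have "exp (a * (y + of_int (k - 1) - s)) = E * exp (- a)"
          unfolding E_def exp_add[symmetric] by (rule arg_cong[of _ _ exp]) (simp add: algebra_simps)
        then show ?thesis by (simp add: J_def)
      qed
      moreover have "J k s = E * (H k s)\<^sup>2" by (simp add: J_def E_def)
      ultimately have "(D has_real_derivative - (E * (H k s)\<^sup>2) - - (E * (exp (- a) * (H (k - 1) s)\<^sup>2)) -
          (- a * E * H k s + E * F k s)) (at s within {0..})"
        by (simp only: E_def)
      then show ?thesis by (simp add: F_def algebra_simps)
    qed
    then obtain c where c: "\<And>s. s \<in> {0..} \<Longrightarrow> D s = c"
      using has_field_derivative_zero_constant[of "{0..}" D] by auto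
    have "D 0 = 0" using f(1)[of k] by (simp add: D_def V0 H_def h0 v_def add.commute)
    then have "D t = 0" using c[of t] c[of 0] that by simp
    then show ?thesis by (simp add: D_def)
  qed
  have flow: "cumulative_flow a y V"
    unfolding cumulative_flow_def
  proof (intro conjI allI impI)
    fix k :: int and t :: real assume t: "0 \<le> t"
    show "V (k - 1) t \<le> V k t"
      using step[OF t, of k] mult_nonneg_nonneg[OF exp_ge_zero hnn[OF t]] unfolding H_def
      by (metis diff_ge_0_iff_ge)
    have "J k t = exp (- a * (y + of_int k - t)) * (V k t - V (k - 1) t)\<^sup>2"
    proof -
      have "exp (- a * (y + of_int k - t)) * exp (a * (y + of_int k - t)) = 1"
        unfolding exp_add[symmetric] by simp
      then have "exp (- a * (y + of_int k - t)) * (exp (a * (y + of_int k - t)) * (exp (a * (y + of_int k - t)) * (H k t)\<^sup>2))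
         = exp (a * (y + of_int k - t)) * (H k t)\<^sup>2"
        by (simp only: mult.assoc[symmetric] mult_1_left)
      then show ?thesis by (simp add: step[OF t] J_def power2_eq_square mult_ac)
    qed
    with Vder[OF t, of k]
    show "(V k has_real_derivative - exp (- a * (y + of_int k - t)) * (V k t - V (k - 1) t)\<^sup>2) (at t within {0..})"
      by simp
  next
    fix T e :: real assume e: "e > 0"
    define T' where "T' = max T 1"
    have "bounded ((\<lambda>(t, x). h t x) ` ({0..T'} \<times> UNIV))"
      using sol by (auto simp: is_solution_def T'_def)
    then obtain b where b: "\<forall>t\<in>{0..T'}. \<forall>x. \<bar>h t x\<bar> \<le> b"
      by (auto simp: bounded_iff)
    define b' where "b' = max b 1"
    have b': "b' > 0" "\<And>t x. 0 \<le> t \<Longrightarrow> t \<le> T' \<Longrightarrow> \<bar>h t x\<bar> \<le> b'"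
      using b by (auto simp: b'_def le_max_iff_disj)
    define d where "d = e / 2 / (T' * b'\<^sup>2)"
    have d: "d > 0" using e b'(1) by (simp add: d_def T'_def)
    obtain K1 where K1: "\<And>k. k \<le> K1 \<Longrightarrow> f k \<le> e / 2" using f(6)[of "e / 2"] e by auto
    show "\<exists>K. \<forall>k\<le>K. \<forall>t\<in>{0..T}. \<bar>V k t\<bar> \<le> e"
    proof (intro exI allI impI ballI)
      fix k t assume k: "k \<le> min K1 \<lfloor>ln d / a - y\<rfloor>" and t: "t \<in> {0..T}"
      have tT: "0 \<le> t" "t \<le> T'" using t by (auto simp: T'_def)
      have "y + of_int k \<le> ln d / a" using k by (simp add: le_floor_iff)
      then have ed: "exp (a * (y + of_int k)) \<le> d" by (rule exp_small_left[OF a d])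
      have "J k s \<le> d * b'\<^sup>2" if "s \<in> {0..t}" for s
      proof -
        have "exp (a * (y + of_int k - s)) \<le> exp (a * (y + of_int k))"
          using a that by simp
        then have "exp (a * (y + of_int k - s)) \<le> d" using ed by (rule order_trans)
        moreover have "(H k s)\<^sup>2 \<le> b'\<^sup>2"
        proof -
          have "\<bar>H k s\<bar> \<le> b'" unfolding H_def by (rule b'(2)) (use that tT in auto)
          then have "\<bar>H k s\<bar>\<^sup>2 \<le> b'\<^sup>2" by (intro power_mono) auto
          then show ?thesis by simp
        qed
        ultimately show ?thesis unfolding J_def using d by (intro mult_mono) auto
      qed
      then have "integral {0..t} (J k) \<le> integral {0..t} (\<lambda>_. d * b'\<^sup>2)"
        by (intro integral_le Jint) auto
      also have "\<dots> = t * (d * b'\<^sup>2)" using tT by simp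
      also have "\<dots> \<le> T' * (d * b'\<^sup>2)" using tT d by (intro mult_right_mono) auto
      also have "\<dots> = e / 2" using b'(1) by (simp add: d_def T'_def)
      finally have "integral {0..t} (J k) \<le> e / 2" .
      moreover have "0 \<le> integral {0..t} (J k)" by (intro integral_nonneg Jint J0)
      moreover have "0 \<le> f k" "f k \<le> e / 2" using f(2) K1 k by auto
      ultimately show "\<bar>V k t\<bar> \<le> e" unfolding V_def by linarith
    qed
  qed
  have le: "V k t \<le> M" if "t \<ge> 0" for k t
    using flow_le_initial[OF flow that, of k] f(3)[of k] by (simp add: V0)
  have tails: "uniform_tails y M V"
  proof (rule uniform_tailsI)
    fix e :: real assume e: "e > 0"
    define C where "C = max (a / (1 - exp (- a))\<^sup>2) (B / (1 - exp (- a)))"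
    have "0 < a / (1 - exp (- a))\<^sup>2" using a by simp
    then have C: "C > 0" "C \<ge> a / (1 - exp (- a))\<^sup>2" "C \<ge> B / (1 - exp (- a))"
      by (auto simp: C_def less_max_iff_disj)
    have init: "V k 0 \<le> C * exp (a * (y + of_int k))" for k
    proof -
      have "infsum v {..k} \<le> B / (1 - exp (- a)) * exp (a * (of_int k + y))"
        by (rule infsum_lower_exp_bound[OF a f(5) B0])
           (use B in \<open>auto simp: v_def mult.commute[of B] intro!: mult_left_mono\<close>)
      also have "\<dots> \<le> C * exp (a * (of_int k + y))" using C by (intro mult_right_mono) auto
      finally show ?thesis by (simp add: V0 f(4) add.commute)
    qed
    show "\<exists>L. \<forall>k. \<forall>t\<ge>0. y + of_int k - t \<le> L \<longrightarrow> V k t \<le> e"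
    proof (intro exI allI impI)
      fix k :: int and t :: real assume t: "0 \<le> t" and x: "y + of_int k - t \<le> ln (e / C) / a"
      have "V k t \<le> C * exp (a * (y + of_int k - t))"
        by (rule flow_left_tail[OF flow a C(2) init t])
      also have "\<dots> \<le> C * (e / C)"
        by (intro mult_left_mono exp_small_left[OF a _ x]) (use e C in auto)
      finally show "V k t \<le> e" using C(1) by simp
    qed
    show "\<exists>R. \<forall>k. \<forall>t\<ge>0. y + of_int k - t \<ge> R \<longrightarrow> V k t \<ge> M - e"
      by (rule flow_right_tail[OF flow a M(2) _ e]) (simp add: V0 f(7))
  qed
  show ?thesis
    by (rule that[OF flow _ le tails]) (use step in \<open>auto simp: H_def\<close>)
qed

lemma profile_cumulative_flow:
  assumes "mono \<Phi>" "\<And>x. 0 \<le> \<Phi> x"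
    and der: "\<And>x. (\<Phi> has_real_derivative exp (- a * x) * (\<Phi> x - \<Phi> (x - 1))\<^sup>2) (at x)"
    and left: "(\<Phi> \<longlongrightarrow> 0) at_bot"
  shows "cumulative_flow a y (\<lambda>k t. \<Phi> (y + of_int k - t))"
  unfolding cumulative_flow_def
proof (intro conjI allI impI)
  fix k :: int and t :: real
  show "\<Phi> (y + of_int (k - 1) - t) \<le> \<Phi> (y + of_int k - t)"
    using \<open>mono \<Phi>\<close> by (rule monoD) simp
  have "((\<lambda>t. \<Phi> (y + of_int k - t)) has_real_derivative
     (exp (- a * (y + of_int k - t)) * (\<Phi> (y + of_int k - t) - \<Phi> (y + of_int k - t - 1))\<^sup>2) * (- 1)) (at t within {0..})"
    by (rule DERIV_chain'[OF _ der]) (auto intro!: derivative_eq_intros)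
  moreover have "y + of_int k - t - 1 = y + of_int (k - 1) - t" by simp
  ultimately show "((\<lambda>t. \<Phi> (y + of_int k - t)) has_real_derivative
     - exp (- a * (y + of_int k - t)) * (\<Phi> (y + of_int k - t) - \<Phi> (y + of_int (k - 1) - t))\<^sup>2) (at t within {0..})"
    by simp
next
  fix T e :: real assume "e > 0"
  then have "eventually (\<lambda>x. \<Phi> x < e) at_bot" using left by (rule order_tendstoD(2)[rotated])
  then obtain L where L: "\<And>x. x \<le> L \<Longrightarrow> \<Phi> x < e" by (auto simp: eventually_at_bot_linorder)
  show "\<exists>K. \<forall>k\<le>K. \<forall>t\<in>{0..T}. \<bar>\<Phi> (y + of_int k - t)\<bar> \<le> e"
  proof (intro exI allI impI ballI)
    fix k t assume "k \<le> \<lfloor>L - y\<rfloor>" "t \<in> {0..T}"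
    then have "y + of_int k - t \<le> L" by (auto simp: le_floor_iff)
    then show "\<bar>\<Phi> (y + of_int k - t)\<bar> \<le> e" using L assms(2) by (simp add: less_imp_le)
  qed
qed

lemma profile_uniform_tails:
  assumes left: "(\<Phi> \<longlongrightarrow> 0) at_bot" and right: "(\<Phi> \<longlongrightarrow> M) at_top"
  shows "uniform_tails y M (\<lambda>k t. \<Phi> (y + of_int k - t))"
proof (rule uniform_tailsI)
  fix e :: real assume "e > 0"
  then have "eventually (\<lambda>x. \<Phi> x < e) at_bot" using left by (rule order_tendstoD(2)[rotated])
  then obtain L where L: "\<And>x. x \<le> L \<Longrightarrow> \<Phi> x < e" by (auto simp: eventually_at_bot_linorder)
  then show "\<exists>L. \<forall>k. \<forall>t\<ge>0. y + of_int k - t \<le> L \<longrightarrow> \<Phi> (y + of_int k - t) \<le> e"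
    by (intro exI[of _ L]) (auto intro: less_imp_le)
  have "M - e < M" using \<open>e > 0\<close> by simp
  then have "eventually (\<lambda>x. M - e < \<Phi> x) at_top" using right by (rule order_tendstoD(1)[rotated])
  then obtain R where R: "\<And>x. x \<ge> R \<Longrightarrow> M - e < \<Phi> x" by (auto simp: eventually_at_top_linorder)
  then show "\<exists>R. \<forall>k. \<forall>t\<ge>0. y + of_int k - t \<ge> R \<longrightarrow> M - e \<le> \<Phi> (y + of_int k - t)"
    by (intro exI[of _ R]) (auto intro: less_imp_le)
qed

text \<open>
The uniform tails identify the limits of \<open>V k t\<close> as \<open>0\<close> and \<open>M\<close>: this is conservation of mass on a fibre.
\<close>
lemma flow_mass:
  assumes V: "cumulative_flow a y V" and le: "\<And>k. V k t \<le> M" and T: "uniform_tails y M V" and t: "t \<ge> 0"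
  shows "(\<integral>\<^sup>+k. ennreal (V k t - V (k - 1) t) \<partial>count_space UNIV) = ennreal M"
proof (rule mass_of_cumulative)
  fix e :: real assume "e > 0"
  from uniform_tailsD[OF T \<open>e > 0\<close>] obtain R where
    R: "\<forall>k. \<forall>t\<ge>0. y + of_int k - t \<le> - R \<longrightarrow> V k t \<le> e"
    "\<forall>k. \<forall>t\<ge>0. y + of_int k - t \<ge> R \<longrightarrow> V k t \<ge> M - e"
    by (elim exE conjE) (rule that)
  have "y + of_int \<lfloor>t - y - R\<rfloor> - t \<le> - R" by linarith
  then show "\<exists>k. V k t \<le> e" using R(1) t by blast
  have "y + of_int \<lceil>t - y + R\<rceil> - t \<ge> R" by linarith
  then show "\<exists>k. V k t \<ge> M - e" using R(2) t by blast
qed (use le flow_step[OF V t] flow_nonneg[OF V t] in auto)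

section \<open>Measurability of solutions\<close>

text \<open>
The right-hand side along a characteristic, with \<open>p\<close> the value at the point and \<open>q\<close> the value one unit
to its left.
\<close>
definition vector_field :: "real \<Rightarrow> real \<Rightarrow> real \<Rightarrow> real" where
  "vector_field a p q = a * p + exp (- a) * q\<^sup>2 - p\<^sup>2"

lemma vector_field_lipschitz:
  assumes "a > 0" "\<bar>p\<bar> \<le> b" "\<bar>q\<bar> \<le> b" "\<bar>p'\<bar> \<le> b" "\<bar>q'\<bar> \<le> b"
    and "\<bar>p - p'\<bar> \<le> d" "\<bar>q - q'\<bar> \<le> d"
  shows "\<bar>vector_field a p q - vector_field a p' q'\<bar> \<le> (a + 4 * b) * d"
proof -
  have sq: "\<bar>u\<^sup>2 - u'\<^sup>2\<bar> \<le> 2 * b * d" if "\<bar>u\<bar> \<le> b" "\<bar>u'\<bar> \<le> b" "\<bar>u - u'\<bar> \<le> d" for u u' :: real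
  proof -
    have "\<bar>u\<^sup>2 - u'\<^sup>2\<bar> = \<bar>u + u'\<bar> * \<bar>u - u'\<bar>"
      unfolding abs_mult[symmetric] by (simp add: power2_eq_square algebra_simps)
    also have "\<dots> \<le> (2 * b) * d" using that by (intro mult_mono) auto
    finally show ?thesis by simp
  qed
  have "\<bar>exp (- a) * (q\<^sup>2 - q'\<^sup>2)\<bar> \<le> 1 * (2 * b * d)"
    unfolding abs_mult using \<open>a > 0\<close> by (intro mult_mono sq assms) auto
  moreover have "\<bar>p\<^sup>2 - p'\<^sup>2\<bar> \<le> 2 * b * d" by (intro sq assms)
  moreover have "\<bar>a * (p - p')\<bar> \<le> a * d" using assms by (simp add: abs_mult)
  moreover have "vector_field a p q - vector_field a p' q' = a * (p - p') + exp (- a) * (q\<^sup>2 - q'\<^sup>2) - (p\<^sup>2 - p'\<^sup>2)"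
    by (simp add: vector_field_def algebra_simps)
  ultimately show ?thesis by (simp add: algebra_simps)
qed

lemma vector_field_bound:
  assumes "a > 0" "\<bar>p\<bar> \<le> b" "\<bar>q\<bar> \<le> b"
  shows "\<bar>vector_field a p q\<bar> \<le> (a + 4 * b) * b"
proof -
  have "\<bar>vector_field a p q - vector_field a 0 0\<bar> \<le> (a + 4 * b) * b"
    by (rule vector_field_lipschitz) (use assms in auto)
  then show ?thesis by (simp add: vector_field_def)
qed

text \<open>
Along characteristics the equation is an ordinary differential equation in the space of bounded functions, with a
vector field that is Lipschitz on bounded sets. The Euler approximations are built from \<open>h0\<close> and its integer translates by
algebraic operations and clipping, hence are measurable, and converge uniformly to the solution.
\<close>
lemma solution_measurable:
  assumes a: "a > 0" and sol: "is_solution a h0 h" and meas: "h0 \<in> borel_measurable lebesgue"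
    and t: "t \<ge> 0"
  shows "(\<lambda>x. h t x) \<in> borel_measurable lebesgue"
proof -
  define X where "X s y = h s (y - s)" for s y
  obtain b where b: "b > 0" "\<And>s y. 0 \<le> s \<Longrightarrow> s \<le> t \<Longrightarrow> 0 \<le> X s y \<and> X s y \<le> b"
  proof -
    have "bounded ((\<lambda>(t, x). h t x) ` ({0..max t 1} \<times> UNIV))"
      using sol by (auto simp: is_solution_def)
    then obtain c where "\<forall>s\<in>{0..max t 1}. \<forall>x. \<bar>h s x\<bar> \<le> c"
      by (auto simp: bounded_iff)
    then have "\<bar>h s x\<bar> \<le> c" if "0 \<le> s" "s \<le> t" for s x using that by auto
    moreover have "h s x \<ge> 0" if "s \<ge> 0" for s x using sol that by (simp add: is_solution_def)
    ultimately show ?thesis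
      by (intro that[of "max c 1"]) (auto simp: X_def le_max_iff_disj dest: abs_le_D1)
  qed
  have Xabs: "\<bar>X s y\<bar> \<le> b" if "0 \<le> s" "s \<le> t" for s y using b(2)[OF that, of y] by simp
  define L where "L = a + 4 * b"
  have L: "L > 0" using a b by (simp add: L_def)
  have X0: "X 0 y = h0 y" for y using sol by (simp add: X_def is_solution_def)
  have der: "((\<lambda>s. X s y) has_real_derivative vector_field a (X s y) (X s (y - 1))) (at s within {0..t})"
    if "0 \<le> s" "s \<le> t" for s y
  proof -
    have "((\<lambda>s. h s (y - s)) has_real_derivative
       (a * h s (y - s) + exp (- a) * (h s (y - s - 1))\<^sup>2 - (h s (y - s))\<^sup>2)) (at s within {0..})"
      using sol that by (auto simp: is_solution_def Let_def)
    moreover have "y - s - 1 = y - 1 - s" by simp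
    ultimately have "((\<lambda>s. h s (y - s)) has_real_derivative
       (a * h s (y - s) + exp (- a) * (h s (y - 1 - s))\<^sup>2 - (h s (y - s))\<^sup>2)) (at s within {0..})"
      by (simp only:)
    then have "((\<lambda>s. X s y) has_real_derivative vector_field a (X s y) (X s (y - 1))) (at s within {0..})"
      by (simp add: X_def[abs_def] vector_field_def)
    then show ?thesis by (rule has_field_derivative_subset) auto
  qed
  have mvt: "\<exists>r\<in>{s..s'}. X s' y - X s y = vector_field a (X r y) (X r (y - 1)) * (s' - s)"
    if "0 \<le> s" "s \<le> s'" "s' \<le> t" for s s' y
  proof (rule mvt_very_simple[OF that(2)])
    fix r assume r: "s \<le> r" "r \<le> s'"
    have "((\<lambda>s. X s y) has_real_derivative vector_field a (X r y) (X r (y - 1))) (at r within {s..s'})"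
      by (rule has_field_derivative_subset[OF der]) (use r that in auto)
    then show "((\<lambda>s. X s y) has_derivative (*) (vector_field a (X r y) (X r (y - 1)))) (at r within {s..s'})"
      by (simp add: has_field_derivative_def)
  qed
  have lip: "\<bar>X s' y - X s y\<bar> \<le> L * b * (s' - s)" if s: "0 \<le> s" "s \<le> s'" "s' \<le> t" for s s' y
  proof -
    obtain r where r: "r \<in> {s..s'}" "X s' y - X s y = vector_field a (X r y) (X r (y - 1)) * (s' - s)"
      using mvt[OF s] by blast
    have "\<bar>vector_field a (X r y) (X r (y - 1))\<bar> \<le> L * b"
      unfolding L_def by (rule vector_field_bound[OF a]) (use r s Xabs in auto)
    then show ?thesis using s by (simp add: r(2) abs_mult mult_right_mono)
  qed
  have taylor: "\<bar>X s' y - (X s y + (s' - s) * vector_field a (X s y) (X s (y - 1)))\<bar> \<le> L * (L * b * (s' - s)) * (s' - s)"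
    if s: "0 \<le> s" "s \<le> s'" "s' \<le> t" for s s' y
  proof -
    obtain r where r: "r \<in> {s..s'}" "X s' y - X s y = vector_field a (X r y) (X r (y - 1)) * (s' - s)"
      using mvt[OF s] by blast
    have d: "\<bar>X r z - X s z\<bar> \<le> L * b * (s' - s)" for z
    proof -
      have "\<bar>X r z - X s z\<bar> \<le> L * b * (r - s)" by (rule lip) (use r s in auto)
      also have "\<dots> \<le> L * b * (s' - s)" using r L b by (intro mult_left_mono) auto
      finally show ?thesis .
    qed
    have "\<bar>vector_field a (X r y) (X r (y - 1)) - vector_field a (X s y) (X s (y - 1))\<bar> \<le> L * (L * b * (s' - s))"
      unfolding L_def[symmetric]
      by (rule vector_field_lipschitz[OF a, where b=b, folded L_def]) (use r s Xabs d in auto)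
    then have "\<bar>(vector_field a (X r y) (X r (y - 1)) - vector_field a (X s y) (X s (y - 1))) * (s' - s)\<bar>
        \<le> L * (L * b * (s' - s)) * (s' - s)"
      using s by (simp add: abs_mult mult_right_mono)
    moreover have "(vector_field a (X r y) (X r (y - 1)) - vector_field a (X s y) (X s (y - 1))) * (s' - s)
       = X s' y - (X s y + (s' - s) * vector_field a (X s y) (X s (y - 1)))"
      using r(2) by (simp add: algebra_simps)
    ultimately show ?thesis by simp
  qed
  have approx: "\<exists>g. g \<in> borel_measurable lebesgue \<and> (\<forall>y. \<bar>g y\<bar> \<le> b) \<and>
      (\<forall>y. \<bar>X (of_nat j * \<delta>) y - g y\<bar> \<le> L * b * (of_nat j * \<delta>) * (L * \<delta>) * (1 + L * \<delta>) ^ j)"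
    if "\<delta> \<ge> 0" "of_nat j * \<delta> \<le> t" for \<delta> :: real and j :: nat
    using that(2)
  proof (induction j)
    case 0
    then show ?case
      using meas Xabs[of 0] t by (intro exI[of _ h0]) (simp add: X0)
  next
    case (Suc j)
    define s where "s = of_nat j * \<delta>"
    define s' where "s' = of_nat (Suc j) * \<delta>"
    have ss': "s' - s = \<delta>" by (simp add: s_def s'_def algebra_simps)
    have s: "0 \<le> s" "s \<le> s'" "s' \<le> t" using Suc.prems \<open>\<delta> \<ge> 0\<close> by (auto simp: s_def s'_def algebra_simps)
    define E where "E = L * b * s * (L * \<delta>) * (1 + L * \<delta>) ^ j"
    have E0: "E \<ge> 0" using L b s \<open>\<delta> \<ge> 0\<close> by (simp add: E_def)
    obtain g where g: "g \<in> borel_measurable lebesgue" "\<And>y. \<bar>g y\<bar> \<le> b" "\<And>y. \<bar>X s y - g y\<bar> \<le> E"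
      using Suc s by (auto simp: s_def s'_def E_def)
    define g' where "g' y = g y + \<delta> * vector_field a (g y) (g (y - 1))" for y
    \<comment> \<open>Clipping to the range of the solution does not increase the error and keeps the vector field Lipschitz.\<close>
    define g'' where "g'' y = max 0 (min b (g' y))" for y
    have gs: "(\<lambda>y. g (y - 1)) \<in> borel_measurable lebesgue"
      using measurable_translate_lebesgue[OF g(1), of "- 1"] by simp
    have "g'' \<in> borel_measurable lebesgue"
      unfolding g''_def[abs_def] g'_def[abs_def] vector_field_def
      using g(1) gs by measurable
    moreover have "\<bar>g'' y\<bar> \<le> b" for y using b(1) by (auto simp: g''_def)
    moreover have "\<bar>X s' y - g'' y\<bar> \<le> L * b * s' * (L * \<delta>) * (1 + L * \<delta>) ^ Suc j" for y
    proof -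
      have Xr: "0 \<le> X s' y" "X s' y \<le> b" using b(2)[of s' y] s by auto
      then have "\<bar>X s' y - g'' y\<bar> \<le> \<bar>X s' y - g' y\<bar>" unfolding g''_def by linarith
      also have "X s' y - g' y = (X s' y - (X s y + (s' - s) * vector_field a (X s y) (X s (y - 1))))
          + (X s y - g y) + \<delta> * (vector_field a (X s y) (X s (y - 1)) - vector_field a (g y) (g (y - 1)))"
        by (simp add: g'_def ss' algebra_simps)
      also have "\<bar>\<dots>\<bar> \<le> L * (L * b * \<delta>) * \<delta> + E + \<delta> * (L * E)"
      proof -
        have "\<bar>vector_field a (X s y) (X s (y - 1)) - vector_field a (g y) (g (y - 1))\<bar> \<le> L * E"
          by (rule vector_field_lipschitz[OF a, where b=b, folded L_def]) (use s Xabs g in auto)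
        then have "\<bar>\<delta> * (vector_field a (X s y) (X s (y - 1)) - vector_field a (g y) (g (y - 1)))\<bar> \<le> \<delta> * (L * E)"
          using \<open>\<delta> \<ge> 0\<close> by (simp add: abs_mult mult_left_mono)
        then show ?thesis using taylor[OF s, of y] g(3)[of y] unfolding ss' by linarith
      qed
      also have "\<dots> = L * b * \<delta> * (L * \<delta>) * 1 + L * b * s * (L * \<delta>) * (1 + L * \<delta>) ^ Suc j"
        by (simp add: E_def algebra_simps)
      also have "\<dots> \<le> L * b * \<delta> * (L * \<delta>) * (1 + L * \<delta>) ^ Suc j + L * b * s * (L * \<delta>) * (1 + L * \<delta>) ^ Suc j"
        using L b \<open>\<delta> \<ge> 0\<close> by (intro add_right_mono mult_left_mono one_le_power) auto
      also have "\<dots> = L * b * s' * (L * \<delta>) * (1 + L * \<delta>) ^ Suc j"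
        by (simp only: ss'[symmetric]) (simp add: algebra_simps)
      finally show ?thesis .
    qed
    ultimately show ?case unfolding s'_def by blast
  qed
  define \<delta> where "\<delta> n = t / of_nat (Suc n)" for n
  have \<delta>: "\<delta> n \<ge> 0" "of_nat (Suc n) * \<delta> n = t" for n using t by (auto simp: \<delta>_def)
  have "\<exists>g. g \<in> borel_measurable lebesgue \<and>
      (\<forall>y. \<bar>X t y - g y\<bar> \<le> L * b * t * (L * \<delta> n) * exp (L * t))" for n
  proof -
    obtain g where g: "g \<in> borel_measurable lebesgue"
      "\<And>y. \<bar>X t y - g y\<bar> \<le> L * b * t * (L * \<delta> n) * (1 + L * \<delta> n) ^ Suc n"
      using approx[OF \<delta>(1)[of n], of "Suc n"] unfolding \<delta>(2) by auto
    have "(1 + L * \<delta> n) ^ Suc n \<le> exp (L * \<delta> n) ^ Suc n"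
      using \<delta>(1)[of n] L by (intro power_mono) auto
    also have "\<dots> = exp (of_nat (Suc n) * (L * \<delta> n))" by (rule exp_of_nat_mult[symmetric])
    also have "of_nat (Suc n) * (L * \<delta> n) = L * (of_nat (Suc n) * \<delta> n)" by (simp only: mult_ac)
    finally have "(1 + L * \<delta> n) ^ Suc n \<le> exp (L * t)" unfolding \<delta>(2) .
    then have "L * b * t * (L * \<delta> n) * (1 + L * \<delta> n) ^ Suc n \<le> L * b * t * (L * \<delta> n) * exp (L * t)"
      using L b t \<delta>(1)[of n] by (intro mult_left_mono) auto
    with g show ?thesis by (meson order_trans)
  qed
  then obtain g where g: "\<And>n. g n \<in> borel_measurable lebesgue"
    "\<And>n y. \<bar>X t y - g n y\<bar> \<le> L * b * t * (L * \<delta> n) * exp (L * t)"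
    by metis
  have "\<delta> \<longlonglongrightarrow> 0"
    unfolding \<delta>_def[abs_def] by (rule LIMSEQ_Suc[OF lim_const_over_n])
  then have err: "(\<lambda>n. L * b * t * (L * \<delta> n) * exp (L * t)) \<longlonglongrightarrow> 0"
    by (auto intro!: tendsto_eq_intros)
  have "(\<lambda>n. g n y) \<longlonglongrightarrow> X t y" for y
  proof -
    have "(\<lambda>n. X t y - g n y) \<longlonglongrightarrow> 0"
      by (rule Lim_null_comparison[OF _ err]) (use g(2) in auto)
    from tendsto_diff[OF tendsto_const[of "X t y"] this] show ?thesis by simp
  qed
  then have "X t \<in> borel_measurable lebesgue"
    by (rule borel_measurable_LIMSEQ_real) (rule g(1))
  from measurable_translate_lebesgue[OF this, of t] show ?thesis
    by (simp add: X_def)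
qed

section \<open>Fibre masses of stationary solutions\<close>

lemma AE_unit_interval_witness:
  assumes "AE y in lebesgue. y \<in> {0<..<1::real} \<longrightarrow> Q y"
  obtains y where "y \<in> {0<..<1}" "Q y"
proof (rule ccontr)
  assume "\<not> thesis"
  then have *: "\<And>y. y \<in> {0<..<1} \<Longrightarrow> \<not> Q y" using that by blast
  have "AE y in lebesgue. y \<notin> {0<..<1::real}"
    using assms by eventually_elim (use * in blast)
  then have "{0<..<1::real} \<in> null_sets lebesgue"
    by (subst (asm) AE_iff_null_sets[symmetric]) auto
  then have "emeasure lebesgue {0<..<1::real} = 0" by (rule null_setsD1)
  then show False by simp
qed

lemma exists_finite_fibre:
  fixes f :: "real \<Rightarrow> ennreal"
  assumes f: "f \<in> borel_measurable lebesgue" and fin: "(\<integral>\<^sup>+x. f x \<partial>lebesgue) < \<infinity>"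
  obtains y where "fibre_sum f y < \<infinity>"
proof -
  have "(\<integral>\<^sup>+y\<in>{0..<1}. fibre_sum f y \<partial>lebesgue) \<noteq> \<infinity>"
    using fin unfolding nn_integral_eq_fibre_sum[OF f] by simp
  then have "AE y in lebesgue. fibre_sum f y * indicator {0..<1} y \<noteq> \<infinity>"
    by (intro nn_integral_PInf_AE borel_measurable_times_ennreal measurable_fibre_sum[OF f]
        borel_measurable_indicator) auto
  then have "AE y in lebesgue. y \<in> {0<..<1} \<longrightarrow> fibre_sum f y < \<infinity>"
    by eventually_elim (auto simp: less_top)
  then show ?thesis by (rule AE_unit_interval_witness) (rule that)
qed

lemma eventually_small_of_finite_sum:
  fixes g :: "int \<Rightarrow> real"
  assumes "(\<integral>\<^sup>+k. ennreal (g k) \<partial>count_space UNIV) < \<infinity>" and g: "\<And>k. 0 \<le> g k"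
  obtains K where "\<And>k. k \<ge> K \<Longrightarrow> g k \<le> 1"
proof -
  obtain M where M: "(\<integral>\<^sup>+k. ennreal (g k) \<partial>count_space UNIV) = ennreal M" "0 \<le> M"
    using assms(1) by (cases "\<integral>\<^sup>+k. ennreal (g k) \<partial>count_space UNIV") auto
  obtain f where f: "\<And>k. f k - f (k - 1) = g k" "\<And>k. f k \<le> M"
     "\<And>e. e > 0 \<Longrightarrow> \<exists>K. \<forall>k\<ge>K. f k \<ge> M - e"
    using cumulative_of_mass[OF g M] by metis
  obtain K where K: "\<And>k. k \<ge> K \<Longrightarrow> f k \<ge> M - 1" using f(3)[of 1] by auto
  show ?thesis
  proof (rule that[of "K + 1"])
    fix k assume "K + 1 \<le> k"
    then show "g k \<le> 1" using f(1)[of k] f(2)[of k] K[of "k - 1"] by simp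
  qed
qed

text \<open>
The sum of the increments of a monotone function over a fibre is its total variation on the line, whichever
fibre is taken. Here partial sums over one fibre are compared with longer ones over the other.
\<close>
lemma fibre_sum_increment_le:
  assumes "mono P"
  shows "fibre_sum (\<lambda>x. ennreal (P x - P (x - 1))) y \<le> fibre_sum (\<lambda>x. ennreal (P x - P (x - 1))) z"
  unfolding fibre_sum_def
proof (rule nn_integral_count_space_le)
  have tel: "(\<Sum>k\<in>{i<..j}. ennreal (P (of_int k + u) - P (of_int k + u - 1)))
     = ennreal (P (of_int j + u) - P (of_int i + u))" if "i \<le> j" for i j :: int and u
  proof -
    have "(\<Sum>k\<in>{i<..j}. ennreal (P (of_int k + u) - P (of_int k + u - 1)))
      = ennreal (\<Sum>k\<in>{i<..j}. P (of_int k + u) - P (of_int (k - 1) + u))"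
      by (subst sum_ennreal[symmetric]) (auto simp: algebra_simps intro!: monoD[OF assms])
    then show ?thesis using sum_telescope_int[OF that, of "\<lambda>k. P (of_int k + u)"] by simp
  qed
  fix F :: "int set" assume "finite F"
  define i where "i = Min (insert 0 F) - 1"
  define j where "j = Max (insert 0 F)"
  have "Min (insert 0 F) \<le> 0" "0 \<le> Max (insert 0 F)" using \<open>finite F\<close> by auto
  then have ij: "i \<le> j" by (simp add: i_def j_def)
  have "F \<subseteq> {i<..j}"
  proof
    fix k assume "k \<in> F"
    then have "Min (insert 0 F) \<le> k" "k \<le> Max (insert 0 F)"
      using \<open>finite F\<close> by (auto intro!: Min_le Max_ge)
    then show "k \<in> {i<..j}" by (auto simp: i_def j_def)
  qed
  then have "(\<Sum>k\<in>F. ennreal (P (of_int k + y) - P (of_int k + y - 1)))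
     \<le> (\<Sum>k\<in>{i<..j}. ennreal (P (of_int k + y) - P (of_int k + y - 1)))"
    by (intro sum_mono2) auto
  also have "\<dots> = ennreal (P (of_int j + y) - P (of_int i + y))" by (rule tel[OF ij])
  also have "\<dots> \<le> ennreal (P (of_int (j + \<lceil>\<bar>y - z\<bar>\<rceil>) + z) - P (of_int (i - \<lceil>\<bar>y - z\<bar>\<rceil>) + z))"
  proof (intro ennreal_leI diff_mono monoD[OF assms])
    have "\<bar>y - z\<bar> \<le> of_int \<lceil>\<bar>y - z\<bar>\<rceil>" by simp
    then show "of_int j + y \<le> of_int (j + \<lceil>\<bar>y - z\<bar>\<rceil>) + z" "of_int (i - \<lceil>\<bar>y - z\<bar>\<rceil>) + z \<le> of_int i + y"
      unfolding of_int_add of_int_diff by linarith+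
  qed
  also have "\<dots> = (\<Sum>k\<in>{i - \<lceil>\<bar>y - z\<bar>\<rceil><..j + \<lceil>\<bar>y - z\<bar>\<rceil>}. ennreal (P (of_int k + z) - P (of_int k + z - 1)))"
  proof (rule tel[symmetric])
    have "0 \<le> \<lceil>\<bar>y - z\<bar>\<rceil>" by simp
    then show "i - \<lceil>\<bar>y - z\<bar>\<rceil> \<le> j + \<lceil>\<bar>y - z\<bar>\<rceil>" using ij by linarith
  qed
  also have "\<dots> \<le> (\<integral>\<^sup>+k. ennreal (P (of_int k + z) - P (of_int k + z - 1)) \<partial>count_space UNIV)"
    by (rule sum_le_nn_integral_count_space) simp
  finally show "(\<Sum>k\<in>F. ennreal (P (of_int k + y) - P (of_int k + y - 1)))
     \<le> (\<integral>\<^sup>+k. ennreal (P (of_int k + z) - P (of_int k + z - 1)) \<partial>count_space UNIV)" .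
qed

text \<open>
With \<open>G x = exp (a x) g x\<close> and \<open>q x = exp (a x) (g x)\<^sup>2\<close> the equation reads \<open>G' x = q x - q (x - 1)\<close>. If \<open>P\<close> is an antiderivative
of \<open>q\<close>, then \<open>G x - (P x - P (x - 1))\<close> is a constant \<open>\<kappa>\<close>. Integrability of \<open>G\<close> excludes \<open>\<kappa> \<noteq> 0\<close>, and then the sum of
\<open>G\<close> over any fibre is the total variation of \<open>P\<close>.
\<close>
lemma stationary_fibre_sum_constant:
  assumes a: "a > 0" and st: "is_stationary a g"
  obtains c where "0 \<le> c" "\<And>y. fibre_sum (\<lambda>x. ennreal (exp (a * x) * g x)) y = ennreal c"
proof -
  define G where "G x = exp (a * x) * g x" for x
  define q where "q x = exp (a * x) * (g x)\<^sup>2" for x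
  have G0: "G x \<ge> 0" for x using st unfolding is_stationary_def G_def by simp
  have gder: "(g has_real_derivative deriv g x) (at x)" for x
  proof -
    have "g differentiable (at x)"
      using st unfolding is_stationary_def C1_differentiable_on_eq by blast
    then show ?thesis
      using DERIV_deriv_iff_real_differentiable by blast
  qed
  have gcont: "continuous_on UNIV g"
    by (intro continuous_at_imp_continuous_on ballI DERIV_isCont[OF gder])
  have Gder: "(G has_real_derivative q x - q (x - 1)) (at x)" for x
  proof -
    have "(G has_real_derivative a * exp (a * x) * g x + exp (a * x) * deriv g x) (at x)"
      unfolding G_def by (rule derivative_eq_intros gder refl | simp)+
    moreover have "0 = deriv g x + a * g x + exp (- a) * (g (x - 1))\<^sup>2 - (g x)\<^sup>2"
      using st unfolding is_stationary_def by blast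
    then have "deriv g x = (g x)\<^sup>2 - exp (- a) * (g (x - 1))\<^sup>2 - a * g x" by linarith
    moreover have "exp (a * (x - 1)) = exp (a * x) * exp (- a)"
      unfolding exp_add[symmetric] by (rule arg_cong[of _ _ exp]) (simp add: algebra_simps)
    ultimately show ?thesis by (simp add: q_def algebra_simps)
  qed
  have "\<exists>P. \<forall>x. - \<infinity> < ereal x \<longrightarrow> ereal x < \<infinity> \<longrightarrow> (P has_vector_derivative q x) (at x)"
  proof (rule einterval_antiderivative)
    fix x :: real
    have "continuous_on UNIV q" unfolding q_def by (intro continuous_intros gcont)
    then show "isCont q x" by (simp add: continuous_on_eq_continuous_at)
  qed simp
  then obtain P where P: "\<And>x. (P has_real_derivative q x) (at x)"
    by (auto simp: has_real_derivative_iff_has_vector_derivative)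
  have q0: "q x \<ge> 0" for x by (simp add: q_def)
  have Pmono: "mono P"
  proof (rule monoI)
    fix u v :: real assume "u \<le> v"
    then show "P u \<le> P v"
    proof (rule DERIV_nonneg_imp_nondecreasing)
      fix x show "\<exists>d. (P has_real_derivative d) (at x) \<and> 0 \<le> d" using P[of x] q0[of x] by blast
    qed
  qed
  obtain \<kappa> where \<kappa>: "\<And>x. G x = \<kappa> + (P x - P (x - 1))"
  proof -
    have "((\<lambda>x. G x - (P x - P (x - 1))) has_real_derivative (q x - q (x - 1)) - (q x - q (x - 1) * 1)) (at x)" for x
      by (intro DERIV_diff Gder P DERIV_chain'[OF _ P]) (auto intro!: derivative_eq_intros)
    then have "\<forall>x. ((\<lambda>x. G x - (P x - P (x - 1))) has_real_derivative 0) (at x)" by simp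
    then have "G x - (P x - P (x - 1)) = G 0 - (P 0 - P (0 - 1))" for x
      by (rule DERIV_isconst_all)
    then show ?thesis by (intro that[of "G 0 - (P 0 - P (0 - 1))"]) (simp add: algebra_simps)
  qed
  have int: "integrable lebesgue G" using st unfolding is_stationary_def G_def[abs_def] by blast
  then have Gm: "(\<lambda>x. ennreal (G x)) \<in> borel_measurable lebesgue" by auto
  have Gfin: "(\<integral>\<^sup>+x. ennreal (G x) \<partial>lebesgue) < \<infinity>"
    using integrableD(2)[OF int] G0 by (simp add: less_top)
  obtain y where y: "fibre_sum (\<lambda>x. ennreal (G x)) y < \<infinity>"
    using exists_finite_fibre[OF Gm Gfin] by blast
  obtain K where K: "\<And>k. k \<ge> K \<Longrightarrow> G (of_int k + y) \<le> 1"
    using eventually_small_of_finite_sum[of "\<lambda>k. G (of_int k + y)"] y G0 unfolding fibre_sum_def by blast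
  have "\<kappa> = 0"
  proof (rule ccontr)
    assume "\<kappa> \<noteq> 0"
    have decay: "\<exists>k\<ge>K. exp (- a * (of_int k + y)) * c < e" if "e > 0" "c > 0" for e c
    proof -
      define k where "k = max K \<lceil>c / (e * a) - y\<rceil>"
      have "c / (e * a) \<le> of_int k + y" unfolding k_def by linarith
      then have "c / e \<le> a * (of_int k + y)" using a that by (simp add: field_simps)
      also have "\<dots> < exp (a * (of_int k + y))" using exp_ge_add_one_self[of "a * (of_int k + y)"] by linarith
      finally have "c / e < exp (a * (of_int k + y))" .
      moreover have "exp (- w) * c < e" if "c / e < exp w" for w
        using that \<open>e > 0\<close> by (simp add: exp_minus field_simps)
      ultimately have "exp (- a * (of_int k + y)) * c < e" by (simp only: mult_minus_left)
      then show ?thesis by (intro exI[of _ k]) (simp add: k_def)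
    qed
    show False
    proof (cases "\<kappa> > 0")
      \<comment> \<open>If \<open>\<kappa> > 0\<close> then \<open>G \<ge> \<kappa>\<close> everywhere, and no fibre has finite mass.\<close>
      case True
      have "ennreal \<kappa> * of_nat (Suc n) \<le> fibre_sum (\<lambda>x. ennreal (G x)) y" for n
      proof -
        have "ennreal \<kappa> * of_nat (Suc n) = (\<Sum>k\<in>{0..int n}. ennreal \<kappa>)"
        proof -
          have "card {0..int n} = Suc n" by simp
          then show ?thesis by (simp only: sum_constant mult.commute)
        qed
        also have "\<dots> \<le> (\<Sum>k\<in>{0..int n}. ennreal (G (of_int k + y)))"
        proof (intro sum_mono ennreal_leI)
          fix k show "\<kappa> \<le> G (of_int k + y)"
            using \<kappa>[of "of_int k + y"] monoD[OF Pmono, of "of_int k + y - 1" "of_int k + y"] by simp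
        qed
        also have "\<dots> \<le> fibre_sum (\<lambda>x. ennreal (G x)) y"
          unfolding fibre_sum_def by (rule sum_le_nn_integral_count_space) simp
        finally show ?thesis .
      qed
      moreover obtain r where r: "fibre_sum (\<lambda>x. ennreal (G x)) y = ennreal r" "0 \<le> r"
        using y by (cases "fibre_sum (\<lambda>x. ennreal (G x)) y") auto
      ultimately have "ennreal (\<kappa> * real (Suc n)) \<le> ennreal r" for n
        using True by (simp add: ennreal_mult ennreal_of_nat_eq_real_of_nat)
      then have "\<kappa> * real (Suc n) \<le> r" for n using r(2) by (simp only: ennreal_le_iff)
      moreover obtain n where "r < \<kappa> * real n" using True ex_less_of_nat_mult[of \<kappa> r] by (auto simp: mult.commute)
      ultimately show False using True by (smt (verit) mult_left_mono of_nat_Suc)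
    next
      case False
      \<comment> \<open>If \<open>\<kappa> < 0\<close> then \<open>q\<close> has integral at least \<open>- \<kappa>\<close> over every unit interval.
        But \<open>G\<close> is small at the points of one fibre far on the right, hence bounded between them,
        and \<open>q = exp (- a x) G\<^sup>2\<close> tends to \<open>0\<close>.\<close>
      define b where "b = - \<kappa>"
      have b: "b > 0" using False \<open>\<kappa> \<noteq> 0\<close> by (simp add: b_def)
      have Gb: "G x \<le> b + 2" if "k \<ge> K" "of_int k + y \<le> x" "x \<le> of_int k + y + 1" for k x
      proof -
        have "P x \<le> P (of_int (k + 1) + y)" "P (of_int k + y - 1) \<le> P (x - 1)"
          using that by (auto intro!: monoD[OF Pmono])
        moreover have "G (of_int (k + 1) + y) \<le> 1" "G (of_int k + y) \<le> 1"
          using K[of "k + 1"] K[of k] that(1) by simp_all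
        moreover have "of_int (k + 1) + y - 1 = of_int k + y" by simp
        ultimately show ?thesis
          using \<kappa>[of x] \<kappa>[of "of_int (k + 1) + y"] \<kappa>[of "of_int k + y"] by (simp add: b_def)
      qed
      obtain k where k: "k \<ge> K" "exp (- a * (of_int k + y)) * (b + 2)\<^sup>2 < b"
        using decay[of b "(b + 2)\<^sup>2"] b by auto
      define x where "x = of_int k + y"
      have "\<exists>z>x. z < x + 1 \<and> P (x + 1) - P x = (x + 1 - x) * q z"
        by (rule MVT2) (use P in auto)
      then obtain z where z: "x < z" "z < x + 1" "P (x + 1) - P x = q z" by auto
      have "q z = exp (- a * z) * (G z)\<^sup>2"
        by (simp add: q_def G_def power_mult_distrib power2_eq_square exp_minus)
      also have "\<dots> \<le> exp (- a * x) * (b + 2)\<^sup>2"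
        using z a G0[of z] Gb[OF k(1), of z] by (intro mult_mono power_mono) (auto simp: x_def)
      also have "\<dots> < b" using k(2) by (simp add: x_def)
      finally show False using \<kappa>[of "x + 1"] G0[of "x + 1"] z(3) by (simp add: b_def)
    qed
  qed
  then have GP: "G x = P x - P (x - 1)" for x using \<kappa>[of x] by simp
  have "fibre_sum (\<lambda>x. ennreal (G x)) z = fibre_sum (\<lambda>x. ennreal (G x)) y" for z
    unfolding GP by (intro antisym fibre_sum_increment_le Pmono)
  moreover obtain r where r: "fibre_sum (\<lambda>x. ennreal (G x)) y = ennreal r" "0 \<le> r"
    using y by (cases "fibre_sum (\<lambda>x. ennreal (G x)) y") auto
  ultimately show ?thesis by (intro that[of r]) (auto simp: G_def)
qed

lemma profile_fibre_sum:
  assumes mono: "mono \<Phi>" and nn: "\<And>x. 0 \<le> \<Phi> x" and le: "\<And>x. \<Phi> x \<le> M"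
    and der: "\<And>x. (\<Phi> has_real_derivative exp (- a * x) * (\<Phi> x - \<Phi> (x - 1))\<^sup>2) (at x)"
    and left: "(\<Phi> \<longlongrightarrow> 0) at_bot" and right: "(\<Phi> \<longlongrightarrow> M) at_top"
  shows "fibre_sum (\<lambda>x. ennreal (\<Phi> x - \<Phi> (x - 1))) y = ennreal M"
proof -
  have "(\<integral>\<^sup>+k. ennreal (\<Phi> (y + of_int k - 0) - \<Phi> (y + of_int (k - 1) - 0)) \<partial>count_space UNIV) = ennreal M"
    by (rule flow_mass[OF profile_cumulative_flow[OF mono nn der left] le profile_uniform_tails[OF left right]]) simp
  then show ?thesis unfolding fibre_sum_def by (simp add: algebra_simps)
qed

lemma profile_stationary:
  assumes mono: "mono \<Phi>" and nn: "\<And>x. 0 \<le> \<Phi> x" and le: "\<And>x. \<Phi> x \<le> M"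
    and der: "\<And>x. (\<Phi> has_real_derivative exp (- a * x) * (\<Phi> x - \<Phi> (x - 1))\<^sup>2) (at x)"
    and left: "(\<Phi> \<longlongrightarrow> 0) at_bot" and right: "(\<Phi> \<longlongrightarrow> M) at_top"
  shows "is_stationary a (\<lambda>x. exp (- a * x) * (\<Phi> x - \<Phi> (x - 1)))"
proof -
  define g where "g x = exp (- a * x) * (\<Phi> x - \<Phi> (x - 1))" for x
  have step: "\<Phi> (x - 1) \<le> \<Phi> x" for x by (rule monoD[OF mono]) simp
  have Phi_cont: "continuous_on UNIV \<Phi>"
    by (intro continuous_at_imp_continuous_on ballI DERIV_isCont[OF der])
  have incr_cont: "continuous_on UNIV (\<lambda>x. \<Phi> x - \<Phi> (x - 1))"
    by (intro continuous_intros Phi_cont continuous_on_compose2[OF Phi_cont]) auto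
  have gcont: "continuous_on UNIV g"
    unfolding g_def by (intro continuous_intros incr_cont)
  define D where "D x = (g x)\<^sup>2 - exp (- a) * (g (x - 1))\<^sup>2 - a * g x" for x
  have gder: "(g has_real_derivative D x) (at x)" for x
  proof -
    have d: "((\<lambda>x. \<Phi> (x - 1)) has_real_derivative
       exp (- a * (x - 1)) * (\<Phi> (x - 1) - \<Phi> (x - 1 - 1))\<^sup>2 * 1) (at x)"
      by (rule DERIV_chain'[OF _ der]) (auto intro!: derivative_eq_intros)
    have "(g has_real_derivative - a * exp (- a * x) * (\<Phi> x - \<Phi> (x - 1)) + exp (- a * x) *
       (exp (- a * x) * (\<Phi> x - \<Phi> (x - 1))\<^sup>2 - exp (- a * (x - 1)) * (\<Phi> (x - 1) - \<Phi> (x - 1 - 1))\<^sup>2)) (at x)"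
      unfolding g_def by (rule derivative_eq_intros der d refl | simp)+
    moreover have "- a * exp (- a * x) * (\<Phi> x - \<Phi> (x - 1)) + exp (- a * x) *
       (exp (- a * x) * (\<Phi> x - \<Phi> (x - 1))\<^sup>2 - exp (- a * (x - 1)) * (\<Phi> (x - 1) - \<Phi> (x - 1 - 1))\<^sup>2) = D x"
    proof -
      have e0: "- a * exp (- a * x) * (\<Phi> x - \<Phi> (x - 1)) = - (a * g x)" by (simp add: g_def)
      have e1: "exp (- a * x) * (exp (- a * x) * (\<Phi> x - \<Phi> (x - 1))\<^sup>2) = (g x)\<^sup>2"
        by (simp add: g_def power2_eq_square)
      have "exp (- a * x) = exp (- a) * exp (- a * (x - 1))"
        unfolding exp_add[symmetric] by (rule arg_cong[of _ _ exp]) (simp add: algebra_simps)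
      then have e2: "exp (- a * x) * (exp (- a * (x - 1)) * (\<Phi> (x - 1) - \<Phi> (x - 1 - 1))\<^sup>2) = exp (- a) * (g (x - 1))\<^sup>2"
        by (simp only: g_def) (simp only: power2_eq_square mult_ac)
      show ?thesis
        unfolding e0 right_diff_distrib[of "exp (- a * x)" "exp (- a * x) * _"] e1 e2 by (simp add: D_def)
    qed
    ultimately show ?thesis by simp
  qed
  have "g C1_differentiable_on UNIV"
    unfolding C1_differentiable_on_def
  proof (intro exI conjI ballI)
    show "(g has_vector_derivative D x) (at x)" for x
      using gder by (simp add: has_real_derivative_iff_has_vector_derivative)
    show "continuous_on UNIV D"
      unfolding D_def by (intro continuous_intros gcont continuous_on_compose2[OF gcont]) auto
  qed
  moreover have incr: "exp (a * x) * g x = \<Phi> x - \<Phi> (x - 1)" for x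
    by (simp add: g_def exp_minus)
  have "integrable lebesgue (\<lambda>x. exp (a * x) * g x)"
    unfolding incr
  proof (rule integrableI_nonneg)
    show meas: "(\<lambda>x. \<Phi> x - \<Phi> (x - 1)) \<in> borel_measurable lebesgue"
      using borel_measurable_continuous_onI[OF incr_cont] by (auto intro: measurable_completion)
    have "(\<integral>\<^sup>+x. ennreal (\<Phi> x - \<Phi> (x - 1)) \<partial>lebesgue)
        = (\<integral>\<^sup>+y\<in>{0..<1}. fibre_sum (\<lambda>x. ennreal (\<Phi> x - \<Phi> (x - 1))) y \<partial>lebesgue)"
      by (rule nn_integral_eq_fibre_sum) (use meas in measurable)
    also have "\<dots> = ennreal M"
      by (simp add: profile_fibre_sum[OF assms] nn_integral_cmult_indicator)
    finally show "(\<integral>\<^sup>+x. ennreal (\<Phi> x - \<Phi> (x - 1)) \<partial>lebesgue) < \<infinity>" by simp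
  qed (use step in auto)
  moreover have "deriv g x = D x" for x using gder by (rule DERIV_imp_deriv)
  ultimately have "is_stationary a g"
    unfolding is_stationary_def using step by (intro conjI allI) (simp_all add: D_def g_def)
  then show ?thesis by (simp add: g_def[abs_def])
qed

section \<open>Convergence if and only if the fibre mass is constant\<close>

lemma continuous_imp_lebesgue_measurable:
  fixes f :: "real \<Rightarrow> real"
  assumes "continuous_on UNIV f"
  shows "f \<in> borel_measurable lebesgue"
  using borel_measurable_continuous_onI[OF assms] by (auto intro: measurable_completion)

lemma stationary_measurable:
  assumes "is_stationary a g"
  shows "g \<in> borel_measurable lebesgue"
proof (rule continuous_imp_lebesgue_measurable)
  have "g C1_differentiable_on UNIV" using assms unfolding is_stationary_def by blast
  then show "continuous_on UNIV g" by (rule C1_differentiable_imp_continuous_on)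
qed

lemma solution_fibre_mass_conserved:
  assumes a: "a > 0" and sol: "is_solution a h0 h" and B: "\<And>x. h0 x \<le> B"
    and M: "fibre_sum (\<lambda>x. ennreal (exp (a * x) * h0 x)) y = ennreal M" "0 \<le> M" and t: "t \<ge> 0"
  shows "fibre_sum (\<lambda>x. ennreal (exp (a * x) * h t x)) (y - t) = ennreal M"
proof -
  obtain V where V: "cumulative_flow a y V"
    "\<And>k t. t \<ge> 0 \<Longrightarrow> V k t - V (k - 1) t = exp (a * (y + of_int k - t)) * h t (y + of_int k - t)"
    "\<And>k t. t \<ge> 0 \<Longrightarrow> V k t \<le> M" "uniform_tails y M V"
    using solution_cumulative_flow[OF a sol B M] by blast
  have "fibre_sum (\<lambda>x. ennreal (exp (a * x) * h t x)) (y - t)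
      = (\<integral>\<^sup>+k. ennreal (V k t - V (k - 1) t) \<partial>count_space UNIV)"
    unfolding fibre_sum_def V(2)[OF t] by (simp add: algebra_simps)
  also have "\<dots> = ennreal M" by (rule flow_mass[OF V(1) V(3)[OF t] V(4) t])
  finally show ?thesis .
qed

text \<open>
At time \<open>t\<close> the characteristics issued from the fibre of \<open>y\<close> occupy the fibre of \<open>y - t\<close>. The second part is the
domination used for passing to the limit under the integral over \<open>y\<close>.
\<close>
lemma fibre_gap_tendsto_0:
  assumes a: "a > 0" and sol: "is_solution a h0 h" and B: "\<And>x. h0 x \<le> B"
    and M: "fibre_sum (\<lambda>x. ennreal (exp (a * x) * h0 x)) y = ennreal M" "0 \<le> M"
    and mono: "mono \<Phi>" and nn: "\<And>x. 0 \<le> \<Phi> x" and le: "\<And>x. \<Phi> x \<le> M"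
    and der: "\<And>x. (\<Phi> has_real_derivative exp (- a * x) * (\<Phi> x - \<Phi> (x - 1))\<^sup>2) (at x)"
    and left: "(\<Phi> \<longlongrightarrow> 0) at_bot" and right: "(\<Phi> \<longlongrightarrow> M) at_top"
  shows "((\<lambda>t. fibre_sum (\<lambda>x. ennreal \<bar>exp (a * x) * h t x - (\<Phi> x - \<Phi> (x - 1))\<bar>) (y - t)) \<longlongrightarrow> 0) at_top"
    and "t \<ge> 0 \<Longrightarrow> fibre_sum (\<lambda>x. ennreal \<bar>exp (a * x) * h t x - (\<Phi> x - \<Phi> (x - 1))\<bar>) (y - t) \<le> ennreal (2 * M)"
proof -
  obtain V where V: "cumulative_flow a y V"
    "\<And>k t. t \<ge> 0 \<Longrightarrow> V k t - V (k - 1) t = exp (a * (y + of_int k - t)) * h t (y + of_int k - t)"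
    "\<And>k t. t \<ge> 0 \<Longrightarrow> V k t \<le> M" "uniform_tails y M V"
    using solution_cumulative_flow[OF a sol B M] by blast
  define W where "W k t = \<Phi> (y + of_int k - t)" for k :: int and t
  have W: "cumulative_flow a y W" "uniform_tails y M W" "\<And>k t. W k t \<le> M"
    unfolding W_def[abs_def]
    by (rule profile_cumulative_flow[OF mono nn der left] profile_uniform_tails[OF left right] le)+
  have eq: "fibre_sum (\<lambda>x. ennreal \<bar>exp (a * x) * h t x - (\<Phi> x - \<Phi> (x - 1))\<bar>) (y - t)
      = (\<integral>\<^sup>+k. ennreal \<bar>(V k t - V (k - 1) t) - (W k t - W (k - 1) t)\<bar> \<partial>count_space UNIV)"
    if t: "t \<ge> 0" for t
  proof -
    have "of_int k + (y - t) = y + of_int k - t" "y + of_int k - t - 1 = y + of_int (k - 1) - t" for k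
      by simp_all
    then show ?thesis unfolding fibre_sum_def V(2)[OF t] W_def by (simp only:)
  qed
  have "((\<lambda>t. \<integral>\<^sup>+k. ennreal \<bar>(V k t - V (k - 1) t) - (W k t - W (k - 1) t)\<bar> \<partial>count_space UNIV)
           \<longlongrightarrow> 0) at_top"
    by (rule flows_merge_l1[OF V(1) W(1) a V(3) W(3) V(4) W(2)]) auto
  then show "((\<lambda>t. fibre_sum (\<lambda>x. ennreal \<bar>exp (a * x) * h t x - (\<Phi> x - \<Phi> (x - 1))\<bar>) (y - t)) \<longlongrightarrow> 0) at_top"
    by (rule Lim_transform_eventually)
       (use eventually_ge_at_top[of 0] in eventually_elim, simp only: eq)
  show "fibre_sum (\<lambda>x. ennreal \<bar>exp (a * x) * h t x - (\<Phi> x - \<Phi> (x - 1))\<bar>) (y - t) \<le> ennreal (2 * M)"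
    if t: "t \<ge> 0"
  proof -
    have "(\<integral>\<^sup>+k. ennreal \<bar>(V k t - V (k - 1) t) - (W k t - W (k - 1) t)\<bar> \<partial>count_space UNIV)
      \<le> (\<integral>\<^sup>+k. ennreal (V k t - V (k - 1) t) + ennreal (W k t - W (k - 1) t) \<partial>count_space UNIV)"
    proof (rule nn_integral_mono)
      fix k
      have "ennreal \<bar>(V k t - V (k - 1) t) - (W k t - W (k - 1) t)\<bar>
         \<le> ennreal ((V k t - V (k - 1) t) + (W k t - W (k - 1) t))"
        using flow_step[OF V(1) t, of k] flow_step[OF W(1) t, of k] by (intro ennreal_leI) simp
      also have "\<dots> = ennreal (V k t - V (k - 1) t) + ennreal (W k t - W (k - 1) t)"
        using flow_step[OF V(1) t, of k] flow_step[OF W(1) t, of k] by (intro ennreal_plus) auto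
      finally show "ennreal \<bar>(V k t - V (k - 1) t) - (W k t - W (k - 1) t)\<bar>
         \<le> ennreal (V k t - V (k - 1) t) + ennreal (W k t - W (k - 1) t)" .
    qed
    also have "\<dots> = ennreal M + ennreal M"
      by (subst nn_integral_add) (simp_all add: flow_mass[OF V(1) V(3)[OF t] V(4) t] flow_mass[OF W(1) W(3) W(2) t])
    also have "\<dots> = ennreal (2 * M)" using M(2) by (simp add: ennreal_plus[symmetric] del: ennreal_plus)
    finally show ?thesis by (simp only: eq[OF t])
  qed
qed

text \<open>
Translating by \<open>t\<close> before decomposing into fibres labels each fibre by its position at time \<open>0\<close>, where the set of
exceptional fibres does not depend on \<open>t\<close>.
\<close>
lemma weighted_distance_eq_fibres:
  assumes h: "h \<in> borel_measurable lebesgue" and g: "g \<in> borel_measurable lebesgue"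
  shows "(\<integral>\<^sup>+x. ennreal (exp (a * x) * \<bar>h x - g x\<bar>) \<partial>lebesgue)
     = (\<integral>\<^sup>+y\<in>{0..<1}. fibre_sum (\<lambda>x. ennreal \<bar>exp (a * x) * h x - exp (a * x) * g x\<bar>) (y - t) \<partial>lebesgue)"
    and "(\<lambda>y. fibre_sum (\<lambda>x. ennreal \<bar>exp (a * x) * h x - exp (a * x) * g x\<bar>) (y - t)) \<in> borel_measurable lebesgue"
proof -
  define f where "f x = ennreal \<bar>exp (a * x) * h x - exp (a * x) * g x\<bar>" for x
  have e: "(\<lambda>x. exp (a * x)) \<in> borel_measurable lebesgue"
    by (intro continuous_imp_lebesgue_measurable continuous_intros) 
  have f: "f \<in> borel_measurable lebesgue"
    unfolding f_def[abs_def] using e h g by measurable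
  have shift: "fibre_sum f (y - t) = fibre_sum (\<lambda>x. f (- t + x)) y" for y
    unfolding fibre_sum_def by (simp add: algebra_simps)
  have ft: "(\<lambda>x. f (- t + x)) \<in> borel_measurable lebesgue" by (rule measurable_translate_lebesgue[OF f])
  show "(\<lambda>y. fibre_sum (\<lambda>x. ennreal \<bar>exp (a * x) * h x - exp (a * x) * g x\<bar>) (y - t)) \<in> borel_measurable lebesgue"
    unfolding f_def[symmetric] shift using measurable_fibre_sum[OF ft] .
  have "exp (a * x) * \<bar>h x - g x\<bar> = \<bar>exp (a * x) * h x - exp (a * x) * g x\<bar>" for x
    by (simp add: right_diff_distrib[symmetric] abs_mult)
  then have "(\<integral>\<^sup>+x. ennreal (exp (a * x) * \<bar>h x - g x\<bar>) \<partial>lebesgue) = (\<integral>\<^sup>+x. f x \<partial>lebesgue)"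
    by (simp add: f_def)
  also have "\<dots> = (\<integral>\<^sup>+x. f (- t + x) \<partial>lebesgue)" by (rule nn_integral_translate_lebesgue[OF f, symmetric])
  also have "\<dots> = (\<integral>\<^sup>+y\<in>{0..<1}. fibre_sum f (y - t) \<partial>lebesgue)"
    unfolding shift by (rule nn_integral_eq_fibre_sum[OF ft])
  finally show "(\<integral>\<^sup>+x. ennreal (exp (a * x) * \<bar>h x - g x\<bar>) \<partial>lebesgue)
     = (\<integral>\<^sup>+y\<in>{0..<1}. fibre_sum (\<lambda>x. ennreal \<bar>exp (a * x) * h x - exp (a * x) * g x\<bar>) (y - t) \<partial>lebesgue)"
    by (simp add: f_def[abs_def])
qed

lemma converges_of_constant_mass:
  assumes a: "a > 0" and sol: "is_solution a h0 h" and meas: "h0 \<in> borel_measurable lebesgue"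
    and B: "\<And>x. h0 x \<le> B" and "0 \<le> M"
    and const: "AE y in lebesgue. y \<in> {0..<1} \<longrightarrow> fibre_sum (\<lambda>x. ennreal (exp (a * x) * h0 x)) y = ennreal M"
  obtains g where "is_stationary a g"
    "((\<lambda>t. \<integral>\<^sup>+x. ennreal (exp (a * x) * \<bar>h t x - g x\<bar>) \<partial>lebesgue) \<longlongrightarrow> 0) at_top"
proof -
  obtain \<Phi> where \<Phi>: "mono \<Phi>" "\<And>x. 0 \<le> \<Phi> x" "\<And>x. \<Phi> x \<le> M"
    "\<And>x. (\<Phi> has_real_derivative exp (- a * x) * (\<Phi> x - \<Phi> (x - 1))\<^sup>2) (at x)"
    "(\<Phi> \<longlongrightarrow> 0) at_bot" "(\<Phi> \<longlongrightarrow> M) at_top"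
    using exists_stationary_cumulative[OF a \<open>0 \<le> M\<close>] by blast
  define g where "g x = exp (- a * x) * (\<Phi> x - \<Phi> (x - 1))" for x
  have st: "is_stationary a g" unfolding g_def[abs_def] by (rule profile_stationary[OF \<Phi>])
  have incr: "exp (a * x) * g x = \<Phi> x - \<Phi> (x - 1)" for x by (simp add: g_def exp_minus)
  have gm: "g \<in> borel_measurable lebesgue" by (rule stationary_measurable[OF st])
  define S where "S t y = fibre_sum (\<lambda>x. ennreal \<bar>exp (a * x) * h t x - exp (a * x) * g x\<bar>) (y - t)" for t y
  have hm: "(\<lambda>x. h t x) \<in> borel_measurable lebesgue" if "t \<ge> 0" for t
    by (rule solution_measurable[OF a sol meas that])
  have N: "(\<integral>\<^sup>+x. ennreal (exp (a * x) * \<bar>h t x - g x\<bar>) \<partial>lebesgue) = (\<integral>\<^sup>+y\<in>{0..<1}. S t y \<partial>lebesgue)"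
    and Sm: "S t \<in> borel_measurable lebesgue" if "t \<ge> 0" for t
    unfolding S_def[abs_def] by (rule weighted_distance_eq_fibres[OF hm[OF that] gm])+
  have S0: "AE y in lebesgue. y \<in> {0..<1} \<longrightarrow> ((\<lambda>t. S t y) \<longlongrightarrow> 0) at_top"
    using const
  proof eventually_elim
    case (elim y)
    then show ?case unfolding S_def incr
      using fibre_gap_tendsto_0(1)[OF a sol B _ \<open>0 \<le> M\<close> \<Phi>] by blast
  qed
  have Sle: "AE y in lebesgue. y \<in> {0..<1} \<longrightarrow> (\<forall>t\<ge>0. S t y \<le> ennreal (2 * M))"
    using const
  proof eventually_elim
    case (elim y)
    then show ?case unfolding S_def incr
      using fibre_gap_tendsto_0(2)[OF a sol B _ \<open>0 \<le> M\<close> \<Phi>] by blast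
  qed
  have "((\<lambda>t. \<integral>\<^sup>+y\<in>{0..<1}. S t y \<partial>lebesgue) \<longlongrightarrow> 0) at_top"
  proof (rule tendsto_at_topI_sequentially)
    fix X :: "nat \<Rightarrow> real" assume X: "filterlim X at_top sequentially"
    \<comment> \<open>The solution is only meaningful for nonnegative times, so negative terms of the sequence are replaced by \<open>0\<close>.\<close>
    define T where "T n = max 0 (X n)" for n
    have T: "filterlim T at_top sequentially"
      unfolding T_def by (rule filterlim_at_top_mono[OF X]) auto
    have "(\<lambda>n. \<integral>\<^sup>+y. S (T n) y * indicator {0..<1} y \<partial>lebesgue) \<longlonglongrightarrow> (\<integral>\<^sup>+y. 0 \<partial>(lebesgue :: real measure))"
    proof (rule nn_integral_dominated_convergence)
      show "(\<lambda>y. S (T n) y * indicator {0..<1} y) \<in> borel_measurable lebesgue" for n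
        by (intro borel_measurable_times_ennreal Sm borel_measurable_indicator) (auto simp: T_def)
      show "(\<lambda>y. ennreal (2 * M) * indicator {0..<1} y) \<in> borel_measurable (lebesgue :: real measure)"
        by (intro borel_measurable_times_ennreal borel_measurable_indicator) auto
      show "(\<integral>\<^sup>+y. ennreal (2 * M) * indicator {0..<1} y \<partial>(lebesgue :: real measure)) < \<infinity>"
        by (simp add: nn_integral_cmult_indicator)
      show "AE y in lebesgue. S (T n) y * indicator {0..<1} y \<le> ennreal (2 * M) * indicator {0..<1} y" for n
        using Sle by eventually_elim (auto simp: indicator_def T_def)
      show "AE y in lebesgue. (\<lambda>n. S (T n) y * indicator {0..<1} y) \<longlonglongrightarrow> 0"
        using S0
      proof eventually_elim
        case (elim y)
        then show ?case
          by (cases "y \<in> {0..<1}") (auto simp: indicator_def intro: filterlim_compose[OF _ T])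
      qed
    qed auto
    then have "(\<lambda>n. \<integral>\<^sup>+y\<in>{0..<1}. S (T n) y \<partial>lebesgue) \<longlonglongrightarrow> 0" by simp
    moreover have "\<forall>\<^sub>F n in sequentially. T n = X n"
      using X[unfolded filterlim_at_top, rule_format, of 0] by eventually_elim (simp add: T_def)
    then have "\<forall>\<^sub>F n in sequentially. (\<integral>\<^sup>+y\<in>{0..<1}. S (T n) y \<partial>lebesgue) = (\<integral>\<^sup>+y\<in>{0..<1}. S (X n) y \<partial>lebesgue)"
      by eventually_elim simp
    ultimately show "(\<lambda>n. \<integral>\<^sup>+y\<in>{0..<1}. S (X n) y \<partial>lebesgue) \<longlonglongrightarrow> 0"
      by (rule Lim_transform_eventually)
  qed
  then have "((\<lambda>t. \<integral>\<^sup>+x. ennreal (exp (a * x) * \<bar>h t x - g x\<bar>) \<partial>lebesgue) \<longlongrightarrow> 0) at_top"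
    by (rule Lim_transform_eventually)
       (use eventually_ge_at_top[of 0] in eventually_elim, simp only: N)
  with st show ?thesis by (rule that)
qed

text \<open>
On each fibre the conserved mass of the solution differs from the mass \<open>c\<close> of the stationary solution by at most
the distance on that fibre. Integrated over the fibres this distance tends to \<open>0\<close>, whereas the
difference of the masses does not depend on time.
\<close>
lemma constant_mass_of_convergence:
  assumes a: "a > 0" and sol: "is_solution a h0 h" and meas: "h0 \<in> borel_measurable lebesgue"
    and B: "\<And>x. h0 x \<le> B"
    and fin: "AE y in lebesgue. y \<in> {0..<1} \<longrightarrow> fibre_sum (\<lambda>x. ennreal (exp (a * x) * h0 x)) y < \<infinity>"
    and st: "is_stationary a g"
    and lim: "((\<lambda>t. \<integral>\<^sup>+x. ennreal (exp (a * x) * \<bar>h t x - g x\<bar>) \<partial>lebesgue) \<longlongrightarrow> 0) at_top"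
  shows "\<exists>c. AE y in lebesgue. y \<in> {0..<1} \<longrightarrow> fibre_sum (\<lambda>x. ennreal (exp (a * x) * h0 x)) y = c"
proof -
  define m where "m = fibre_sum (\<lambda>x. ennreal (exp (a * x) * h0 x))"
  obtain c where c: "0 \<le> c" "\<And>y. fibre_sum (\<lambda>x. ennreal (exp (a * x) * g x)) y = ennreal c"
    using stationary_fibre_sum_constant[OF a st] by blast
  have gnn: "g x \<ge> 0" for x using st unfolding is_stationary_def by blast
  have hnn: "h t x \<ge> 0" if "t \<ge> 0" for t x using sol that by (simp add: is_solution_def)
  have gm: "g \<in> borel_measurable lebesgue" by (rule stationary_measurable[OF st])
  define S where "S n y = fibre_sum (\<lambda>x. ennreal \<bar>exp (a * x) * h n x - exp (a * x) * g x\<bar>) (y - n)" for n :: real and y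
  define N where "N t = (\<integral>\<^sup>+x. ennreal (exp (a * x) * \<bar>h t x - g x\<bar>) \<partial>lebesgue)" for t
  have N: "N t = (\<integral>\<^sup>+y\<in>{0..<1}. S t y \<partial>lebesgue)" if "t \<ge> 0" for t
    unfolding S_def[abs_def] N_def
    by (rule weighted_distance_eq_fibres(1)[OF solution_measurable[OF a sol meas that] gm])
  have close: "m y \<le> ennreal c + S t y" "ennreal c \<le> m y + S t y" if fy: "m y < \<infinity>" and t: "t \<ge> 0" for t y
  proof -
    obtain M where M: "m y = ennreal M" "0 \<le> M" using fy by (cases "m y") auto
    have mass: "fibre_sum (\<lambda>x. ennreal (exp (a * x) * h t x)) (y - t) = m y"
      using solution_fibre_mass_conserved[OF a sol B M(1)[unfolded m_def] M(2) t] M(1) by simp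
    have tri: "ennreal p \<le> ennreal q + ennreal \<bar>r\<bar>" if "p \<le> q + \<bar>r\<bar>" "0 \<le> q" for p q r :: real
      using ennreal_leI[OF that(1)] that(2) by (simp add: ennreal_plus)
    have "fibre_sum (\<lambda>x. ennreal (exp (a * x) * h t x)) (y - t)
       \<le> fibre_sum (\<lambda>x. ennreal (exp (a * x) * g x) + ennreal \<bar>exp (a * x) * h t x - exp (a * x) * g x\<bar>) (y - t)"
      by (intro fibre_sum_mono tri) (use gnn in auto)
    then show "m y \<le> ennreal c + S t y"
      unfolding fibre_sum_add mass c(2) S_def .
    have "fibre_sum (\<lambda>x. ennreal (exp (a * x) * g x)) (y - t)
       \<le> fibre_sum (\<lambda>x. ennreal (exp (a * x) * h t x) + ennreal \<bar>exp (a * x) * h t x - exp (a * x) * g x\<bar>) (y - t)"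
      by (intro fibre_sum_mono tri) (use hnn[OF t] in auto)
    then show "ennreal c \<le> m y + S t y"
      unfolding fibre_sum_add mass c(2) S_def .
  qed
  have e: "(\<lambda>x. exp (a * x)) \<in> borel_measurable lebesgue"
    by (intro continuous_imp_lebesgue_measurable continuous_intros)
  have mm: "m \<in> borel_measurable lebesgue"
    unfolding m_def by (intro measurable_fibre_sum) (use e meas in measurable)
  have lim_le: "x = 0" if "\<And>t. t \<ge> 0 \<Longrightarrow> x \<le> N t" for x
  proof -
    have "\<forall>\<^sub>F t in at_top. x \<le> N t"
      using eventually_ge_at_top[of "0::real"] by eventually_elim (rule that)
    then have "x \<le> 0"
      by (intro tendsto_lowerbound[OF lim[folded N_def]]) auto
    then show ?thesis by simp
  qed
  have "(\<integral>\<^sup>+y\<in>{0..<1}. (m y - ennreal c) \<partial>lebesgue) = 0"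
  proof (rule lim_le)
    fix t :: real assume t: "t \<ge> 0"
    show "(\<integral>\<^sup>+y\<in>{0..<1}. (m y - ennreal c) \<partial>lebesgue) \<le> N t"
      unfolding N[OF t]
    proof (rule nn_integral_mono_AE)
      show "AE y in lebesgue. (m y - ennreal c) * indicator {0..<1} y \<le> S t y * indicator {0..<1} y"
        using fin
      proof eventually_elim
        case (elim y)
        then show ?case using close(1)[of y t] t
          by (auto simp: indicator_def m_def ennreal_minus_le_iff)
      qed
    qed
  qed
  then have "AE y in lebesgue. (m y - ennreal c) * indicator {0..<1} y = 0"
    by (subst (asm) nn_integral_0_iff_AE) (auto intro!: borel_measurable_times_ennreal borel_measurable_indicator mm borel_measurable_minus_ennreal)
  moreover have "(\<integral>\<^sup>+y\<in>{0..<1}. (ennreal c - m y) \<partial>lebesgue) = 0"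
  proof (rule lim_le)
    fix t :: real assume t: "t \<ge> 0"
    show "(\<integral>\<^sup>+y\<in>{0..<1}. (ennreal c - m y) \<partial>lebesgue) \<le> N t"
      unfolding N[OF t]
    proof (rule nn_integral_mono_AE)
      show "AE y in lebesgue. (ennreal c - m y) * indicator {0..<1} y \<le> S t y * indicator {0..<1} y"
        using fin
      proof eventually_elim
        case (elim y)
        then show ?case using close(2)[of y t] t
          by (auto simp: indicator_def m_def ennreal_minus_le_iff)
      qed
    qed
  qed
  then have "AE y in lebesgue. (ennreal c - m y) * indicator {0..<1} y = 0"
    by (subst (asm) nn_integral_0_iff_AE) (auto intro!: borel_measurable_times_ennreal borel_measurable_indicator mm borel_measurable_minus_ennreal)
  ultimately have "AE y in lebesgue. y \<in> {0..<1} \<longrightarrow> m y = ennreal c"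
    using fin
  proof eventually_elim
    case (elim y)
    show ?case
    proof
      assume y: "y \<in> {0..<1}"
      then have "m y - ennreal c = 0" "ennreal c - m y = 0" "m y < \<infinity>" using elim by (auto simp: m_def)
      then show "m y = ennreal c"
        by (auto simp: diff_eq_0_iff_ennreal intro: antisym)
    qed
  qed
  then show ?thesis unfolding m_def by blast
qed

theorem corollary2p3:
  fixes \<gamma> :: real and h0 :: "real \<Rightarrow> real" and h :: "real \<Rightarrow> real \<Rightarrow> real"
  assumes "\<gamma> < 1"
    and "h0 \<in> borel_measurable lebesgue"
    and "bounded (range h0)"
    and "\<And>x. h0 x \<ge> 0"
    and "m0 (alpha \<gamma>) h0 \<in> borel_measurable (lebesgue_on {0<..<1})"
    and "(\<integral>\<^sup>+ \<theta>. m0 (alpha \<gamma>) h0 \<theta> \<partial>lebesgue_on {0<..<1}) < \<infinity>"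
    and "is_solution (alpha \<gamma>) h0 h"
  shows "(\<exists>hinf. is_stationary (alpha \<gamma>) hinf \<and>
            ((\<lambda>t. \<integral>\<^sup>+ x. ennreal (exp (alpha \<gamma> * x) * \<bar>h t x - hinf x\<bar>) \<partial>lebesgue)
               \<longlongrightarrow> 0) at_top)
         \<longleftrightarrow> (\<exists>c. AE \<theta> in lebesgue_on {0..<1}. m0 (alpha \<gamma>) h0 \<theta> = c)"
proof -
  define a where "a = alpha \<gamma>"
  have a: "a > 0" using \<open>\<gamma> < 1\<close> by (simp add: a_def alpha_def)
  define m where "m = fibre_sum (\<lambda>x. ennreal (exp (a * x) * h0 x))"
  have m0: "m0 (alpha \<gamma>) h0 = m" by (simp add: m_def a_def m0_eq_fibre_sum)
  obtain B where "\<forall>x\<in>range h0. norm x \<le> B" using assms(3) by (auto simp: bounded_iff)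
  then have B: "h0 x \<le> B" for x by (force dest: abs_le_D1)
  have sol: "is_solution a h0 h" using assms(7) by (simp add: a_def)
  have fin: "AE y in lebesgue. y \<in> {0..<1} \<longrightarrow> m y < \<infinity>"
  proof -
    have "AE y in lebesgue_on {0<..<1}. m y \<noteq> \<infinity>"
      by (rule nn_integral_PInf_AE) (use assms(5,6) in \<open>auto simp: m0\<close>)
    then have "AE y in lebesgue. y \<in> {0<..<1} \<longrightarrow> m y \<noteq> \<infinity>"
      by (subst (asm) AE_restrict_space_iff) auto
    moreover have "AE y in lebesgue. y \<noteq> (0::real)"
      by (rule AE_completion) (rule AE_lborel_singleton)
    ultimately show ?thesis by eventually_elim (auto simp: less_top)
  qed
  have AE_iff: "(AE \<theta> in lebesgue_on {0..<1}. m0 (alpha \<gamma>) h0 \<theta> = c)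
      \<longleftrightarrow> (AE y in lebesgue. y \<in> {0..<1} \<longrightarrow> m y = c)" for c
    by (subst AE_restrict_space_iff) (auto simp: m0)
  show ?thesis
    unfolding AE_iff unfolding a_def[symmetric]
  proof
    assume "\<exists>hinf. is_stationary a hinf \<and>
      ((\<lambda>t. \<integral>\<^sup>+ x. ennreal (exp (a * x) * \<bar>h t x - hinf x\<bar>) \<partial>lebesgue) \<longlongrightarrow> 0) at_top"
    then show "\<exists>c. AE y in lebesgue. y \<in> {0..<1} \<longrightarrow> m y = c"
      using constant_mass_of_convergence[OF a sol assms(2) B fin[unfolded m_def]] unfolding m_def by blast
  next
    assume "\<exists>c. AE y in lebesgue. y \<in> {0..<1} \<longrightarrow> m y = c"
    then obtain c where c: "AE y in lebesgue. y \<in> {0..<1} \<longrightarrow> m y = c" by blast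
    have "AE y in lebesgue. y \<in> {0<..<1} \<longrightarrow> m y < \<infinity> \<and> m y = c"
      using c fin by eventually_elim auto
    then have "c < \<infinity>" by (rule AE_unit_interval_witness) auto
    then obtain M where M: "c = ennreal M" "0 \<le> M" by (cases c) auto
    show "\<exists>hinf. is_stationary a hinf \<and>
      ((\<lambda>t. \<integral>\<^sup>+ x. ennreal (exp (a * x) * \<bar>h t x - hinf x\<bar>) \<partial>lebesgue) \<longlongrightarrow> 0) at_top"
      using converges_of_constant_mass[OF a sol assms(2) B M(2) c[unfolded m_def M(1)]] by blast
  qed
qed

end
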